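(* For every $\varepsilon>0$ there is an integer $q\geq1$ such that for every $N\geq 1$, if $f\in\mathcal{C}^1(\mathbb{T}^N)$ satisfies $\|\vec{\partial}f\|_{L_1\ell_1^N}\leq1$ and $\|f-\int f\|_2\leq1$, then there is some $S\subseteq[N]$ with $|S|\leq q$ such that \[\|f-E_Sf\|_1<\varepsilon.\] The same result holds for functions on $[0,1]^N$, possibly with a different dependence of $q$ on $\varepsilon$: for every $\varepsilon>0$ there is an integer $q'\geq1$ such that for every $N\geq1$, if $f\in\mathcal{C}^1([0,1]^N)$ satisfies $\|\vec{\partial}f\|_{L_1\ell_1^N}\leq1$ and $\|f-\int f\|_2\leq1$, then there is some $S\subseteq[N]$ with $|S|\leq q'$ such that $\|f-E_Sf\|_1<\varepsilon$.
   Context: $\mathbb{T}:=\mathbb{R}/\mathbb{Z}$. All integrals and the $L_p$ norms $\|\cdot\|_p$ are with respect to the Haar probability measure on $\mathbb{T}^N$ (resp. Lebesgue measure on $[0,1]^N$). $\partial_nf$ is the partial derivative in the $n$-th coordinate, $\vec{\partial}f:=(\partial_nf)_{n=1}^N$, and \[\|\vec{\partial}f\|_{L_1\ell_1^N}:=\sum_{n=1}^N\int|\partial_nf(x)|\,\mathrm{d}x.\] $[N]=\{1,\ldots,N\}$. For $S\subseteq[N]$, $E_Sf$ is the conditional expectation obtained by integrating out (with respect to Haar probability measure on $\mathbb{T}$, resp. Lebesgue measure on $[0,1]$) all coordinates $n\in[N]\setminus S$. *)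

theory Defs
  imports "HOL-Probability.Probability"
begin

section \<open>The circle group\<close>

quotient_type circle = real / "\<lambda>x y :: real. x - y \<in> \<int>"
  morphisms rep_circle to_circle
proof (rule equivpI)
  show "reflp (\<lambda>x y :: real. x - y \<in> \<int>)"
    by (simp add: reflp_def)
  show "symp (\<lambda>x y :: real. x - y \<in> \<int>)"
    by (auto simp: symp_def intro: Ints_minus dest: Ints_minus)
  show "transp (\<lambda>x y :: real. x - y \<in> \<int>)"
    unfolding transp_def by (metis Ints_add diff_add_cancel add_diff_eq)
qed

instantiation circle :: ab_group_add
begin

lift_definition zero_circle :: circle is 0 .

lift_definition plus_circle :: "circle \<Rightarrow> circle \<Rightarrow> circle" is "(+)"
  by (metis Ints_add add_diff_add)

lift_definition uminus_circle :: "circle \<Rightarrow> circle" is uminus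
  by (metis Ints_minus minus_diff_minus)

lift_definition minus_circle :: "circle \<Rightarrow> circle \<Rightarrow> circle" is "(-)"
  by (metis Ints_diff diff_diff_eq2 diff_add_eq add.commute diff_diff_eq)

instance
  by standard (transfer; simp)+

end

instantiation circle :: topological_space
begin

definition open_circle :: "circle set \<Rightarrow> bool" where
  "open_circle U \<longleftrightarrow> open (to_circle -` U)"

instance
proof
  show "open (UNIV :: circle set)"
    by (simp add: open_circle_def)
next
  fix U V :: "circle set"
  assume "open U" "open V"
  then show "open (U \<inter> V)"
    by (simp add: open_circle_def open_Int)
next
  fix K :: "circle set set"
  assume "\<forall>U\<in>K. open U"
  then show "open (\<Union>K)"
    by (auto simp: open_circle_def vimage_Union)
qed

end

definition circle_haar :: "circle measure" where
  "circle_haar = distr (restrict_space lborel {0..<1}) borel to_circle"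

lemma to_circle_measurable [measurable]: "to_circle \<in> borel_measurable borel"
proof (rule borel_measurable_continuous_onI)
  show "continuous_on UNIV to_circle"
    unfolding continuous_on_open_vimage[OF open_UNIV] by (simp add: open_circle_def)
qed

lemma to_circle_eq_iff: "to_circle x = to_circle y \<longleftrightarrow> x - y \<in> \<int>"
  by (rule circle.abs_eq_iff)

lemma to_circle_add: "to_circle (x + y) = to_circle x + to_circle y"
  by (simp add: plus_circle.abs_eq)

lemma translation_circle_measurable [measurable]:
  "(\<lambda>x :: circle. a + x) \<in> borel_measurable borel"
proof (rule borel_measurable_continuous_onI)
  obtain s where s: "a = to_circle s"
    by (metis Quotient3_abs_rep Quotient3_circle)
  have "open ((\<lambda>x. a + x) -` U)" if "open U" for U :: "circle set"
  proof -
    have "to_circle -` (\<lambda>x. a + x) -` U = (\<lambda>t. s + t) -` (to_circle -` U)"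
      by (auto simp: s to_circle_add)
    moreover have "open ((\<lambda>t :: real. s + t) -` (to_circle -` U))"
      by (rule open_vimage[OF that[unfolded open_circle_def]]) (intro continuous_intros)
    ultimately show ?thesis
      by (simp add: open_circle_def)
  qed
  then show "continuous_on UNIV (\<lambda>x. a + x)"
    unfolding continuous_on_open_vimage[OF open_UNIV] by simp
qed

lemma emeasure_circle_haar:
  assumes "A \<in> sets borel"
  shows "emeasure circle_haar A = emeasure lborel (to_circle -` A \<inter> {0..<1})"
proof -
  have "to_circle \<in> measurable (restrict_space lborel {0..<1}) borel"
    by (intro measurable_restrict_space1) simp
  then have "emeasure circle_haar A =
      emeasure (restrict_space lborel {0..<1}) (to_circle -` A \<inter> {0..<1})"
    using assms by (simp add: circle_haar_def emeasure_distr space_restrict_space)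
  also have "\<dots> = emeasure lborel (to_circle -` A \<inter> {0..<1})"
    by (rule emeasure_restrict_space) auto
  finally show ?thesis .
qed

lemma prob_space_circle_haar: "prob_space circle_haar"
proof
  show "emeasure circle_haar (space circle_haar) = 1"
    using emeasure_circle_haar[of UNIV] by (simp add: circle_haar_def)
qed

lemma emeasure_lborel_shift:
  assumes "B \<in> sets borel"
  shows "emeasure lborel ((\<lambda>t :: real. c + t) -` B) = emeasure lborel B"
proof -
  have "emeasure lborel B = emeasure (distr lborel borel ((+) c)) B"
    by (simp add: lborel_distr_plus)
  also have "\<dots> = emeasure lborel ((\<lambda>t. c + t) -` B)"
    using assms by (subst emeasure_distr) auto
  finally show ?thesis ..
qed

lemma circle_haar_translation_invariant: "distr circle_haar borel (\<lambda>x. a + x) = circle_haar"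
proof (rule measure_eqI)
  fix A :: "circle set"
  assume "A \<in> sets (distr circle_haar borel (\<lambda>x. a + x))"
  then have A: "A \<in> sets borel" by simp
  obtain s0 where s0: "a = to_circle s0"
    by (metis Quotient3_abs_rep Quotient3_circle)
  define s where "s = frac s0"
  have s: "a = to_circle s" "0 \<le> s" "s < 1"
    by (auto simp: s_def s0 to_circle_eq_iff frac_def frac_lt_1[unfolded frac_def])
  define P where "P = to_circle -` A"
  have P [measurable]: "P \<in> sets borel"
    unfolding P_def using measurable_sets[OF to_circle_measurable A] by simp
  have per: "1 + t \<in> P \<longleftrightarrow> t \<in> P" for t
  proof -
    have "to_circle (1 + t) = to_circle t" by (simp add: to_circle_eq_iff)
    then show ?thesis by (simp add: P_def)
  qed
  have "emeasure (distr circle_haar borel (\<lambda>x. a + x)) A = emeasure circle_haar ((\<lambda>x. a + x) -` A)"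
    using A by (subst emeasure_distr) (auto simp: circle_haar_def)
  also have "\<dots> = emeasure lborel (to_circle -` (\<lambda>x. a + x) -` A \<inter> {0..<1})"
    using measurable_sets[OF translation_circle_measurable A, of a]
    by (intro emeasure_circle_haar) simp
  also have "to_circle -` (\<lambda>x. a + x) -` A \<inter> {0..<1} = (\<lambda>t. s + t) -` (P \<inter> {s..<1 + s})"
    by (auto simp: P_def s(1) to_circle_add)
  also have "emeasure lborel \<dots> = emeasure lborel (P \<inter> {s..<1 + s})"
    by (rule emeasure_lborel_shift) simp
  also have "P \<inter> {s..<1 + s} = (P \<inter> {s..<1}) \<union> (P \<inter> {1..<1 + s})"
    using s by auto
  also have "emeasure lborel \<dots> = emeasure lborel (P \<inter> {s..<1}) + emeasure lborel (P \<inter> {1..<1 + s})"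
    by (rule plus_emeasure[symmetric]) auto
  also have "emeasure lborel (P \<inter> {1..<1 + s}) =
      emeasure lborel ((\<lambda>t. 1 + t) -` (P \<inter> {1..<1 + s}))"
    by (rule emeasure_lborel_shift[symmetric]) simp
  also have "(\<lambda>t. 1 + t) -` (P \<inter> {1..<1 + s}) = P \<inter> {0..<s}"
    by (auto simp: per)
  also have "emeasure lborel (P \<inter> {s..<1}) + emeasure lborel (P \<inter> {0..<s}) =
      emeasure lborel ((P \<inter> {s..<1}) \<union> (P \<inter> {0..<s}))"
    by (rule plus_emeasure) auto
  also have "(P \<inter> {s..<1}) \<union> (P \<inter> {0..<s}) = to_circle -` A \<inter> {0..<1}"
    using s by (auto simp: P_def)
  also have "emeasure lborel \<dots> = emeasure circle_haar A"
    by (rule emeasure_circle_haar[OF A, symmetric])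
  finally show "emeasure (distr circle_haar borel (\<lambda>x. a + x)) A = emeasure circle_haar A" .
qed (simp add: circle_haar_def)

section \<open>Norms and conditional expectations\<close>

text \<open>
  Functions take values in a scalar type of sort \<open>{real_normed_field, euclidean_space}\<close>,
  which covers exactly the real and the complex numbers.
\<close>

definition L1_norm :: "'x measure \<Rightarrow> ('x \<Rightarrow> 'k :: euclidean_space) \<Rightarrow> real" where
  "L1_norm M f = (\<integral>x. norm (f x) \<partial>M)"

definition L2_norm :: "'x measure \<Rightarrow> ('x \<Rightarrow> 'k :: euclidean_space) \<Rightarrow> real" where
  "L2_norm M f = sqrt (\<integral>x. (norm (f x))\<^sup>2 \<partial>M)"

text \<open>
  Points of an \<open>N\<close>-fold product are functions in \<open>PiE {1..N}\<close>, that is, functions on \<open>nat\<close> which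
  are \<open>undefined\<close> outside \<open>{1..N}\<close>; the topology induced on them by the product
  topology of the function space is the product topology with \<open>N\<close> factors.
\<close>

definition prod_measure :: "'a measure \<Rightarrow> nat \<Rightarrow> (nat \<Rightarrow> 'a) measure" where
  "prod_measure \<mu> N = Pi\<^sub>M {1..N} (\<lambda>_. \<mu>)"

definition expect_onto ::
    "'a measure \<Rightarrow> nat \<Rightarrow> nat set \<Rightarrow> ((nat \<Rightarrow> 'a) \<Rightarrow> 'k :: euclidean_space) \<Rightarrow> (nat \<Rightarrow> 'a) \<Rightarrow> 'k" where
  "expect_onto \<mu> N S f x =
     (\<integral>y. f (merge S ({1..N} - S) (x, y)) \<partial>(Pi\<^sub>M ({1..N} - S) (\<lambda>_. \<mu>)))"

section \<open>Continuously differentiable functions on the torus\<close>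

definition torus :: "nat \<Rightarrow> (nat \<Rightarrow> circle) set" where
  "torus N = PiE {1..N} (\<lambda>_. UNIV)"

abbreviation torus_haar :: "nat \<Rightarrow> (nat \<Rightarrow> circle) measure" where
  "torus_haar \<equiv> prod_measure circle_haar"

definition torus_line :: "nat \<Rightarrow> ((nat \<Rightarrow> circle) \<Rightarrow> 'k) \<Rightarrow> (nat \<Rightarrow> circle) \<Rightarrow> real \<Rightarrow> 'k" where
  "torus_line n f x t = f (x(n := x n + to_circle t))"

definition torus_partial ::
    "nat \<Rightarrow> ((nat \<Rightarrow> circle) \<Rightarrow> 'k :: euclidean_space) \<Rightarrow> (nat \<Rightarrow> circle) \<Rightarrow> 'k" where
  "torus_partial n f x = vector_derivative (torus_line n f x) (at 0)"

definition C1_torus :: "nat \<Rightarrow> ((nat \<Rightarrow> circle) \<Rightarrow> 'k :: euclidean_space) \<Rightarrow> bool" where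
  "C1_torus N f \<longleftrightarrow>
     continuous_on (torus N) f \<and>
     (\<forall>n\<in>{1..N}. (\<forall>x\<in>torus N. torus_line n f x differentiable (at 0)) \<and>
                 continuous_on (torus N) (torus_partial n f))"

definition torus_gradient_norm :: "nat \<Rightarrow> ((nat \<Rightarrow> circle) \<Rightarrow> 'k :: euclidean_space) \<Rightarrow> real" where
  "torus_gradient_norm N f = (\<Sum>n=1..N. L1_norm (torus_haar N) (torus_partial n f))"

section \<open>Continuously differentiable functions on the cube\<close>

abbreviation unit_interval :: "real measure" where
  "unit_interval \<equiv> restrict_space lborel {0..1}"

definition cube :: "nat \<Rightarrow> (nat \<Rightarrow> real) set" where
  "cube N = PiE {1..N} (\<lambda>_. {0..1})"

abbreviation cube_lebesgue :: "nat \<Rightarrow> (nat \<Rightarrow> real) measure" where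
  "cube_lebesgue \<equiv> prod_measure unit_interval"

definition cube_line :: "nat \<Rightarrow> ((nat \<Rightarrow> real) \<Rightarrow> 'k) \<Rightarrow> (nat \<Rightarrow> real) \<Rightarrow> real \<Rightarrow> 'k" where
  "cube_line n f x t = f (x(n := t))"

text \<open>On the faces of the cube the partial derivatives are one-sided.\<close>

definition cube_partial ::
    "nat \<Rightarrow> ((nat \<Rightarrow> real) \<Rightarrow> 'k :: euclidean_space) \<Rightarrow> (nat \<Rightarrow> real) \<Rightarrow> 'k" where
  "cube_partial n f x = vector_derivative (cube_line n f x) (at (x n) within {0..1})"

definition C1_cube :: "nat \<Rightarrow> ((nat \<Rightarrow> real) \<Rightarrow> 'k :: euclidean_space) \<Rightarrow> bool" where
  "C1_cube N f \<longleftrightarrow>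
     continuous_on (cube N) f \<and>
     (\<forall>n\<in>{1..N}. (\<forall>x\<in>cube N. cube_line n f x differentiable (at (x n) within {0..1})) \<and>
                 continuous_on (cube N) (cube_partial n f))"

definition cube_gradient_norm :: "nat \<Rightarrow> ((nat \<Rightarrow> real) \<Rightarrow> 'k :: euclidean_space) \<Rightarrow> real" where
  "cube_gradient_norm N f = (\<Sum>n=1..N. L1_norm (cube_lebesgue N) (cube_partial n f))"

end

(* Averaging over the coordinates outside S = {n. ||d_n f||_1 > delta} is controlled by a noise
   operator T, the product over n of (1 - eta) G_n + eta E_n, where E_n integrates out the n-th
   coordinate and G_n averages it over cells of length eta.  T moves f by O(eta) in L_1, because the
   L_1 norms of the partial derivatives add up to at most 1.  By the Efron-Stein inequality,
   ||Tf - E_S Tf||_2^2 is at most the sum of ||D_n Tf||_2^2 over n not in S, where D_n = 1 - E_n.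
   Since there are finitely many cells, some power T^J maps L_2 to L_4 contractively with J independent
   of the dimension, whence ||T^J D_n f||_2^2 <= ||D_n f||_1 ||D_n f||_2,
   which is small for n not in S; log-convexity of the powers of T transfers this smallness to T
   itself, the total energy being bounded because the noise is strictly contractive on D_n f. *)

theory Submission
  imports Defs
begin

section \<open>Commuting averaging operators\<close>

text \<open>Mixing with the mean alone would not do: (1 - \<eta>) id + \<eta> E_n retains a multiple
  of the identity and cannot map L_2 into L_4 on a space without atoms. Averaging over m cells of
  mass 1/m turns each coordinate into a finite space, where the square of a function is at most m
  times its mean, and m alone decides which power of the noise is hypercontractive. The price is the
  error of this averaging, which the integral of the derivative over a cell controls; for \<eta> =
  1/m it has the order of the error caused by the mixing. Differentiability is used only through
  such bounds on oscillations, so torus and cube differ only in how their lines are parametrized.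
  Nothing is diagonalized. The operators are positive, unital and linear on an algebra of functions
  whose axioms provide absolute values and reciprocals of functions bounded away from 0, but no
  roots. For this reason inequalities of Cauchy-Schwarz type are discriminants, L_2 norms appear
  squared, and L_2 to L_4 is preferred to its dual with the exponent 4/3.\<close>

locale function_algebra =
  fixes B :: "('x \<Rightarrow> real) set"
  assumes const_mem: "(\<lambda>_. c) \<in> B"
    and add_mem: "f \<in> B \<Longrightarrow> g \<in> B \<Longrightarrow> (\<lambda>x. f x + g x) \<in> B"
    and mult_mem: "f \<in> B \<Longrightarrow> g \<in> B \<Longrightarrow> (\<lambda>x. f x * g x) \<in> B"
    and abs_mem: "f \<in> B \<Longrightarrow> (\<lambda>x. \<bar>f x\<bar>) \<in> B"
    and inverse_mem: "f \<in> B \<Longrightarrow> 0 < c \<Longrightarrow> (\<And>x. c \<le> f x) \<Longrightarrow> (\<lambda>x. inverse (f x)) \<in> B"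
begin

lemma diff_mem: "f \<in> B \<Longrightarrow> g \<in> B \<Longrightarrow> (\<lambda>x. f x - g x) \<in> B"
  using add_mem[OF _ mult_mem[OF const_mem[of "-1"]], of f g] by simp

lemma power_mem: "f \<in> B \<Longrightarrow> (\<lambda>x. f x ^ k) \<in> B"
  by (induction k) (simp_all add: const_mem mult_mem)

lemma divide_mem: "f \<in> B \<Longrightarrow> (\<lambda>x. f x / c) \<in> B"
  using mult_mem[OF _ const_mem[of "inverse c"], of f] by (simp add: field_simps)

lemmas mem = const_mem add_mem mult_mem abs_mem diff_mem power_mem divide_mem

section \<open>Positive unital operators and conditional expectations on a function algebra\<close>

definition markov :: "(('x \<Rightarrow> real) \<Rightarrow> 'x \<Rightarrow> real) \<Rightarrow> bool" where
  "markov A \<longleftrightarrow> (\<forall>f\<in>B. A f \<in> B) \<and>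
     (\<forall>f\<in>B. \<forall>g\<in>B. A (\<lambda>x. f x + g x) = (\<lambda>x. A f x + A g x)) \<and>
     (\<forall>f\<in>B. \<forall>c. A (\<lambda>x. c * f x) = (\<lambda>x. c * A f x)) \<and>
     (\<forall>f\<in>B. (\<forall>x. 0 \<le> f x) \<longrightarrow> (\<forall>x. 0 \<le> A f x)) \<and>
     A (\<lambda>_. 1) = (\<lambda>_. 1)"

text \<open>The pull-out identity replaces a sub-sigma-algebra: functions of the form
  \<open>A f\<close> behave like constants under \<open>A\<close>. Idempotence is its special case g
  = 1.\<close>

definition cond_exp_op :: "(('x \<Rightarrow> real) \<Rightarrow> 'x \<Rightarrow> real) \<Rightarrow> bool" where
  "cond_exp_op A \<longleftrightarrow> markov A \<and>
     (\<forall>f\<in>B. \<forall>g\<in>B. A (\<lambda>x. A f x * g x) = (\<lambda>x. A f x * A g x))"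

definition commuting :: "(('x \<Rightarrow> real) \<Rightarrow> 'x \<Rightarrow> real) \<Rightarrow> (('x \<Rightarrow> real) \<Rightarrow> 'x \<Rightarrow> real) \<Rightarrow> bool" where
  "commuting A C \<longleftrightarrow> (\<forall>f\<in>B. A (C f) = C (A f))"

lemma commutingD: "commuting A C \<Longrightarrow> f \<in> B \<Longrightarrow> A (C f) = C (A f)"
  by (auto simp: commuting_def)

lemma commuting_sym: "commuting A C \<Longrightarrow> commuting C A"
  by (auto simp: commuting_def)

lemma
  assumes "markov A"
  shows markov_mem: "f \<in> B \<Longrightarrow> A f \<in> B"
    and markov_add: "f \<in> B \<Longrightarrow> g \<in> B \<Longrightarrow> A (\<lambda>x. f x + g x) = (\<lambda>x. A f x + A g x)"
    and markov_cmult: "f \<in> B \<Longrightarrow> A (\<lambda>x. c * f x) = (\<lambda>x. c * A f x)"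
    and markov_nonneg: "f \<in> B \<Longrightarrow> (\<And>x. 0 \<le> f x) \<Longrightarrow> 0 \<le> A f x"
    and markov_one: "A (\<lambda>_. 1) = (\<lambda>_. 1)"
  using assms by (auto simp: markov_def)

lemma markov_const: assumes "markov A" shows "A (\<lambda>_. c) = (\<lambda>_. c)"
  using markov_cmult[OF assms const_mem[of 1], of c] markov_one[OF assms] by simp

lemma markov_diff:
  assumes A: "markov A" and "f \<in> B" "g \<in> B"
  shows "A (\<lambda>x. f x - g x) = (\<lambda>x. A f x - A g x)"
  using markov_add[OF A assms(2) mult_mem[OF const_mem[of "-1"] assms(3)]]
    markov_cmult[OF A assms(3), of "-1"] by simp

lemma markov_lincomb:
  assumes A: "markov A" and "f \<in> B" "g \<in> B"
  shows "A (\<lambda>x. r * f x + s * g x) = (\<lambda>x. r * A f x + s * A g x)"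
  using markov_add[OF A mult_mem[OF const_mem assms(2)] mult_mem[OF const_mem assms(3)]]
    markov_cmult[OF A] assms by simp

lemma markov_mono:
  assumes A: "markov A" and "f \<in> B" "g \<in> B" "\<And>x. f x \<le> g x"
  shows "A f x \<le> A g x"
  using markov_nonneg[OF A diff_mem[OF assms(3,2)], of x] markov_diff[OF A assms(3,2)] assms(4) by simp

lemma markov_abs:
  assumes A: "markov A" and f: "f \<in> B"
  shows "\<bar>A f x\<bar> \<le> A (\<lambda>x. \<bar>f x\<bar>) x"
proof -
  have "A (\<lambda>x. (-1) * f x) x \<le> A (\<lambda>x. \<bar>f x\<bar>) x"
    by (rule markov_mono[OF A mult_mem[OF const_mem f] abs_mem[OF f]]) auto
  moreover have "A f x \<le> A (\<lambda>x. \<bar>f x\<bar>) x"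
    by (rule markov_mono[OF A f abs_mem[OF f]]) auto
  ultimately show ?thesis
    unfolding markov_cmult[OF A f] by (simp add: abs_le_iff)
qed

lemma markov_compose: "markov A \<Longrightarrow> markov C \<Longrightarrow> markov (\<lambda>f. A (C f))"
  by (simp add: markov_def)

lemma markov_convex:
  assumes A: "markov A" and C: "markov C" and "0 \<le> r" "r \<le> 1"
  shows "markov (\<lambda>f x. r * A f x + (1 - r) * C f x)"
  unfolding markov_def
proof (intro conjI ballI allI impI)
  show "0 \<le> r * A f x + (1 - r) * C f x" if "f \<in> B" "\<forall>x. 0 \<le> f x" for f x
    using that assms by (intro add_nonneg_nonneg mult_nonneg_nonneg markov_nonneg[OF A] markov_nonneg[OF C]) auto
qed (use assms in \<open>auto intro!: mem
      simp: markov_mem markov_add markov_cmult markov_one algebra_simps\<close>)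

text \<open>For c > 0 the quadratic is minimal at t = b / c, with value a - b^2 / c. This yields
  Cauchy-Schwarz for pairings known only to be positive.\<close>

lemma quadratic_nonneg_discriminant:
  fixes a b c :: real
  assumes nn: "\<And>t. 0 \<le> a - 2 * t * b + t\<^sup>2 * c" and "0 \<le> c"
  shows "b\<^sup>2 \<le> a * c"
proof (cases "c = 0")
  case True
  then have nn': "2 * t * b \<le> a" for t using nn[of t] by simp
  have "b = 0"
  proof (rule ccontr)
    assume "b \<noteq> 0"
    \<comment> \<open>A linear function of t that is bounded above has slope 0; this t makes
      \<open>2 * t * b\<close> equal to a + 1.\<close>
    then show False using nn'[of "(a + 1) / (2 * b)"] by simp
  qed
  then show ?thesis using True by simp
next
  case False
  then have "0 < c" using assms(2) by simp
  then have "b\<^sup>2 / c \<le> a"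
    using nn[of "b / c"] by (simp add: power2_eq_square field_simps)
  then show ?thesis using \<open>0 < c\<close> by (simp add: field_simps)
qed

text \<open>At a fixed x the map from f to \<open>A f x\<close> is a positive linear functional, so
  expanding the image of (f - t g)^2 gives a quadratic in t that is nowhere negative.\<close>

lemma markov_Cauchy_Schwarz:
  assumes A: "markov A" and f: "f \<in> B" and g: "g \<in> B"
  shows "(A (\<lambda>x. f x * g x) x)\<^sup>2 \<le> A (\<lambda>x. (f x)\<^sup>2) x * A (\<lambda>x. (g x)\<^sup>2) x"
proof (rule quadratic_nonneg_discriminant)
  fix t :: real
  have eq: "(\<lambda>x. (f x - t * g x)\<^sup>2) = (\<lambda>x. ((f x)\<^sup>2 - (2 * t) * (f x * g x)) + t\<^sup>2 * (g x)\<^sup>2)"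
    by (auto simp: power2_eq_square algebra_simps)
  have "0 \<le> A (\<lambda>x. (f x - t * g x)\<^sup>2) x"
    by (intro markov_nonneg[OF A]) (auto intro!: mem f g)
  also have "A (\<lambda>x. (f x - t * g x)\<^sup>2) x =
      A (\<lambda>x. (f x)\<^sup>2) x - 2 * t * A (\<lambda>x. f x * g x) x + t\<^sup>2 * A (\<lambda>x. (g x)\<^sup>2) x"
    unfolding eq
    by (simp add: markov_add[OF A] markov_diff[OF A] markov_cmult[OF A] mem f g)
  finally show "0 \<le> A (\<lambda>x. (f x)\<^sup>2) x - 2 * t * A (\<lambda>x. f x * g x) x + t\<^sup>2 * A (\<lambda>x. (g x)\<^sup>2) x" .
next
  show "0 \<le> A (\<lambda>x. (g x)\<^sup>2) x"
    by (intro markov_nonneg[OF A]) (auto intro!: mem g)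
qed

lemma markov_Jensen_square:
  assumes A: "markov A" and f: "f \<in> B"
  shows "(A f x)\<^sup>2 \<le> A (\<lambda>x. (f x)\<^sup>2) x"
  using markov_Cauchy_Schwarz[OF A f const_mem[of 1], of x] markov_const[OF A] by simp

lemma cond_exp_op_markov: "cond_exp_op A \<Longrightarrow> markov A"
  by (simp add: cond_exp_op_def)

lemma cond_exp_op_pull_out:
  "cond_exp_op A \<Longrightarrow> f \<in> B \<Longrightarrow> g \<in> B \<Longrightarrow> A (\<lambda>x. A f x * g x) = (\<lambda>x. A f x * A g x)"
  by (simp add: cond_exp_op_def)

lemma cond_exp_op_idem: 
  assumes "cond_exp_op A" "f \<in> B" shows "A (A f) = A f"
  using cond_exp_op_pull_out[OF assms const_mem[of 1]] markov_one[OF cond_exp_op_markov[OF assms(1)]]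
  by simp

text \<open>Commutation lets the factor leave both operators: written as C (A f) it is pulled out of
  \<open>C\<close>, and written as A (C f) out of \<open>A\<close>.\<close>

lemma cond_exp_op_compose:
  assumes A: "cond_exp_op A" and C: "cond_exp_op C" and AC: "commuting A C"
  shows "cond_exp_op (\<lambda>f. A (C f))"
  unfolding cond_exp_op_def
proof (intro conjI ballI)
  show "markov (\<lambda>f. A (C f))"
    using A C by (rule markov_compose[OF cond_exp_op_markov cond_exp_op_markov])
next
  fix f g assume fg: "f \<in> B" "g \<in> B"
  note [simp] = markov_mem[OF cond_exp_op_markov[OF A]] markov_mem[OF cond_exp_op_markov[OF C]] fg
  have "C (\<lambda>x. A (C f) x * g x) = (\<lambda>x. A (C f) x * C g x)"
    using cond_exp_op_pull_out[OF C, of "A f" g] commutingD[OF AC, of f] by simp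
  then show "A (C (\<lambda>x. A (C f) x * g x)) = (\<lambda>x. A (C f) x * A (C g) x)"
    using cond_exp_op_pull_out[OF A, of "C f" "C g"] by simp
qed

lemma markov_id: "markov (\<lambda>f. f)" and cond_exp_op_id: "cond_exp_op (\<lambda>f. f)"
  by (simp_all add: markov_def cond_exp_op_def)

lemma markov_foldr: "(\<And>n. n \<in> set L \<Longrightarrow> markov (A n)) \<Longrightarrow> markov (foldr A L)"
proof (induction L)
  case Nil then show ?case using markov_id by (simp add: id_def)
next
  case (Cons n L) then show ?case using markov_compose[of "A n" "foldr A L"] by (simp add: comp_def)
qed

lemma commuting_foldr:
  assumes "\<And>n. n \<in> set L \<Longrightarrow> commuting C (A n)" "\<And>n. n \<in> set L \<Longrightarrow> markov (A n)"
  shows "commuting C (foldr A L)"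
  using assms
proof (induction L)
  case Nil then show ?case by (simp add: commuting_def)
next
  case (Cons n L)
  have "foldr A L f \<in> B" if "f \<in> B" for f
    using that Cons.prems by (intro markov_mem[OF markov_foldr]) auto
  with Cons show ?case by (auto simp: commuting_def)
qed

lemma cond_exp_op_foldr:
  assumes "\<And>n. n \<in> set L \<Longrightarrow> cond_exp_op (A n)"
    and "\<And>i j. i \<in> set L \<Longrightarrow> j \<in> set L \<Longrightarrow> commuting (A i) (A j)"
  shows "cond_exp_op (foldr A L)"
  using assms
proof (induction L)
  case Nil then show ?case using cond_exp_op_id by (simp add: id_def)
next
  case (Cons n L)
  have "commuting (A n) (foldr A L)"
    using Cons.prems by (intro commuting_foldr cond_exp_op_markov) auto
  then show ?case
    using Cons cond_exp_op_compose[of "A n" "foldr A L"] by (simp add: comp_def)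
qed

end


section \<open>Two averaging operators per coordinate and the expectation they generate\<close>

locale coordinate_operators = function_algebra B
  for B :: "('x \<Rightarrow> real) set" +
  fixes I :: "'i list" and E G :: "'i \<Rightarrow> ('x \<Rightarrow> real) \<Rightarrow> 'x \<Rightarrow> real" and m :: real
  assumes distinct_I: "distinct I"
    and E_op: "n \<in> set I \<Longrightarrow> cond_exp_op (E n)"
    and G_op: "n \<in> set I \<Longrightarrow> cond_exp_op (G n)"
    and E_E: "i \<in> set I \<Longrightarrow> j \<in> set I \<Longrightarrow> i \<noteq> j \<Longrightarrow> commuting (E i) (E j)"
    and G_G: "i \<in> set I \<Longrightarrow> j \<in> set I \<Longrightarrow> i \<noteq> j \<Longrightarrow> commuting (G i) (G j)"
    and E_G: "i \<in> set I \<Longrightarrow> j \<in> set I \<Longrightarrow> i \<noteq> j \<Longrightarrow> commuting (E i) (G j)"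
    and E_G_same: "n \<in> set I \<Longrightarrow> f \<in> B \<Longrightarrow> E n (G n f) = E n f"
    and G_E_same: "n \<in> set I \<Longrightarrow> f \<in> B \<Longrightarrow> G n (E n f) = E n f"
    and G_sup: "n \<in> set I \<Longrightarrow> f \<in> B \<Longrightarrow> (G n f x)\<^sup>2 \<le> m * E n (\<lambda>x. (f x)\<^sup>2) x"
begin

lemmas E_markov = cond_exp_op_markov[OF E_op]
lemmas G_markov = cond_exp_op_markov[OF G_op]

lemma E_commute: "i \<in> set I \<Longrightarrow> j \<in> set I \<Longrightarrow> commuting (E i) (E j)"
  using E_E by (cases "i = j") (auto simp: commuting_def)

lemma cond_exp_op_foldr_E: "set L \<subseteq> set I \<Longrightarrow> cond_exp_op (foldr E L)"
  by (intro cond_exp_op_foldr E_op E_commute) auto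

lemmas markov_foldr_E = cond_exp_op_markov[OF cond_exp_op_foldr_E]

text \<open>The locale does not say that averaging over all coordinates gives a constant. Evaluation
  at any fixed point yields a positive unital functional preserved by every \<open>E n\<close> and
  \<open>G n\<close>, which is enough for the estimates; on a product space it is the
  integral.\<close>

definition ev :: "('x \<Rightarrow> real) \<Rightarrow> real" where
  "ev f = foldr E I f undefined"

lemmas markov_all = markov_foldr_E[OF subset_refl]

lemma ev_add: "f \<in> B \<Longrightarrow> g \<in> B \<Longrightarrow> ev (\<lambda>x. f x + g x) = ev f + ev g"
  and ev_diff: "f \<in> B \<Longrightarrow> g \<in> B \<Longrightarrow> ev (\<lambda>x. f x - g x) = ev f - ev g"
  and ev_cmult: "f \<in> B \<Longrightarrow> ev (\<lambda>x. c * f x) = c * ev f"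
  and ev_const: "ev (\<lambda>_. c) = c"
  and ev_mono: "f \<in> B \<Longrightarrow> g \<in> B \<Longrightarrow> (\<And>x. f x \<le> g x) \<Longrightarrow> ev f \<le> ev g"
  and ev_nonneg: "f \<in> B \<Longrightarrow> (\<And>x. 0 \<le> f x) \<Longrightarrow> 0 \<le> ev f"
  and ev_Cauchy_Schwarz: "f \<in> B \<Longrightarrow> g \<in> B \<Longrightarrow>
     (ev (\<lambda>x. f x * g x))\<^sup>2 \<le> ev (\<lambda>x. (f x)\<^sup>2) * ev (\<lambda>x. (g x)\<^sup>2)"
  unfolding ev_def
  by (simp_all add: markov_add[OF markov_all] markov_diff[OF markov_all]
      markov_cmult[OF markov_all] markov_const[OF markov_all] markov_mono[OF markov_all]
      markov_nonneg[OF markov_all] markov_Cauchy_Schwarz[OF markov_all])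

lemmas ev_linear = ev_add ev_diff ev_cmult

text \<open>As the operators commute, the extra \<open>E n\<close> can be moved next to its copy in
  the product, where idempotence absorbs it.\<close>

lemma foldr_E_absorb:
  "set L \<subseteq> set I \<Longrightarrow> n \<in> set L \<Longrightarrow> f \<in> B \<Longrightarrow> foldr E L (E n f) = foldr E L f"
proof (induction L)
  case (Cons k L)
  have nk: "n \<in> set I" "k \<in> set I" using Cons.prems by auto
  have L: "foldr E L f \<in> B"
    using Cons.prems by (intro markov_mem[OF markov_foldr_E]) auto
  have "foldr E L (E k f) = E k (foldr E L f)"
    using Cons.prems by (intro commutingD[symmetric] commuting_foldr E_commute E_markov) auto
  then show ?case
    using Cons cond_exp_op_idem[OF E_op[OF nk(2)] L] by (cases "n \<in> set L") auto
qed simp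

lemma ev_E: "n \<in> set I \<Longrightarrow> f \<in> B \<Longrightarrow> ev (E n f) = ev f"
  by (simp add: ev_def foldr_E_absorb)

lemma ev_G: "n \<in> set I \<Longrightarrow> f \<in> B \<Longrightarrow> ev (G n f) = ev f"
  by (metis E_G_same ev_E G_markov markov_mem)

text \<open>Self-adjointness for the pairing ev (f g). Paired with the constant 1 it contains the
  invariance of \<open>ev\<close>, hence contraction in L_1 and L_2.\<close>

definition sym_markov :: "(('x \<Rightarrow> real) \<Rightarrow> 'x \<Rightarrow> real) \<Rightarrow> bool" where
  "sym_markov A \<longleftrightarrow> markov A \<and>
     (\<forall>f\<in>B. \<forall>g\<in>B. ev (\<lambda>x. f x * A g x) = ev (\<lambda>x. A f x * g x))"

lemma sym_markov_markov: "sym_markov A \<Longrightarrow> markov A"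
  by (simp add: sym_markov_def)

lemma sym_markovD:
  "sym_markov A \<Longrightarrow> f \<in> B \<Longrightarrow> g \<in> B \<Longrightarrow> ev (\<lambda>x. f x * A g x) = ev (\<lambda>x. A f x * g x)"
  by (simp add: sym_markov_def)

lemma sym_markov_ev:
  assumes A: "sym_markov A" and f: "f \<in> B" shows "ev (A f) = ev f"
  using sym_markovD[OF A const_mem[of 1] f] markov_one[OF sym_markov_markov[OF A]] by simp

text \<open>By invariance and pull-out both pairings equal the expectation of A f times A g, which
  is symmetric in f and g.\<close>

lemma sym_markov_cond_exp_op:
  assumes A: "cond_exp_op A" and pres: "\<And>f. f \<in> B \<Longrightarrow> ev (A f) = ev f"
  shows "sym_markov A"
proof -
  note M = cond_exp_op_markov[OF A]
  have *: "ev (\<lambda>x. A f x * g x) = ev (\<lambda>x. A f x * A g x)" if "f \<in> B" "g \<in> B" for f g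
    using pres[of "\<lambda>x. A f x * g x"] cond_exp_op_pull_out[OF A that] mult_mem markov_mem[OF M] that
    by simp
  have "ev (\<lambda>x. f x * A g x) = ev (\<lambda>x. A f x * g x)" if "f \<in> B" "g \<in> B" for f g
    using *[OF that] *[OF that(2,1)] by (simp add: mult.commute)
  then show ?thesis using M by (simp add: sym_markov_def)
qed

lemma sym_markov_compose:
  assumes A: "sym_markov A" and C: "sym_markov C" and AC: "commuting A C"
  shows "sym_markov (\<lambda>f. A (C f))"
  unfolding sym_markov_def
proof (intro conjI ballI)
  show "markov (\<lambda>f. A (C f))"
    by (rule markov_compose[OF sym_markov_markov[OF A] sym_markov_markov[OF C]])
next
  fix f g assume fg: "f \<in> B" "g \<in> B"
  have "ev (\<lambda>x. f x * A (C g) x) = ev (\<lambda>x. A f x * C g x)"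
    by (intro sym_markovD[OF A] fg markov_mem[OF sym_markov_markov[OF C]])
  also have "\<dots> = ev (\<lambda>x. C (A f) x * g x)"
    by (intro sym_markovD[OF C] fg markov_mem[OF sym_markov_markov[OF A]])
  finally show "ev (\<lambda>x. f x * A (C g) x) = ev (\<lambda>x. A (C f) x * g x)"
    using commutingD[OF AC fg(1)] by simp
qed

lemma sym_markov_foldr:
  assumes "\<And>n. n \<in> set L \<Longrightarrow> sym_markov (A n)" "distinct L"
    and "\<And>i j. i \<in> set L \<Longrightarrow> j \<in> set L \<Longrightarrow> i \<noteq> j \<Longrightarrow> commuting (A i) (A j)"
  shows "sym_markov (foldr A L)"
  using assms
proof (induction L)
  case Nil then show ?case using markov_id by (simp add: id_def sym_markov_def)
next
  case (Cons n L)
  have "commuting (A n) (foldr A L)"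
    using Cons.prems by (intro commuting_foldr sym_markov_markov) auto
  then show ?case
    using Cons sym_markov_compose[of "A n" "foldr A L"] by (simp add: comp_def)
qed

lemma sym_markov_convex:
  assumes A: "sym_markov A" and C: "sym_markov C" and r: "0 \<le> r" "r \<le> 1"
  shows "sym_markov (\<lambda>f x. r * A f x + (1 - r) * C f x)"
  unfolding sym_markov_def
proof (intro conjI ballI)
  show "markov (\<lambda>f x. r * A f x + (1 - r) * C f x)"
    using r by (intro markov_convex sym_markov_markov A C)
next
  fix f g assume fg: "f \<in> B" "g \<in> B"
  note [simp] = fg markov_mem[OF sym_markov_markov[OF A]] markov_mem[OF sym_markov_markov[OF C]]
  have "ev (\<lambda>x. f x * (r * A g x + (1 - r) * C g x)) =
      ev (\<lambda>x. r * (f x * A g x) + (1 - r) * (f x * C g x))"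
    by (simp add: algebra_simps)
  also have "\<dots> = r * ev (\<lambda>x. f x * A g x) + (1 - r) * ev (\<lambda>x. f x * C g x)"
    by (simp add: ev_linear mem)
  also have "\<dots> = r * ev (\<lambda>x. A f x * g x) + (1 - r) * ev (\<lambda>x. C f x * g x)"
    using sym_markovD[OF A fg] sym_markovD[OF C fg] by simp
  also have "\<dots> = ev (\<lambda>x. r * (A f x * g x) + (1 - r) * (C f x * g x))"
    by (simp add: ev_linear mem)
  finally show "ev (\<lambda>x. f x * (r * A g x + (1 - r) * C g x)) =
      ev (\<lambda>x. (r * A f x + (1 - r) * C f x) * g x)"
    by (simp add: algebra_simps)
qed

definition norm1 :: "('x \<Rightarrow> real) \<Rightarrow> real" where
  "norm1 f = ev (\<lambda>x. \<bar>f x\<bar>)"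

definition sqnorm2 :: "('x \<Rightarrow> real) \<Rightarrow> real" where
  "sqnorm2 f = ev (\<lambda>x. (f x)\<^sup>2)"

lemma norm1_nonneg: "f \<in> B \<Longrightarrow> 0 \<le> norm1 f"
  and sqnorm2_nonneg: "f \<in> B \<Longrightarrow> 0 \<le> sqnorm2 f"
  unfolding norm1_def sqnorm2_def by (auto intro!: ev_nonneg mem)

lemma norm1_triangle:
  assumes "f \<in> B" "g \<in> B" shows "norm1 (\<lambda>x. f x + g x) \<le> norm1 f + norm1 g"
  using assms unfolding norm1_def
  by (subst ev_add[symmetric]) (auto intro!: ev_mono mem)

lemma norm1_le_sqnorm2:
  assumes "f \<in> B" shows "(norm1 f)\<^sup>2 \<le> sqnorm2 f"
  using ev_Cauchy_Schwarz[OF abs_mem[OF assms] const_mem[of 1]]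
  by (simp add: norm1_def sqnorm2_def ev_const)

lemma norm1_contraction:
  assumes A: "sym_markov A" and f: "f \<in> B" shows "norm1 (A f) \<le> norm1 f"
proof -
  note M = sym_markov_markov[OF A]
  have "ev (\<lambda>x. \<bar>A f x\<bar>) \<le> ev (A (\<lambda>x. \<bar>f x\<bar>))"
    by (intro ev_mono markov_abs[OF M] mem markov_mem[OF M] f)
  then show ?thesis
    by (simp add: norm1_def sym_markov_ev[OF A] mem f)
qed

lemma sqnorm2_contraction:
  assumes A: "sym_markov A" and f: "f \<in> B" shows "sqnorm2 (A f) \<le> sqnorm2 f"
proof -
  note M = sym_markov_markov[OF A]
  have "ev (\<lambda>x. (A f x)\<^sup>2) \<le> ev (A (\<lambda>x. (f x)\<^sup>2))"
    by (intro ev_mono markov_Jensen_square[OF M] mem markov_mem[OF M] f)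
  then show ?thesis
    by (simp add: sqnorm2_def sym_markov_ev[OF A] mem f)
qed

section \<open>The noise operators and their semigroup law\<close>

definition noise :: "real \<Rightarrow> 'i \<Rightarrow> ('x \<Rightarrow> real) \<Rightarrow> 'x \<Rightarrow> real" where
  "noise r n f x = r * G n f x + (1 - r) * E n f x"

definition noises :: "real \<Rightarrow> 'i list \<Rightarrow> ('x \<Rightarrow> real) \<Rightarrow> 'x \<Rightarrow> real" where
  "noises r = foldr (noise r)"

lemma sym_markov_E: "n \<in> set I \<Longrightarrow> sym_markov (E n)"
  by (intro sym_markov_cond_exp_op E_op ev_E)

lemma sym_markov_G: "n \<in> set I \<Longrightarrow> sym_markov (G n)"
  by (intro sym_markov_cond_exp_op G_op ev_G)

lemma sym_markov_noise: "n \<in> set I \<Longrightarrow> 0 \<le> r \<Longrightarrow> r \<le> 1 \<Longrightarrow> sym_markov (noise r n)"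
  unfolding noise_def[abs_def] by (intro sym_markov_convex sym_markov_G sym_markov_E)

lemmas markov_noise = sym_markov_markov[OF sym_markov_noise]

lemma commuting_convex:
  assumes "markov C" "markov A" "markov A'" "commuting C A" "commuting C A'"
  shows "commuting C (\<lambda>f x. r * A f x + s * A' f x)"
  using assms markov_lincomb[OF assms(1)] unfolding commuting_def by (simp add: markov_mem)

lemma commuting_E_noise:
  assumes "i \<in> set I" "j \<in> set I" "i \<noteq> j" shows "commuting (E i) (noise r j)"
  unfolding noise_def[abs_def] using assms by (intro commuting_convex E_markov G_markov E_E E_G)

lemma commuting_G_noise:
  assumes "i \<in> set I" "j \<in> set I" "i \<noteq> j" shows "commuting (G i) (noise r j)"
  unfolding noise_def[abs_def] using assms
  by (intro commuting_convex E_markov G_markov G_G commuting_sym[OF E_G]) auto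

lemma commuting_noise_noise:
  assumes "i \<in> set I" "j \<in> set I" "i \<noteq> j" "0 \<le> s" "s \<le> 1"
  shows "commuting (noise s j) (noise r i)"
  unfolding noise_def[of r, abs_def] using assms
  by (intro commuting_convex E_markov G_markov markov_noise commuting_sym[OF commuting_E_noise]
      commuting_sym[OF commuting_G_noise])

lemma E_noise_same:
  assumes "n \<in> set I" "f \<in> B" shows "E n (noise r n f) = E n f" and "noise r n (E n f) = E n f"
  using assms unfolding noise_def[abs_def]
  by (simp_all add: markov_lincomb[OF E_markov] markov_mem[OF E_markov]
      markov_mem[OF G_markov] E_G_same G_E_same cond_exp_op_idem[OF E_op])
    (simp_all add: algebra_simps)

text \<open>Noise with parameter s kills f - G n f, multiplies G n f - E n f by s and fixes E n f,
  so the parameters of two noises multiply. At parameter 1 it is \<open>G n\<close>, not the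
  identity.\<close>

lemma noise_noise_same:
  assumes n: "n \<in> set I" and f: "f \<in> B"
  shows "noise r n (noise s n f) = noise (r * s) n f"
proof -
  have "G n (noise s n f) = noise s n f"
    using n f unfolding noise_def[abs_def]
    by (simp add: markov_lincomb[OF G_markov] markov_mem[OF E_markov]
      markov_mem[OF G_markov] G_E_same cond_exp_op_idem[OF G_op])
  then have "noise r n (noise s n f) x = r * noise s n f x + (1 - r) * E n f x" for x
    using E_noise_same(1)[OF n f, of s] by (simp add: noise_def[of r])
  then show ?thesis
    by (auto simp: noise_def[of s] noise_def[of "r * s"] algebra_simps)
qed

lemma commuting_E_noise': "i \<in> set I \<Longrightarrow> j \<in> set I \<Longrightarrow> commuting (E i) (noise r j)"
  by (cases "i = j") (simp_all add: commuting_E_noise, simp add: commuting_def E_noise_same)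

lemma sym_markov_noises:
  assumes "set L \<subseteq> set I" "distinct L" "0 \<le> r" "r \<le> 1"
  shows "sym_markov (noises r L)"
  unfolding noises_def using assms
  by (intro sym_markov_foldr sym_markov_noise commuting_noise_noise) auto

lemmas markov_noises = sym_markov_markov[OF sym_markov_noises]

lemma commuting_E_noises:
  assumes "set L \<subseteq> set I" "0 \<le> r" "r \<le> 1" "i \<in> set I"
  shows "commuting (E i) (noises r L)"
  unfolding noises_def using assms
  by (intro commuting_foldr commuting_E_noise' markov_noise) auto

text \<open>The \<open>noise s n\<close> in the middle moves past the operators of the other
  coordinates, and the law for one coordinate applies. With r = s this says that squaring the
  operator squares its parameter, the basis for repeated squaring below.\<close>

lemma noises_noises:
  assumes "set L \<subseteq> set I" "distinct L" "0 \<le> r" "r \<le> 1" "0 \<le> s" "s \<le> 1" "f \<in> B"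
  shows "noises r L (noises s L f) = noises (r * s) L f"
  using assms(1,2,7)
proof (induction L arbitrary: f)
  case Nil then show ?case by (simp add: noises_def)
next
  case (Cons n L)
  have n: "n \<in> set I" "n \<notin> set L" and L: "set L \<subseteq> set I" "distinct L" using Cons.prems by auto
  have mem': "noises s L f \<in> B" "noise s n (noises s L f) \<in> B"
    using n L assms Cons.prems
    by (auto intro!: markov_mem[OF markov_noises] markov_mem[OF markov_noise])
  have "commuting (noise s n) (noises r L)"
    unfolding noises_def using n L assms
    by (intro commuting_foldr commuting_noise_noise markov_noise) auto
  then have "noises r L (noise s n (noises s L f)) = noise s n (noises r L (noises s L f))"
    using mem' by (simp add: commuting_def)
  also have "\<dots> = noise s n (noises (r * s) L f)"
    using Cons.IH L Cons.prems by simp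
  finally have "noises r (n # L) (noises s (n # L) f) = noise r n (noise s n (noises (r * s) L f))"
    by (simp add: noises_def)
  also have "\<dots> = noise (r * s) n (noises (r * s) L f)"
    using L assms mult_le_one[of r s] Cons.prems(3)
    by (intro noise_noise_same n markov_mem[OF markov_noises]) auto
  finally show ?case by (simp add: noises_def)
qed

end


text \<open>Either t is at most \<kappa> b, or b < t / \<kappa>, and then the hypothesis leaves t at
  most h / \<kappa>^j. This replaces the geometric mean of b and h by a bound linear in both, which
  can be summed over coordinates.\<close>

lemma log_convex_interpolation:
  fixes b h t \<kappa> :: real
  assumes "0 \<le> b" "0 \<le> t" "0 < \<kappa>" "0 \<le> h" and ineq: "t ^ Suc j \<le> b ^ j * h"
  shows "t \<le> \<kappa> * b + h / \<kappa> ^ j"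
proof (cases "t \<le> \<kappa> * b")
  case True
  then show ?thesis using assms by (simp add: add_increasing2)
next
  case False
  then have b: "b \<le> t / \<kappa>" and t: "0 < t"
    using assms by (auto simp: field_simps) (smt (verit) mult_nonneg_nonneg)
  have "t ^ Suc j \<le> (t / \<kappa>) ^ j * h"
    using ineq mult_right_mono[OF power_mono[OF b \<open>0 \<le> b\<close>, of j] \<open>0 \<le> h\<close>] by linarith
  then have "t ^ j * t \<le> t ^ j * (h / \<kappa> ^ j)"
    by (simp add: power_divide mult.commute)
  then have "t \<le> h / \<kappa> ^ j" using t by (rule mult_left_le_imp_le[OF _ zero_less_power])
  then show ?thesis using assms by (simp add: add_increasing)
qed

section \<open>Energy inequalities and log-convexity along the noise semigroup\<close>

context coordinate_operators
begin

definition lap :: "'i \<Rightarrow> ('x \<Rightarrow> real) \<Rightarrow> 'x \<Rightarrow> real" where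
  "lap n f x = f x - E n f x"

lemma lap_mem: "n \<in> set I \<Longrightarrow> f \<in> B \<Longrightarrow> lap n f \<in> B"
  unfolding lap_def[abs_def] by (intro mem markov_mem[OF E_markov])

lemma lap_commute:
  assumes "markov A" "commuting (E n) A" "n \<in> set I" "f \<in> B"
  shows "lap n (A f) = A (lap n f)"
  using assms unfolding lap_def[abs_def]
  by (simp add: markov_diff[OF assms(1)] markov_mem[OF E_markov] commutingD)

lemma sqnorm2_add:
  assumes "f \<in> B" "g \<in> B"
  shows "sqnorm2 (\<lambda>x. f x + g x) = sqnorm2 f + 2 * ev (\<lambda>x. f x * g x) + sqnorm2 g"
proof -
  have "(\<lambda>x. (f x + g x)\<^sup>2) = (\<lambda>x. ((f x)\<^sup>2 + 2 * (f x * g x)) + (g x)\<^sup>2)"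
    by (auto simp: power2_eq_square algebra_simps)
  then show ?thesis
    using assms by (simp add: sqnorm2_def ev_linear mem)
qed

lemma E_lap: "n \<in> set I \<Longrightarrow> f \<in> B \<Longrightarrow> E n (lap n f) = (\<lambda>_. 0)"
  unfolding lap_def[abs_def]
  by (simp add: markov_diff[OF E_markov] markov_mem[OF E_markov] cond_exp_op_idem[OF E_op])

text \<open>One more coordinate splits the error into \<open>lap n g\<close> and
  \<open>E n w\<close>, where w is the error for the remaining list. These are orthogonal, since
  \<open>E n\<close> is self-adjoint and kills \<open>lap n g\<close>, and \<open>E n\<close> does
  not increase the norm of w.\<close>

lemma Efron_Stein:
  assumes "set L \<subseteq> set I" "distinct L" "g \<in> B"
  shows "sqnorm2 (\<lambda>x. g x - foldr E L g x) \<le> (\<Sum>n\<in>set L. sqnorm2 (lap n g))"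
  using assms
proof (induction L)
  case Nil then show ?case by (simp add: sqnorm2_def ev_const)
next
  case (Cons n L)
  have n: "n \<in> set I" and L: "set L \<subseteq> set I" using Cons.prems by auto
  define w where "w = (\<lambda>x. g x - foldr E L g x)"
  have EL: "foldr E L g \<in> B" by (intro markov_mem[OF markov_foldr_E] L Cons.prems)
  have w: "w \<in> B" "E n w \<in> B"
    unfolding w_def by (intro mem markov_mem[OF E_markov] Cons.prems n EL)+
  have "(\<lambda>x. g x - foldr E (n # L) g x) = (\<lambda>x. lap n g x + E n w x)"
    unfolding lap_def w_def using n EL Cons.prems by (simp add: markov_diff[OF E_markov])
  moreover have "ev (\<lambda>x. lap n g x * E n w x) = 0"
    using n w Cons.prems
    by (simp add: sym_markovD[OF sym_markov_E] lap_mem E_lap ev_const)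
  ultimately have "sqnorm2 (\<lambda>x. g x - foldr E (n # L) g x) = sqnorm2 (lap n g) + sqnorm2 (E n w)"
    using sqnorm2_add[of "lap n g" "E n w"] lap_mem n w Cons.prems by simp
  also have "\<dots> \<le> sqnorm2 (lap n g) + sqnorm2 w"
    using sqnorm2_contraction[OF sym_markov_E] n w by simp
  also have "\<dots> \<le> sqnorm2 (lap n g) + (\<Sum>n\<in>set L. sqnorm2 (lap n g))"
    using Cons unfolding w_def by simp
  finally show ?case using Cons.prems by simp
qed

text \<open>Put p = G n f and e = E n f. Then p - e is orthogonal to e and the noise shrinks it by
  r, so the energy lost is at least (1 - r^2) times that of p - e, while \<open>lap n\<close> of the
  result is r (p - e).\<close>

lemma energy_coordinate:
  assumes n: "n \<in> set I" and f: "f \<in> B" and r: "0 \<le> r" "r < 1"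
  shows "(1 - r\<^sup>2) * sqnorm2 (lap n (noise r n f)) \<le> sqnorm2 f - sqnorm2 (noise r n f)"
proof -
  note [simp] = n f markov_mem[OF E_markov] markov_mem[OF G_markov]
  define p e where "p = G n f" and "e = E n f"
  have [simp]: "p \<in> B" "e \<in> B" by (simp_all add: p_def e_def)
  have pe: "ev (\<lambda>x. p x * e x) = sqnorm2 e"
  proof -
    have "ev (\<lambda>x. p x * e x) = ev (\<lambda>x. f x * e x)"
      using sym_markovD[OF sym_markov_G[OF n] f, of e] by (simp add: p_def e_def G_E_same)
    also have "\<dots> = ev (\<lambda>x. E n f x * e x)"
      using sym_markovD[OF sym_markov_E[OF n] f, of e]
      by (simp add: e_def cond_exp_op_idem[OF E_op])
    finally show ?thesis by (simp add: sqnorm2_def e_def power2_eq_square)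
  qed
  have sc: "sqnorm2 (\<lambda>x. c * g x) = c\<^sup>2 * sqnorm2 g" if "g \<in> B" for c g
    using that by (simp add: sqnorm2_def power_mult_distrib ev_cmult mem)
  have lin: "sqnorm2 (\<lambda>x. s * p x + t * e x) = s\<^sup>2 * sqnorm2 p + (2 * s * t + t\<^sup>2) * sqnorm2 e"
    for s t
  proof -
    have "(\<lambda>x. (s * p x) * (t * e x)) = (\<lambda>x. (s * t) * (p x * e x))" by (auto simp: mult_ac)
    then show ?thesis
      using sqnorm2_add[of "\<lambda>x. s * p x" "\<lambda>x. t * e x"]
      by (simp add: mem sc pe ev_cmult) (simp add: algebra_simps)
  qed
  have noise: "noise r n f = (\<lambda>x. r * p x + (1 - r) * e x)"
    by (auto simp: noise_def p_def e_def)
  have "lap n (noise r n f) = (\<lambda>x. r * p x + (- r) * e x)"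
    unfolding lap_def E_noise_same(1)[OF n f] by (auto simp: noise_def p_def e_def algebra_simps)
  then have lap: "sqnorm2 (lap n (noise r n f)) = r\<^sup>2 * (sqnorm2 p - sqnorm2 e)"
    by (simp only: lin) (simp add: power2_eq_square algebra_simps)
  have "0 \<le> sqnorm2 p - sqnorm2 e"
    using lin[of 1 "-1"] sqnorm2_nonneg[of "\<lambda>x. 1 * p x + (-1) * e x"] by (simp add: mem)
  moreover have "sqnorm2 (noise r n f) = r\<^sup>2 * sqnorm2 p + (1 - r\<^sup>2) * sqnorm2 e"
    unfolding noise lin by (simp add: power2_eq_square algebra_simps)
  moreover have "sqnorm2 p \<le> sqnorm2 f"
    unfolding p_def by (rule sqnorm2_contraction[OF sym_markov_G[OF n] f])
  moreover have r2: "r\<^sup>2 \<le> 1" using r by (simp add: power_le_one)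
  ultimately have "(1 - r\<^sup>2) * (sqnorm2 p - sqnorm2 e) \<le> sqnorm2 f - sqnorm2 (noise r n f)"
    by (simp add: algebra_simps)
  moreover have "(1 - r\<^sup>2) * (r\<^sup>2 * (sqnorm2 p - sqnorm2 e)) \<le> (1 - r\<^sup>2) * (1 * (sqnorm2 p - sqnorm2 e))"
    using r2 \<open>0 \<le> sqnorm2 p - sqnorm2 e\<close> by (intro mult_left_mono mult_right_mono) auto
  ultimately show ?thesis unfolding lap by simp
qed

text \<open>The energies lost at successive coordinates telescope, so the bound is free of the
  dimension. Terms of coordinates treated earlier can only decrease when a further noise acts,
  because it commutes with \<open>lap j\<close> and contracts.\<close>

lemma energy:
  assumes "set L \<subseteq> set I" "distinct L" "f \<in> B" and r: "0 \<le> r" "r < 1"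
  shows "(1 - r\<^sup>2) * (\<Sum>n\<in>set L. sqnorm2 (lap n (noises r L f))) \<le> sqnorm2 f - sqnorm2 (noises r L f)"
  using assms(1-3)
proof (induction L)
  case Nil then show ?case by (simp add: noises_def)
next
  case (Cons n L)
  have n: "n \<in> set I" "n \<notin> set L" and L: "set L \<subseteq> set I" "distinct L" using Cons.prems by auto
  define h where "h = noises r L f"
  have h: "h \<in> B"
    unfolding h_def using r by (intro markov_mem[OF markov_noises] L Cons.prems) auto
  have rec: "noises r (n # L) f = noise r n h" by (simp add: noises_def h_def)
  have "sqnorm2 (lap j (noise r n h)) \<le> sqnorm2 (lap j h)" if "j \<in> set L" for j
  proof -
    have j: "j \<in> set I" using that L by auto
    have "lap j (noise r n h) = noise r n (lap j h)"
      using r n h j by (intro lap_commute markov_noise commuting_E_noise') auto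
    then show ?thesis
      using sqnorm2_contraction[OF sym_markov_noise[OF n(1)] lap_mem[OF j h], of r] r by simp
  qed
  then have "(\<Sum>j\<in>set L. sqnorm2 (lap j (noise r n h))) \<le> (\<Sum>j\<in>set L. sqnorm2 (lap j h))"
    by (rule sum_mono)
  then have "(1 - r\<^sup>2) * (\<Sum>j\<in>set L. sqnorm2 (lap j (noise r n h)))
      \<le> (1 - r\<^sup>2) * (\<Sum>j\<in>set L. sqnorm2 (lap j h))"
    using r by (intro mult_left_mono) (auto simp: power_le_one)
  also have "\<dots> \<le> sqnorm2 f - sqnorm2 h"
    using Cons.IH L Cons.prems unfolding h_def by simp
  finally show ?case
    using energy_coordinate[OF n(1) h r] n unfolding rec by (simp add: algebra_simps)
qed

text \<open>With w the error of the remaining coordinates, the new error is f - noise r n f plus the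
  noise of w. The latter is contracted, so errors of single coordinates merely add up.\<close>

lemma norm1_noises_telescope:
  assumes "set L \<subseteq> set I" "distinct L" "f \<in> B" and r: "0 \<le> r" "r \<le> 1"
  shows "norm1 (\<lambda>x. f x - noises r L f x) \<le> (\<Sum>n\<in>set L. norm1 (\<lambda>x. f x - noise r n f x))"
  using assms(1-3)
proof (induction L)
  case Nil then show ?case by (simp add: noises_def norm1_def ev_const)
next
  case (Cons n L)
  have n: "n \<in> set I" "n \<notin> set L" and L: "set L \<subseteq> set I" "distinct L" using Cons.prems by auto
  have h: "noises r L f \<in> B"
    using r by (intro markov_mem[OF markov_noises] L Cons.prems) auto
  define w where "w = (\<lambda>x. f x - noises r L f x)"
  have w: "w \<in> B" unfolding w_def by (intro mem h Cons.prems)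
  have "(\<lambda>x. f x - noises r (n # L) f x) = (\<lambda>x. (f x - noise r n f x) + noise r n w x)"
    unfolding w_def using markov_diff[OF markov_noise[OF n(1) r]] Cons.prems h
    by (simp add: noises_def)
  then have "norm1 (\<lambda>x. f x - noises r (n # L) f x)
      \<le> norm1 (\<lambda>x. f x - noise r n f x) + norm1 (noise r n w)"
    using Cons.prems markov_mem[OF markov_noise[OF n(1) r]] w by (simp add: norm1_triangle mem)
  also have "norm1 (noise r n w) \<le> norm1 w"
    by (intro norm1_contraction sym_markov_noise n r w)
  also have "norm1 w \<le> (\<Sum>n\<in>set L. norm1 (\<lambda>x. f x - noise r n f x))"
    unfolding w_def using Cons.IH L Cons.prems by simp
  finally show ?case using n by simp
qed

text \<open>By self-adjointness the squared norm at r is the pairing of f with the twofold noise,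
  whose parameter is r^2; then Cauchy-Schwarz applies.\<close>

lemma sqnorm2_noises_log_convex:
  assumes L: "set L \<subseteq> set I" "distinct L" and f: "f \<in> B" and r: "0 \<le> r" "r \<le> 1"
  shows "(sqnorm2 (noises r L f))\<^sup>2 \<le> sqnorm2 f * sqnorm2 (noises (r\<^sup>2) L f)"
proof -
  note M = markov_mem[OF markov_noises[OF L r]]
  have "sqnorm2 (noises r L f) = ev (\<lambda>x. f x * noises r L (noises r L f) x)"
    using sym_markovD[OF sym_markov_noises[OF L r] f M[OF f]] by (simp add: sqnorm2_def power2_eq_square)
  also have "noises r L (noises r L f) = noises (r\<^sup>2) L f"
    using noises_noises[OF L r r f] by (simp add: power2_eq_square)
  finally show ?thesis
    using ev_Cauchy_Schwarz[OF f markov_mem[OF markov_noises[OF L, of "r\<^sup>2"] f]] r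
    by (simp add: sqnorm2_def power_le_one)
qed

text \<open>Repeated squaring: the bound for 2^k is squared and log-convexity is applied at the
  parameter r^(2^k), which doubles the exponent and costs one further factor
  \<open>sqnorm2 f\<close>.\<close>

lemma sqnorm2_noises_power:
  assumes L: "set L \<subseteq> set I" "distinct L" and f: "f \<in> B" and r: "0 \<le> r" "r \<le> 1"
  shows "sqnorm2 (noises r L f) ^ (2 ^ k) \<le> sqnorm2 f ^ (2 ^ k - 1) * sqnorm2 (noises (r ^ (2 ^ k)) L f)"
proof (induction k)
  case (Suc k)
  let ?t = "sqnorm2 (noises r L f)" and ?b = "sqnorm2 f"
  let ?y = "\<lambda>k. sqnorm2 (noises (r ^ (2 ^ k)) L f)"
  have rk: "0 \<le> r ^ j" "r ^ j \<le> 1" for j using r by (auto simp: power_le_one)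
  have nn: "0 \<le> ?t" "0 \<le> ?b"
    by (intro sqnorm2_nonneg markov_mem[OF markov_noises[OF L r]] f)+
  have "?t ^ (2 ^ Suc k) = (?t ^ (2 ^ k))\<^sup>2"
    by (simp add: power_mult[symmetric] mult.commute)
  also have "\<dots> \<le> (?b ^ (2 ^ k - 1) * ?y k)\<^sup>2"
    using Suc nn by (intro power_mono) auto
  also have "\<dots> = ?b ^ (2 * (2 ^ k - 1)) * (?y k)\<^sup>2"
    by (simp add: power_mult_distrib power_mult[symmetric] mult.commute)
  also have "\<dots> \<le> ?b ^ (2 * (2 ^ k - 1)) * (?b * ?y (Suc k))"
  proof (rule mult_left_mono)
    have "(r ^ (2 ^ k))\<^sup>2 = r ^ (2 ^ Suc k)"
      by (simp add: power_mult[symmetric] mult.commute)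
    then show "(?y k)\<^sup>2 \<le> ?b * ?y (Suc k)"
      using sqnorm2_noises_log_convex[OF L f rk, of "2 ^ k"] by simp
  qed (use nn in simp)
  also have "\<dots> = ?b ^ Suc (2 * (2 ^ k - 1)) * ?y (Suc k)" by simp
  \<comment> \<open>With subtraction of natural numbers this needs 2 ^ k to be positive.\<close>
  also have "Suc (2 * (2 ^ k - 1)) = 2 ^ Suc k - (1::nat)"
    unfolding power_Suc using zero_less_power[of "2::nat" k, OF zero_less_numeral] by arith
  finally show ?case .
qed simp

text \<open>Carries an estimate at r^(2^k), where hypercontractivity will hold, back to r. The
  weight \<kappa> is to be chosen small: it multiplies the energy, and its reciprocal power falls on
  the term made small by small derivatives.\<close>

lemma sqnorm2_noises_interpolation:
  assumes L: "set L \<subseteq> set I" "distinct L" and f: "f \<in> B" and r: "0 \<le> r" "r \<le> 1" and "0 < \<kappa>"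
  shows "sqnorm2 (noises r L f) \<le> \<kappa> * sqnorm2 f + sqnorm2 (noises (r ^ (2 ^ k)) L f) / \<kappa> ^ (2 ^ k - 1)"
proof (rule log_convex_interpolation)
  have rk: "0 \<le> r ^ j" "r ^ j \<le> 1" for j using r by (auto simp: power_le_one)
  show "0 \<le> sqnorm2 (noises (r ^ 2 ^ k) L f)"
    by (intro sqnorm2_nonneg markov_mem[OF markov_noises[OF L rk]] f)
  show "0 \<le> sqnorm2 (noises r L f)" "0 \<le> sqnorm2 f"
    by (intro sqnorm2_nonneg markov_mem[OF markov_noises[OF L r]] f)+
  show "sqnorm2 (noises r L f) ^ Suc (2 ^ k - 1) \<le> sqnorm2 f ^ (2 ^ k - 1) * sqnorm2 (noises (r ^ 2 ^ k) L f)"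
    using sqnorm2_noises_power[OF L f r, of k] by simp
qed fact

end


section \<open>Hypercontractivity, one coordinate at a time\<close>

lemma fourth_power_bound:
  fixes e w V :: real
  assumes "w\<^sup>2 \<le> V / 4"
  shows "(e + w) ^ 4 \<le> e ^ 4 + 4 * (e ^ 3 * w) + 8 * (e\<^sup>2 * w\<^sup>2) + 3 * (V / 4 * w\<^sup>2)"
proof -
  \<comment> \<open>The third moment of w need not vanish, so the cubic term is absorbed by its
    neighbours. The linear term stays, because w will have mean 0.\<close>
  have "4 * (e * w ^ 3) \<le> 2 * (e\<^sup>2 * w\<^sup>2) + 2 * w ^ 4"
    using zero_le_power2[of "e * w - w\<^sup>2"]
    by (simp add: power2_eq_square power3_eq_cube power4_eq_xxxx algebra_simps)
  moreover have "3 * w ^ 4 \<le> 3 * (V / 4 * w\<^sup>2)"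
    using mult_right_mono[OF assms zero_le_power2[of w]] by (simp add: power4_eq_xxxx power2_eq_square)
  moreover have "(e + w) ^ 4 = e ^ 4 + 4 * (e ^ 3 * w) + 6 * (e\<^sup>2 * w\<^sup>2) + 4 * (e * w ^ 3) + w ^ 4"
    by (simp add: power2_eq_square power3_eq_cube power4_eq_xxxx algebra_simps)
  ultimately show ?thesis by linarith
qed

context coordinate_operators
begin

text \<open>Split u into its mean e and the rest v. The noise gives e + w with w = \<tau> G v, and
  \<open>G_sup\<close> bounds w^2 pointwise by V / 4, where V is the mean of v^2; this reduces
  fourth moments of w to second ones. The constant 1/4 turns 8 e^2 w^2 into the cross term 2 e^2 V
  of (e^2 + V)^2. The inequality is conditional on the other coordinates, as tensorization
  requires.\<close>

lemma hypercontractive_coordinate: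
  assumes n: "n \<in> set I" and u: "u \<in> B" and \<tau>: "0 \<le> \<tau>" "\<tau> \<le> 1" "\<tau>\<^sup>2 * m \<le> 1 / 4"
  shows "E n (\<lambda>x. (noise \<tau> n u x) ^ 4) x \<le> (E n (\<lambda>x. (u x)\<^sup>2) x)\<^sup>2"
proof -
  note M = E_markov[OF n]
  define e v where "e = E n u" and "v = lap n u"
  define w where "w = (\<lambda>x. \<tau> * G n v x)"
  define V where "V = E n (\<lambda>x. (v x)\<^sup>2)"
  have B: "e \<in> B" "v \<in> B" "V \<in> B" "w \<in> B"
    unfolding e_def v_def V_def w_def
    by (intro mem markov_mem[OF M] markov_mem[OF G_markov[OF n]] lap_mem n u)+
  note [simp] = B mem markov_mem[OF M]
  have Ee: "E n e = e" and Ev: "E n v = (\<lambda>_. 0)"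
    using n u by (simp_all add: e_def v_def E_lap cond_exp_op_idem[OF E_op])
  have pull: "E n (\<lambda>x. g x * h x) = (\<lambda>x. g x * E n h x)" if "E n g = g" "g \<in> B" "h \<in> B" for g h
    using cond_exp_op_pull_out[OF E_op[OF n] that(2,3)] that(1) by simp
  have mult_inv: "E n (\<lambda>x. g x * h x) = (\<lambda>x. g x * h x)" if "E n g = g" "E n h = h" "g \<in> B" "h \<in> B" for g h
    using pull[of g h] that by simp
  have e2: "E n (\<lambda>x. (e x)\<^sup>2) = (\<lambda>x. (e x)\<^sup>2)"
    using mult_inv[OF Ee Ee] by (simp add: power2_eq_square)
  have e3: "E n (\<lambda>x. e x ^ 3) = (\<lambda>x. e x ^ 3)"
    using mult_inv[OF e2 Ee] by (simp add: power2_eq_square power3_eq_cube)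
  have e4: "E n (\<lambda>x. e x ^ 4) = (\<lambda>x. e x ^ 4)"
    using mult_inv[OF e2 e2] by (simp add: power2_eq_square power4_eq_xxxx mult.assoc)
  have EV: "E n V = V" "E n (\<lambda>x. V x / 4) = (\<lambda>x. V x / 4)"
  proof -
    show "E n V = V" using n by (simp add: V_def cond_exp_op_idem[OF E_op])
    then show "E n (\<lambda>x. V x / 4) = (\<lambda>x. V x / 4)"
      using markov_cmult[OF M B(3), of "1/4"] by simp
  qed
  have Ew: "E n w = (\<lambda>_. 0)"
    unfolding w_def using n Ev by (simp add: markov_cmult[OF M] markov_mem[OF G_markov] E_G_same)
  have noise: "noise \<tau> n u = (\<lambda>x. e x + w x)"
    using n u by (auto simp: noise_def w_def v_def lap_def[abs_def] e_def markov_diff[OF G_markov]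
        G_E_same algebra_simps)
  have w_le: "(w x)\<^sup>2 \<le> V x / 4" for x
  proof -
    have "(w x)\<^sup>2 = \<tau>\<^sup>2 * (G n v x)\<^sup>2" by (simp add: w_def power_mult_distrib)
    also have "\<dots> \<le> \<tau>\<^sup>2 * (m * V x)"
      unfolding V_def by (intro mult_left_mono G_sup n B) simp
    also have "\<dots> = (\<tau>\<^sup>2 * m) * V x" by simp
    also have "\<dots> \<le> 1 / 4 * V x"
      using \<tau> unfolding V_def by (intro mult_right_mono markov_nonneg[OF M]) auto
    finally show ?thesis by simp
  qed
  define W where "W = E n (\<lambda>x. (w x)\<^sup>2)"
  have W: "0 \<le> W x" "W x \<le> V x / 4" for x
  proof -
    show "0 \<le> W x" unfolding W_def by (intro markov_nonneg[OF M]) auto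
    have "W x \<le> E n (\<lambda>x. V x / 4) x"
      unfolding W_def by (intro markov_mono[OF M] w_le) auto
    then show "W x \<le> V x / 4" by (simp add: EV)
  qed
  have "E n (\<lambda>x. (noise \<tau> n u x) ^ 4) x \<le>
      E n (\<lambda>x. e x ^ 4 + 4 * (e x ^ 3 * w x) + 8 * ((e x)\<^sup>2 * (w x)\<^sup>2) + 3 * (V x / 4 * (w x)\<^sup>2)) x"
    unfolding noise by (intro markov_mono[OF M] fourth_power_bound w_le) auto
  also have "\<dots> = e x ^ 4 + 4 * (e x ^ 3 * E n w x) + 8 * ((e x)\<^sup>2 * W x) + 3 * (V x / 4 * W x)"
    unfolding W_def
    by (simp add: markov_add[OF M] markov_cmult[OF M] pull[OF e3] pull[OF e2] pull[OF EV(2)] e4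
        del: times_divide_eq_left)
  also have "\<dots> \<le> e x ^ 4 + 8 * ((e x)\<^sup>2 * (V x / 4)) + 3 * (V x / 4 * (V x / 4))"
  proof -
    have "(e x)\<^sup>2 * W x \<le> (e x)\<^sup>2 * (V x / 4)" using W by (intro mult_left_mono) auto
    moreover have "V x / 4 * W x \<le> V x / 4 * (V x / 4)"
      using W[of x] by (intro mult_left_mono) auto
    moreover have "4 * (e x ^ 3 * E n w x) = 0" by (simp add: Ew)
    ultimately show ?thesis by linarith
  qed
  also have "\<dots> \<le> ((e x)\<^sup>2 + V x)\<^sup>2"
    by (simp add: power2_eq_square power4_eq_xxxx algebra_simps)
  also have "(e x)\<^sup>2 + V x = E n (\<lambda>x. (u x)\<^sup>2) x"
  proof -
    have "(\<lambda>x. (u x)\<^sup>2) = (\<lambda>x. ((e x)\<^sup>2 + 2 * (e x * v x)) + (v x)\<^sup>2)"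
      by (auto simp: e_def v_def lap_def power2_eq_square algebra_simps)
    then show ?thesis
      by (simp add: markov_add[OF M] markov_cmult[OF M] pull[OF Ee] e2 Ev V_def)
  qed
  finally show ?thesis .
qed

text \<open>The instance of Minkowski's inequality that tensorizes hypercontractivity is obtained from the
  weighted Cauchy--Schwarz inequality with weight \<open>Q\<close>.\<close>

lemma hypercontractive_foldr:
  assumes L: "set L \<subseteq> set I" "distinct L" and g: "g \<in> B"
    and \<tau>: "0 \<le> \<tau>" "\<tau> \<le> 1" "\<tau>\<^sup>2 * m \<le> 1 / 4"
  shows "foldr E L (\<lambda>x. (noises \<tau> L g x) ^ 4) x \<le> (foldr E L (\<lambda>x. (g x)\<^sup>2) x)\<^sup>2"
  using L
proof (induction L arbitrary: x)
  case Nil then show ?case by (simp add: noises_def power_mult[symmetric])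
next
  case (Cons n L)
  have n: "n \<in> set I" "n \<notin> set L" and L: "set L \<subseteq> set I" "distinct L" using Cons.prems by auto
  note M = E_markov[OF n(1)] and MF = markov_foldr_E[OF L(1)]
  define h where "h = noises \<tau> L g"
  have h: "h \<in> B"
    unfolding h_def using \<tau> by (intro markov_mem[OF markov_noises] L g) auto
  note [simp] = g h mem markov_mem[OF M] markov_mem[OF MF] markov_mem[OF markov_noise[OF n(1) \<tau>(1,2)]]
  have comm: "foldr E L (E n f) = E n (foldr E L f)" if "f \<in> B" for f
    using commutingD[OF commuting_foldr[of L "E n" E] that] L n E_commute E_markov by fastforce
  define P where "P = foldr E L (\<lambda>x. (g x)\<^sup>2)"
  have P: "P \<in> B" "0 \<le> P x" for x
    unfolding P_def by (auto intro: markov_nonneg[OF MF])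
  note [simp] = P(1)
  \<comment> \<open>The summand d keeps the weight \<open>Q\<close> away from 0, so that its
    reciprocal lies in \<open>B\<close>; at the end d tends to 0.\<close>
  have step: "foldr E L (\<lambda>x. (E n (\<lambda>x. (h x)\<^sup>2) x)\<^sup>2) x \<le> (E n P x + d)\<^sup>2" if d: "0 < d" for d
  proof -
    define Q where "Q = (\<lambda>x. P x + d)"
    have Q: "Q \<in> B" "d \<le> Q x" "0 < Q x" for x using P(2)[of x] d by (simp_all add: Q_def)
    have iQ [simp]: "(\<lambda>x. inverse (Q x)) \<in> B" by (rule inverse_mem[OF Q(1) d Q(2)])
    note [simp] = Q(1)
    have EQ: "E n Q = (\<lambda>x. E n P x + d)"
      unfolding Q_def by (simp add: markov_add[OF M] markov_const[OF M])
    have LP: "foldr E L P = P"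
      unfolding P_def by (simp add: cond_exp_op_idem[OF cond_exp_op_foldr_E[OF L(1)]])
    then have LQ: "foldr E L Q = Q"
      unfolding Q_def by (simp add: markov_add[OF MF] markov_const[OF MF])
    have LEQ: "foldr E L (E n Q) = E n Q" by (simp add: comm LQ)
    have pull: "foldr E L (\<lambda>x. k x * f x) = (\<lambda>x. k x * foldr E L f x)"
      if "foldr E L k = k" "k \<in> B" "f \<in> B" for k f
      using cond_exp_op_pull_out[OF cond_exp_op_foldr_E[OF L(1)] that(2,3)] that(1) by simp
    \<comment> \<open>\<open>Q\<close> is invariant under the averages over \<open>L\<close>.
      Pulling it out of the average of Q times its reciprocal, which is 1, shows the same for the
      reciprocal.\<close>
    have LiQ: "foldr E L (\<lambda>x. inverse (Q x)) = (\<lambda>x. inverse (Q x))"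
    proof
      fix x
      have "foldr E L (\<lambda>x. Q x * inverse (Q x)) x = Q x * foldr E L (\<lambda>x. inverse (Q x)) x"
        by (simp add: pull[OF LQ])
      moreover have "(\<lambda>x. Q x * inverse (Q x)) = (\<lambda>_. 1)"
        using Q(3) by (auto simp: fun_eq_iff) (metis less_irrefl right_inverse)
      ultimately show "foldr E L (\<lambda>x. inverse (Q x)) x = inverse (Q x)"
        using Q(3)[of x] markov_one[OF MF] by (simp add: field_simps)
    qed
    define H where "H = (\<lambda>x. inverse (Q x) * h x ^ 4)"
    have H [simp]: "H \<in> B" by (simp add: H_def)
    \<comment> \<open>Cauchy-Schwarz for the root of Q and h^2 divided by that root, as a
      discriminant so that no root has to lie in \<open>B\<close>.\<close>
    have CS: "(E n (\<lambda>x. (h x)\<^sup>2) x)\<^sup>2 \<le> E n Q x * E n H x" for x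
    proof -
      have quad: "0 \<le> E n Q x - 2 * t * E n (\<lambda>x. (h x)\<^sup>2) x + t\<^sup>2 * E n H x" for t
      proof -
        have eq: "(\<lambda>x. inverse (Q x) * (Q x - t * (h x)\<^sup>2)\<^sup>2)
            = (\<lambda>x. (Q x - (2 * t) * (h x)\<^sup>2) + t\<^sup>2 * H x)"
        proof
          fix x
          show "inverse (Q x) * (Q x - t * (h x)\<^sup>2)\<^sup>2 = (Q x - (2 * t) * (h x)\<^sup>2) + t\<^sup>2 * H x"
            using Q(3)[of x] by (simp add: H_def field_simps power2_eq_square power4_eq_xxxx)
        qed
        have "0 \<le> E n (\<lambda>x. inverse (Q x) * (Q x - t * (h x)\<^sup>2)\<^sup>2) x"
          using Q(3) by (intro markov_nonneg[OF M]) (auto simp: less_imp_le)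
        then show ?thesis
          unfolding eq by (simp add: markov_add[OF M] markov_diff[OF M] markov_cmult[OF M])
      qed
      have "0 \<le> E n H x"
        using Q(3) unfolding H_def by (intro markov_nonneg[OF M]) (auto simp: less_imp_le)
      from quadratic_nonneg_discriminant[OF quad this] show ?thesis .
    qed
    have "foldr E L (\<lambda>x. (E n (\<lambda>x. (h x)\<^sup>2) x)\<^sup>2) x \<le> foldr E L (\<lambda>x. E n Q x * E n H x) x"
      by (intro markov_mono[OF MF] CS) auto
    also have "\<dots> = E n Q x * E n (foldr E L H) x"
      by (simp add: pull[OF LEQ] comm)
    \<comment> \<open>By the induction hypothesis h^4 averages over \<open>L\<close> to at most P^2,
      which is at most Q^2; dividing by the invariant weight leaves Q.\<close>
    also have "\<dots> \<le> E n Q x * E n Q x"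
    proof (intro mult_left_mono markov_mono[OF M])
      fix x
      have "foldr E L H x = inverse (Q x) * foldr E L (\<lambda>x. h x ^ 4) x"
        unfolding H_def by (simp add: pull[OF LiQ])
      also have "\<dots> \<le> inverse (Q x) * (P x)\<^sup>2"
        using Cons.IH[OF L, of x] Q(3)[of x] unfolding h_def P_def by (intro mult_left_mono) auto
      also have "\<dots> \<le> inverse (Q x) * (Q x)\<^sup>2"
        using Q(3)[of x] P(2)[of x] d by (intro mult_left_mono power_mono) (auto simp: Q_def)
      also have "\<dots> = Q x" using Q(3)[of x] by (simp add: power2_eq_square)
      finally show "foldr E L H x \<le> Q x" .
    next
      show "0 \<le> E n Q x" using Q(3) by (intro markov_nonneg[OF M]) (auto simp: less_imp_le)
    qed auto
    finally show ?thesis by (simp add: EQ power2_eq_square)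
  qed
  have lim: "((\<lambda>d. (E n P x + d)\<^sup>2) \<longlongrightarrow> (E n P x + 0)\<^sup>2) (at_right 0)"
    by (intro tendsto_intros)
  have "foldr E L (\<lambda>x. (E n (\<lambda>x. (h x)\<^sup>2) x)\<^sup>2) x \<le> (E n P x + 0)\<^sup>2"
    by (rule tendsto_lowerbound[OF lim])
      (auto simp: eventually_at_right_less step intro: eventually_mono[OF eventually_at_right_less])
  moreover have "foldr E (n # L) (\<lambda>x. (noises \<tau> (n # L) g x) ^ 4) x =
      foldr E L (E n (\<lambda>x. (noise \<tau> n h x) ^ 4)) x"
    by (simp add: noises_def h_def[symmetric, unfolded noises_def] comm)
  moreover have "\<dots> \<le> foldr E L (\<lambda>x. (E n (\<lambda>x. (h x)\<^sup>2) x)\<^sup>2) x"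
    by (intro markov_mono[OF MF] hypercontractive_coordinate n h \<tau>) auto
  ultimately show ?case by (simp add: P_def)
qed

lemma hypercontractive:
  assumes g: "g \<in> B" and \<tau>: "0 \<le> \<tau>" "\<tau> \<le> 1" "\<tau>\<^sup>2 * m \<le> 1 / 4"
  shows "ev (\<lambda>x. (noises \<tau> I g x) ^ 4) \<le> (sqnorm2 g)\<^sup>2"
  using hypercontractive_foldr[OF subset_refl distinct_I g \<tau>, of undefined]
  by (simp add: ev_def sqnorm2_def)

text \<open>This is what duality, from L_(4/3) to L_2, and interpolation of L_(4/3) between L_1 and
  L_2 would give. To avoid fractional exponents, X is written as the pairing of g with the twofold
  noise h, and the L_4 bound is applied to the noise of g: its right-hand side is X^2 again, which
  cancels.\<close>

lemma sqnorm2_noises_le: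
  assumes g: "g \<in> B" and \<tau>: "0 \<le> \<tau>" "\<tau> \<le> 1" "\<tau>\<^sup>2 * m \<le> 1 / 4"
  shows "(sqnorm2 (noises \<tau> I g))\<^sup>2 \<le> (norm1 g)\<^sup>2 * sqnorm2 g"
proof -
  note S = sym_markov_noises[OF subset_refl distinct_I \<tau>(1,2)]
  note M = markov_mem[OF sym_markov_markov[OF S]]
  note [simp] = g mem M
  define X where "X = sqnorm2 (noises \<tau> I g)"
  define h where "h = noises \<tau> I (noises \<tau> I g)"
  have h [simp]: "h \<in> B" by (simp add: h_def)
  define y where "y = ev (\<lambda>x. \<bar>g x\<bar> * (h x)\<^sup>2)"
  have X: "X = ev (\<lambda>x. g x * h x)"
    using sym_markovD[OF S g M[OF g]] by (simp add: X_def sqnorm2_def h_def power2_eq_square)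
  have nn: "0 \<le> X" "0 \<le> y" "0 \<le> norm1 g" "0 \<le> sqnorm2 g"
    unfolding X_def y_def by (auto intro!: sqnorm2_nonneg norm1_nonneg ev_nonneg)
  text \<open>Cauchy--Schwarz for \<open>g h = sgn g \<cdot> \<bar>g\<bar>\<^sup>1\<^sup>/\<^sup>2 \<cdot> \<bar>g\<bar>\<^sup>1\<^sup>/\<^sup>2 h\<close>,
    in discriminant form because \<open>B\<close> is not closed under square roots.\<close>
  have X2: "X\<^sup>2 \<le> norm1 g * y"
  proof (rule quadratic_nonneg_discriminant)
    fix t
    have "0 \<le> ev (\<lambda>x. \<bar>g x\<bar> - (2 * t) * (g x * h x) + t\<^sup>2 * (\<bar>g x\<bar> * (h x)\<^sup>2))"
    proof (rule ev_nonneg)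
      fix x
      have "2 * t * (g x * h x) \<le> \<bar>g x\<bar> * (2 * \<bar>t * h x\<bar>)"
        using abs_ge_self[of "2 * t * (g x * h x)"] by (simp add: abs_mult mult_ac)
      moreover have "0 \<le> \<bar>g x\<bar> * (1 - \<bar>t * h x\<bar>)\<^sup>2" by simp
      moreover have "\<bar>g x\<bar> * (1 - \<bar>t * h x\<bar>)\<^sup>2 =
          \<bar>g x\<bar> - \<bar>g x\<bar> * (2 * \<bar>t * h x\<bar>) + t\<^sup>2 * (\<bar>g x\<bar> * (h x)\<^sup>2)"
        unfolding power2_diff power2_abs by (simp add: power_mult_distrib algebra_simps)
      ultimately show "0 \<le> \<bar>g x\<bar> - (2 * t) * (g x * h x) + t\<^sup>2 * (\<bar>g x\<bar> * (h x)\<^sup>2)"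
        by simp
    qed simp
    then show "0 \<le> norm1 g - 2 * t * X + t\<^sup>2 * y"
      by (simp add: ev_linear X y_def norm1_def)
  qed (rule nn)
  have y2: "y\<^sup>2 \<le> sqnorm2 g * X\<^sup>2"
  proof -
    have "y\<^sup>2 \<le> ev (\<lambda>x. \<bar>g x\<bar>\<^sup>2) * ev (\<lambda>x. ((h x)\<^sup>2)\<^sup>2)"
      unfolding y_def by (intro ev_Cauchy_Schwarz) auto
    also have "\<dots> = sqnorm2 g * ev (\<lambda>x. h x ^ 4)"
      by (simp add: sqnorm2_def)
    also have "\<dots> \<le> sqnorm2 g * X\<^sup>2"
      unfolding X_def h_def by (intro mult_left_mono hypercontractive \<tau> nn) auto
    finally show ?thesis .
  qed
  have "X\<^sup>2 * X\<^sup>2 \<le> (norm1 g * y)\<^sup>2"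
    using power_mono[OF X2, of 2] by (simp add: power2_eq_square mult_ac)
  also have "\<dots> = (norm1 g)\<^sup>2 * y\<^sup>2" by (simp add: power_mult_distrib)
  also have "\<dots> \<le> (norm1 g)\<^sup>2 * (sqnorm2 g * X\<^sup>2)"
    by (intro mult_left_mono y2) auto
  finally have "X\<^sup>2 * X\<^sup>2 \<le> ((norm1 g)\<^sup>2 * sqnorm2 g) * X\<^sup>2" by (simp add: mult_ac)
  then have "X = 0 \<or> X\<^sup>2 \<le> (norm1 g)\<^sup>2 * sqnorm2 g"
    using mult_right_le_imp_le[of "X\<^sup>2" "X\<^sup>2"] by (cases "X = 0") simp_all
  then show ?thesis
    unfolding X_def[symmetric] using nn by auto
qed


section \<open>Approximation by few coordinates in the abstract setting\<close>

lemma norm1_minus_noise: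
  assumes n: "n \<in> set I" and f: "f \<in> B" and \<eta>: "0 \<le> \<eta>" "\<eta> \<le> 1"
    and lap: "norm1 (lap n f) \<le> c" and G: "norm1 (\<lambda>x. f x - G n f x) \<le> \<eta> * c"
  shows "norm1 (\<lambda>x. f x - noise (1 - \<eta>) n f x) \<le> 2 * \<eta> * c"
proof -
  have sc: "norm1 (\<lambda>x. s * g x) = s * norm1 g" if "g \<in> B" "0 \<le> s" for s g
    using that by (simp add: norm1_def abs_mult ev_cmult mem)
  have B: "(\<lambda>x. f x - G n f x) \<in> B" "lap n f \<in> B"
    by (intro mem lap_mem markov_mem[OF G_markov[OF n]] n f)+
  have eq: "(\<lambda>x. f x - noise (1 - \<eta>) n f x) = (\<lambda>x. (1 - \<eta>) * (f x - G n f x) + \<eta> * lap n f x)"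
    by (auto simp: noise_def lap_def algebra_simps)
  have "norm1 (\<lambda>x. f x - noise (1 - \<eta>) n f x)
      \<le> (1 - \<eta>) * norm1 (\<lambda>x. f x - G n f x) + \<eta> * norm1 (lap n f)"
    unfolding eq using norm1_triangle[OF mult_mem[OF const_mem[of "1 - \<eta>"] B(1)] mult_mem[OF const_mem[of \<eta>] B(2)]] \<eta>
    by (simp add: sc B)
  also have "\<dots> \<le> 1 * norm1 (\<lambda>x. f x - G n f x) + \<eta> * norm1 (lap n f)"
    using \<eta> norm1_nonneg[OF B(1)] by (intro add_mono mult_right_mono order_refl) auto
  also have "\<dots> \<le> 1 * (\<eta> * c) + \<eta> * c"
    using \<eta> lap G by (intro add_mono mult_left_mono) auto
  finally show ?thesis by simp
qed

lemma norm1_diff_commute: "norm1 (\<lambda>x. f x - g x) = norm1 (\<lambda>x. g x - f x)"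
  by (simp add: norm1_def abs_minus_commute)

lemma norm1_triangle3:
  assumes "f \<in> B" "g \<in> B" "h \<in> B"
  shows "norm1 (\<lambda>x. f x - h x) \<le> norm1 (\<lambda>x. f x - g x) + norm1 (\<lambda>x. g x - h x)"
  using norm1_triangle[OF diff_mem[OF assms(1,2)] diff_mem[OF assms(2,3)]] by simp

text \<open>\<open>R\<close> lists the coordinates integrated out, \<open>a n\<close> stands for the
  L_1 norm of the n-th derivative, and 2 ^ k is the power of the noise that is hypercontractive.
  \<open>C\<close> bounds the total energy and \<open>K\<close> is the cost of interpolation. Of the
  error 8 \<eta>, one half comes from smoothing f and the other from smoothing its average over
  \<open>R\<close>.\<close>

theorem junta_approximation:
  assumes f: "f \<in> B" and \<eta>: "0 < \<eta>" "\<eta> < 1" and \<kappa>: "0 < \<kappa>"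
    and k: "((1 - \<eta>) ^ (2 ^ k))\<^sup>2 * m \<le> 1 / 4"
    and lap: "\<And>n. n \<in> set I \<Longrightarrow> norm1 (lap n f) \<le> a n"
    and G: "\<And>n. n \<in> set I \<Longrightarrow> norm1 (\<lambda>x. f x - G n f x) \<le> \<eta> * a n"
    and a: "(\<Sum>n\<in>set I. a n) \<le> 1"
    and var: "sqnorm2 (\<lambda>x. f x - ev f) \<le> 1"
    and R: "set R \<subseteq> set I" "distinct R" and "0 \<le> \<delta>" and small: "\<And>n. n \<in> set R \<Longrightarrow> a n \<le> \<delta>"
  defines "C \<equiv> 1 / (1 - (1 - \<eta>)\<^sup>2)" and "K \<equiv> 1 / \<kappa> ^ (2 ^ k - 1)"
  shows "norm1 (\<lambda>x. f x - foldr E R f x) \<le> 8 * \<eta> + sqrt (2 * \<kappa> * C + K\<^sup>2 * \<delta> / (4 * \<kappa>))"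
proof -
  define r where "r = 1 - \<eta>"
  have r: "0 \<le> r" "r \<le> 1" "r < 1" using \<eta> by (auto simp: r_def)
  define T where "T = noises r I"
  have ST: "sym_markov T"
    unfolding T_def using r by (intro sym_markov_noises distinct_I) auto
  note MT = sym_markov_markov[OF ST]
  have a_nonneg: "0 \<le> a n" if "n \<in> set I" for n
    using norm1_nonneg[OF lap_mem[OF that f]] lap[OF that] by simp
  have [simp]: "T g \<in> B" if "g \<in> B" for g using that by (rule markov_mem[OF MT])
  have [simp]: "foldr E R g \<in> B" if "g \<in> B" for g using that by (rule markov_mem[OF markov_foldr_E[OF R(1)]])
  have SE: "sym_markov (foldr E R)"
    using R by (intro sym_markov_foldr sym_markov_E E_commute) auto
  note [simp] = f mem lap_mem
  have fT: "norm1 (\<lambda>x. f x - T f x) \<le> 2 * \<eta>"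
  proof -
    have "norm1 (\<lambda>x. f x - T f x) \<le> (\<Sum>n\<in>set I. norm1 (\<lambda>x. f x - noise r n f x))"
      unfolding T_def by (intro norm1_noises_telescope f distinct_I r) auto
    also have "\<dots> \<le> (\<Sum>n\<in>set I. 2 * \<eta> * a n)"
      unfolding r_def using \<eta> by (intro sum_mono norm1_minus_noise f lap G) auto
    also have "\<dots> = 2 * \<eta> * (\<Sum>n\<in>set I. a n)" by (simp add: sum_distrib_left)
    also have "\<dots> \<le> 2 * \<eta> * 1" using \<eta> a by (intro mult_left_mono) auto
    finally show ?thesis by simp
  qed
  \<comment> \<open>Two factors are needed: the inner one makes the energies of
    \<open>lap n (T f)\<close> summable, the outer one is interpolated against its powers.\<close>
  define h where "h = T (T f)"
  have h [simp]: "h \<in> B" by (simp add: h_def)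
  have fh: "norm1 (\<lambda>x. f x - h x) \<le> 4 * \<eta>"
  proof -
    have "norm1 (\<lambda>x. T f x - h x) \<le> norm1 (\<lambda>x. f x - T f x)"
      using norm1_contraction[OF ST, of "\<lambda>x. f x - T f x"] markov_diff[OF MT, of f "T f"]
      by (simp add: h_def)
    then show ?thesis using norm1_triangle3[of f "T f" h] fT by simp
  qed
  have Eh: "norm1 (\<lambda>x. foldr E R h x - foldr E R f x) \<le> 4 * \<eta>"
  proof -
    have "norm1 (foldr E R (\<lambda>x. h x - f x)) \<le> norm1 (\<lambda>x. h x - f x)"
      by (intro norm1_contraction SE) simp
    then show ?thesis
      using fh by (simp add: norm1_diff_commute[of h f] markov_diff[OF markov_foldr_E[OF R(1)]])
  qed
  define g where "g n = lap n (T f)" for n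
  have g: "g n \<in> B" "g n = T (lap n f)" "lap n h = T (g n)" if "n \<in> set I" for n
  proof -
    have comm: "commuting (E n) T"
      unfolding T_def using r that by (intro commuting_E_noises) auto
    then show "g n = T (lap n f)" "lap n h = T (g n)"
      unfolding g_def h_def using that by (simp_all add: lap_commute[OF MT])
    show "g n \<in> B" using that by (simp add: g_def)
  qed
  have g1: "norm1 (g n) \<le> a n" if "n \<in> set I" for n
    using norm1_contraction[OF ST, of "lap n f"] lap[OF that] g[OF that] that by simp
  have r2: "0 < 1 - r\<^sup>2" using r power_strict_mono[of r 1 2] by simp
  have g2: "(\<Sum>n\<in>set I. sqnorm2 (g n)) \<le> C"
  proof -
    \<comment> \<open>Subtracting the mean changes no \<open>lap n\<close> and brings in the
      variance hypothesis.\<close>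
    define f0 where "f0 = (\<lambda>x. f x - ev f)"
    have f0: "f0 \<in> B" by (simp add: f0_def)
    have "g n = lap n (T f0)" if n: "n \<in> set I" for n
      unfolding g_def f0_def lap_def using n
      by (simp add: markov_diff[OF MT] markov_const[OF MT] markov_diff[OF E_markov] markov_const[OF E_markov])
    then have "(1 - r\<^sup>2) * (\<Sum>n\<in>set I. sqnorm2 (g n)) = (1 - r\<^sup>2) * (\<Sum>n\<in>set I. sqnorm2 (lap n (T f0)))"
      by simp
    also have "\<dots> \<le> sqnorm2 f0 - sqnorm2 (T f0)"
      unfolding T_def by (intro energy f0 r distinct_I) auto
    also have "\<dots> \<le> 1" using var sqnorm2_nonneg[of "T f0"] f0 by (simp add: f0_def)
    finally show ?thesis using r2 by (simp add: C_def r_def[symmetric] field_simps)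
  qed
  have K: "0 < K" using \<kappa> by (simp add: K_def)
  have term_le: "sqnorm2 (T (g n)) \<le> 2 * \<kappa> * sqnorm2 (g n) + K\<^sup>2 / (4 * \<kappa>) * (\<delta> * a n)"
    if n: "n \<in> set R" for n
  proof -
    have nI: "n \<in> set I" using n R by auto
    let ?b = "sqnorm2 (g n)"
    have b: "0 \<le> ?b" using g nI by (simp add: sqnorm2_nonneg)
    define y where "y = sqnorm2 (noises (r ^ 2 ^ k) I (g n))"
    have y: "y\<^sup>2 \<le> (a n)\<^sup>2 * ?b"
    proof -
      have "y\<^sup>2 \<le> (norm1 (g n))\<^sup>2 * ?b"
        unfolding y_def using k r g nI by (intro sqnorm2_noises_le) (auto simp: r_def power_le_one)
      also have "\<dots> \<le> (a n)\<^sup>2 * ?b"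
        using g1[OF nI] norm1_nonneg[OF g(1)[OF nI]] b by (intro mult_right_mono power_mono) auto
      finally show ?thesis .
    qed
    have "y \<le> a n * sqrt ?b"
      using real_le_rsqrt[OF y] a_nonneg[OF nI] by (simp add: real_sqrt_mult)
    then have "K * y \<le> K * a n * sqrt ?b"
      using K by (simp add: mult.assoc)
    \<comment> \<open>The arithmetic-geometric mean inequality, weighted so that the energy costs
      \<kappa> once more. Of the two factors \<open>a n\<close> that appear, one is bounded by
      \<delta> and the other is summed over the coordinates.\<close>
    also have "\<dots> \<le> \<kappa> * ?b + K\<^sup>2 / (4 * \<kappa>) * (a n)\<^sup>2"
    proof -
      have "0 \<le> (2 * \<kappa> * sqrt ?b - K * a n)\<^sup>2" by simp
      then have "4 * \<kappa> * (K * a n * sqrt ?b) \<le> 4 * \<kappa>\<^sup>2 * ?b + K\<^sup>2 * (a n)\<^sup>2"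
        using b by (simp add: power2_diff power_mult_distrib algebra_simps)
      then show ?thesis using \<kappa> by (simp add: field_simps power2_eq_square)
    qed
    also have "(a n)\<^sup>2 \<le> \<delta> * a n"
      unfolding power2_eq_square using small[OF n] a_nonneg[OF nI] by (intro mult_right_mono)
    finally have "K * y \<le> \<kappa> * ?b + K\<^sup>2 / (4 * \<kappa>) * (\<delta> * a n)"
      using \<kappa> by (simp add: mult_left_mono divide_right_mono)
    moreover have "sqnorm2 (T (g n)) \<le> \<kappa> * ?b + K * y"
      using sqnorm2_noises_interpolation[OF subset_refl distinct_I g(1)[OF nI] r(1,2) \<kappa>, of k]
      by (simp add: T_def y_def K_def)
    ultimately show ?thesis by simp
  qed
  have "(norm1 (\<lambda>x. h x - foldr E R h x))\<^sup>2 \<le> sqnorm2 (\<lambda>x. h x - foldr E R h x)"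
    by (rule norm1_le_sqnorm2) simp
  also have "\<dots> \<le> (\<Sum>n\<in>set R. sqnorm2 (lap n h))"
    by (rule Efron_Stein[OF R h])
  also have "\<dots> \<le> (\<Sum>n\<in>set R. 2 * \<kappa> * sqnorm2 (g n) + K\<^sup>2 / (4 * \<kappa>) * (\<delta> * a n))"
    using term_le g(3) R by (intro sum_mono) (auto simp: subset_iff)
  also have "\<dots> = 2 * \<kappa> * (\<Sum>n\<in>set R. sqnorm2 (g n)) + K\<^sup>2 / (4 * \<kappa>) * (\<Sum>n\<in>set R. \<delta> * a n)"
    by (simp add: sum.distrib sum_distrib_left)
  also have "\<dots> \<le> 2 * \<kappa> * C + K\<^sup>2 / (4 * \<kappa>) * \<delta>"
  proof (intro add_mono mult_left_mono)
    have "(\<Sum>n\<in>set R. sqnorm2 (g n)) \<le> (\<Sum>n\<in>set I. sqnorm2 (g n))"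
      using R g by (intro sum_mono2) (auto intro: sqnorm2_nonneg)
    then show "(\<Sum>n\<in>set R. sqnorm2 (g n)) \<le> C" using g2 by simp
    have aR: "(\<Sum>n\<in>set R. a n) \<le> 1"
      using sum_mono2[OF _ R(1), of a] a_nonneg a by force
    show "(\<Sum>n\<in>set R. \<delta> * a n) \<le> \<delta>"
      using mult_left_mono[OF aR \<open>0 \<le> \<delta>\<close>] by (simp add: sum_distrib_left)
  qed (use \<kappa> in auto)
  finally have "norm1 (\<lambda>x. h x - foldr E R h x) \<le> sqrt (2 * \<kappa> * C + K\<^sup>2 * \<delta> / (4 * \<kappa>))"
    by (intro real_le_rsqrt) simp
  then show ?thesis
    using norm1_triangle3[of f h "foldr E R f"] norm1_triangle3[of h "foldr E R h" "foldr E R f"] fh Eh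
    by simp
qed

end

section \<open>Coordinate averaging on product spaces\<close>

lemma (in prob_space) integrable_bounded:
  fixes f :: "'a \<Rightarrow> real"
  assumes "f \<in> borel_measurable M" "\<And>x. x \<in> space M \<Longrightarrow> \<bar>f x\<bar> \<le> b"
  shows "integrable M f"
  using assms by (intro integrable_const_bound[of _ b]) (auto intro: AE_I2)

text \<open>All cells that contain a point have the same mass, so averaging over the cell of a point
  has the constant density m there.\<close>

locale cell_product = prob_space \<mu> for \<mu> :: "'a measure" +
  fixes cell :: "'a \<Rightarrow> nat" and m :: nat and J :: "'i list"
  assumes cell_measurable [measurable]: "cell \<in> measurable \<mu> (count_space UNIV)"
    and measure_cell: "s \<in> space \<mu> \<Longrightarrow> measure \<mu> {t \<in> space \<mu>. cell t = cell s} = 1 / m"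
    and m_pos: "0 < m"
    and distinct_J: "distinct J"
begin

abbreviation P :: "('i \<Rightarrow> 'a) measure" where
  "P \<equiv> Pi\<^sub>M (set J) (\<lambda>_. \<mu>)"

definition base :: "'i \<Rightarrow> 'a" where
  "base = (SOME x. x \<in> space P)"

definition collapse :: "('i \<Rightarrow> 'a) \<Rightarrow> 'i \<Rightarrow> 'a" where
  "collapse x = (if x \<in> space P then x else base)"

text \<open>Collapsing all points outside the product space to one point of it turns identities that
  hold on the product space into identities of functions.\<close>

definition B :: "(('i \<Rightarrow> 'a) \<Rightarrow> real) set" where
  "B = {f \<in> borel_measurable P. (\<exists>b. \<forall>x. \<bar>f x\<bar> \<le> b) \<and> (\<forall>x. f (collapse x) = f x)}"

lemma collapse_space [simp]: "collapse x \<in> space P"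
proof -
  have "space P \<noteq> {}"
    using not_empty by (auto simp: space_PiM PiE_eq_empty_iff)
  then show ?thesis by (auto simp: collapse_def base_def some_in_eq)
qed

lemma collapse_eq [simp]: "x \<in> space P \<Longrightarrow> collapse x = x"
  by (simp add: collapse_def)

lemma coord_space: "x \<in> space P \<Longrightarrow> n \<in> set J \<Longrightarrow> x n \<in> space \<mu>"
  by (auto simp: space_PiM)

lemma upd_space: "x \<in> space P \<Longrightarrow> n \<in> set J \<Longrightarrow> t \<in> space \<mu> \<Longrightarrow> x(n := t) \<in> space P"
  by (auto simp: space_PiM PiE_def extensional_def Pi_def)

lemma upd_measurable [measurable]:
  "n \<in> set J \<Longrightarrow> (\<lambda>(x, t). x(n := t)) \<in> measurable (P \<Otimes>\<^sub>M \<mu>) P"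
  \<comment> \<open>Adding a coordinate that is already present overwrites it.\<close>
  using measurable_add_dim[of n "set J" "\<lambda>_. \<mu>"] by (simp add: insert_absorb)

lemma upd_measurable': "n \<in> set J \<Longrightarrow> x \<in> space P \<Longrightarrow> (\<lambda>t. x(n := t)) \<in> measurable \<mu> P"
  using measurable_compose[OF measurable_Pair1' upd_measurable] by force

lemma BI:
  assumes "f \<in> borel_measurable P" "\<And>x. x \<in> space P \<Longrightarrow> \<bar>f x\<bar> \<le> b"
  shows "(\<lambda>x. f (collapse x)) \<in> B"
proof -
  have "(\<lambda>x. f (collapse x)) \<in> borel_measurable P \<longleftrightarrow> f \<in> borel_measurable P"
    by (intro measurable_cong) simp
  then show ?thesis using assms by (auto simp: B_def intro!: exI[of _ b])
qed

lemma B_measurable: "f \<in> B \<Longrightarrow> f \<in> borel_measurable P"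
  and B_bounded: "f \<in> B \<Longrightarrow> \<exists>b. \<forall>x. \<bar>f x\<bar> \<le> b"
  and B_collapse: "f \<in> B \<Longrightarrow> f (collapse x) = f x"
  by (auto simp: B_def)

sublocale function_algebra B
proof
  fix f g :: "('i \<Rightarrow> 'a) \<Rightarrow> real" and c :: real
  show "(\<lambda>_. c) \<in> B" by (auto simp: B_def)
  show "(\<lambda>x. \<bar>f x\<bar>) \<in> B" if "f \<in> B" using that by (auto simp: B_def)
  show "(\<lambda>x. inverse (f x)) \<in> B" if "f \<in> B" "0 < c" "\<And>x. c \<le> f x"
  proof -
    have "\<bar>inverse (f x)\<bar> \<le> inverse c" for x
      using that(2) that(3)[of x] by (simp add: le_imp_inverse_le)
    then show ?thesis using that(1) by (auto simp: B_def)
  qed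
  assume fg: "f \<in> B" "g \<in> B"
  then obtain a b where ab: "\<And>x. \<bar>f x\<bar> \<le> a" "\<And>x. \<bar>g x\<bar> \<le> b" by (auto simp: B_def)
  have "\<bar>f x + g x\<bar> \<le> a + b" for x using ab[of x] by linarith
  then show "(\<lambda>x. f x + g x) \<in> B" using fg by (auto simp: B_def)
  have "\<bar>f x * g x\<bar> \<le> a * b" for x
    unfolding abs_mult using ab[of x] by (intro mult_mono) auto
  then show "(\<lambda>x. f x * g x) \<in> B" using fg by (auto simp: B_def)
qed

section \<open>Averaging one coordinate against a symmetric kernel\<close>

definition kernel :: "('a \<Rightarrow> 'a \<Rightarrow> real) \<Rightarrow> bool" where
  "kernel k \<longleftrightarrow> case_prod k \<in> borel_measurable (\<mu> \<Otimes>\<^sub>M \<mu>) \<and> (\<exists>c. \<forall>s t. 0 \<le> k s t \<and> k s t \<le> c) \<and>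
     (\<forall>s t. k s t = k t s) \<and> (\<forall>s\<in>space \<mu>. (\<integral>t. k s t \<partial>\<mu>) = 1)"

lemma kernel_measurable: "kernel k \<Longrightarrow> case_prod k \<in> borel_measurable (\<mu> \<Otimes>\<^sub>M \<mu>)"
  and kernel_bounded: "kernel k \<Longrightarrow> \<exists>c. \<forall>s t. 0 \<le> k s t \<and> k s t \<le> c"
  and kernel_nonneg: "kernel k \<Longrightarrow> 0 \<le> k s t"
  and kernel_sym: "kernel k \<Longrightarrow> k s t = k t s"
  and kernel_integral: "kernel k \<Longrightarrow> s \<in> space \<mu> \<Longrightarrow> (\<integral>t. k s t \<partial>\<mu>) = 1"
  unfolding kernel_def by blast+

text \<open>Common form of \<open>E\<close> and \<open>G\<close>, with the kernel 1 and the cell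
  kernel, so that positivity and commutation need only one proof.\<close>

definition kern :: "('a \<Rightarrow> 'a \<Rightarrow> real) \<Rightarrow> 'i \<Rightarrow> (('i \<Rightarrow> 'a) \<Rightarrow> real) \<Rightarrow> ('i \<Rightarrow> 'a) \<Rightarrow> real" where
  "kern k n f x = (\<integral>t. k (collapse x n) t * f ((collapse x)(n := t)) \<partial>\<mu>)"

lemma kern_integrand_bounded:
  assumes "kernel k" "f \<in> B"
  obtains b where "\<And>s t x. \<bar>k s t * f x\<bar> \<le> b"
proof -
  obtain c where c: "\<And>s t. 0 \<le> k s t \<and> k s t \<le> c" using kernel_bounded[OF assms(1)] by blast
  obtain b where b: "\<And>x. \<bar>f x\<bar> \<le> b" using B_bounded[OF assms(2)] by blast
  have "\<bar>k s t * f x\<bar> \<le> c * b" for s t x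
    unfolding abs_mult using c[of s t] b[of x] by (intro mult_mono) auto
  then show thesis using that by blast
qed

lemma kern_integrand_measurable:
  assumes "kernel k" "f \<in> B" "n \<in> set J"
  shows "(\<lambda>(x, t). k (x n) t * f (x(n := t))) \<in> borel_measurable (P \<Otimes>\<^sub>M \<mu>)"
proof -
  note [measurable] = B_measurable[OF assms(2)] kernel_measurable[OF assms(1)] upd_measurable[OF assms(3)]
  have [measurable]: "(\<lambda>x. x n) \<in> measurable P \<mu>" using assms(3) by measurable
  have "(\<lambda>p. case_prod k (fst p n, snd p) * f ((\<lambda>(x, t). x(n := t)) p)) \<in> borel_measurable (P \<Otimes>\<^sub>M \<mu>)"
    by measurable
  then show ?thesis by (simp add: case_prod_beta')
qed

lemma kern_integrable:
  assumes k: "kernel k" and f: "f \<in> B" and n: "n \<in> set J"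
  shows "integrable \<mu> (\<lambda>t. k (collapse x n) t * f ((collapse x)(n := t)))"
proof -
  obtain b where b: "\<And>s t x. \<bar>k s t * f x\<bar> \<le> b" using kern_integrand_bounded[OF k f] by blast
  have "(\<lambda>t. k (collapse x n) t * f ((collapse x)(n := t))) \<in> borel_measurable \<mu>"
    using measurable_compose[OF measurable_Pair1'[OF collapse_space] kern_integrand_measurable[OF assms]]
    by simp
  then show ?thesis by (rule integrable_bounded[OF _ b])
qed

lemma kern_mem:
  assumes k: "kernel k" and f: "f \<in> B" and n: "n \<in> set J"
  shows "kern k n f \<in> B"
proof -
  obtain b where b: "\<And>s t x. \<bar>k s t * f x\<bar> \<le> b" using kern_integrand_bounded[OF k f] by blast
  have "(\<lambda>x. (\<lambda>x. \<integral>t. k (x n) t * f (x(n := t)) \<partial>\<mu>) (collapse x)) \<in> B"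
  proof (rule BI)
    show "(\<lambda>x. \<integral>t. k (x n) t * f (x(n := t)) \<partial>\<mu>) \<in> borel_measurable P"
      by (rule borel_measurable_lebesgue_integral[OF kern_integrand_measurable[OF assms]])
    fix x assume x: "x \<in> space P"
    have "\<bar>\<integral>t. k (x n) t * f (x(n := t)) \<partial>\<mu>\<bar> \<le> (\<integral>t. \<bar>k (x n) t * f (x(n := t))\<bar> \<partial>\<mu>)"
      by (rule integral_abs_bound)
    also have "\<dots> \<le> (\<integral>t. b \<partial>\<mu>)"
      using kern_integrable[OF assms, of x] x b by (intro integral_mono) auto
    finally show "\<bar>\<integral>t. k (x n) t * f (x(n := t)) \<partial>\<mu>\<bar> \<le> b" by (simp add: prob_space)
  qed
  then show ?thesis by (simp add: kern_def[abs_def])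
qed

lemma kern_markov:
  assumes k: "kernel k" and n: "n \<in> set J"
  shows "markov (kern k n)"
  unfolding markov_def
proof (intro conjI ballI allI impI)
  fix f g c x assume f: "f \<in> B"
  show "kern k n f \<in> B" by (rule kern_mem[OF k f n])
  show "kern k n (\<lambda>x. c * f x) = (\<lambda>x. c * kern k n f x)"
    using kern_integrable[OF k f n] by (auto simp: kern_def mult.left_commute)
  show "kern k n (\<lambda>x. f x + g x) = (\<lambda>x. kern k n f x + kern k n g x)" if g: "g \<in> B"
    using kern_integrable[OF k f n] kern_integrable[OF k g n]
    by (auto simp: kern_def distrib_left)
  show "0 \<le> kern k n f x" if "\<forall>x. 0 \<le> f x"
    using that kernel_nonneg[OF k] unfolding kern_def by (intro integral_nonneg_AE) auto
next
  show "kern k n (\<lambda>_. 1) = (\<lambda>_. 1)"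
    using kernel_integral[OF k coord_space[OF collapse_space n]] by (auto simp: kern_def)
qed

text \<open>Updates of different coordinates do not interfere, so this is Fubini for one bounded
  integrand in the two new values.\<close>

lemma kern_commuting:
  assumes k: "kernel k" and l: "kernel l" and ij: "i \<in> set J" "j \<in> set J" "i \<noteq> j"
  shows "commuting (kern k i) (kern l j)"
  unfolding commuting_def
proof (intro ballI ext)
  fix f x assume f: "f \<in> B"
  interpret pair_prob_space \<mu> \<mu> ..
  define y where "y = collapse x"
  have y: "y \<in> space P" by (simp add: y_def)
  obtain b where b: "\<And>s t x. \<bar>l s t * f x\<bar> \<le> b" using kern_integrand_bounded[OF l f] by blast
  obtain c where c: "\<And>s t. 0 \<le> k s t \<and> k s t \<le> c" using kernel_bounded[OF k] by blast
  define F where "F s t = k (y i) s * (l (y j) t * f (y(i := s, j := t)))" for s t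
  note [measurable] = B_measurable[OF f] kernel_measurable[OF k] kernel_measurable[OF l]
    upd_measurable'[OF ij(1) y] upd_measurable[OF ij(2)]
  have [simp]: "y i \<in> space \<mu>" "y j \<in> space \<mu>" using y ij by (auto intro: coord_space)
  have "(\<lambda>p. case_prod k (y i, fst p) * (case_prod l (y j, snd p)
      * f ((\<lambda>(x, t). x(j := t)) (y(i := fst p), snd p)))) \<in> borel_measurable (\<mu> \<Otimes>\<^sub>M \<mu>)"
    by measurable
  then have Fm: "case_prod F \<in> borel_measurable (\<mu> \<Otimes>\<^sub>M \<mu>)"
    by (simp add: F_def case_prod_beta')
  have "\<bar>F s t\<bar> \<le> c * b" for s t
    unfolding F_def abs_mult[of "k _ _"] using c[of "y i" s] b by (intro mult_mono) auto
  then have "integrable (\<mu> \<Otimes>\<^sub>M \<mu>) (case_prod F)"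
    by (intro P.integrable_bounded[OF Fm, of "c * b"]) auto
  then have "(\<integral>t. (\<integral>s. F s t \<partial>\<mu>) \<partial>\<mu>) = (\<integral>s. (\<integral>t. F s t \<partial>\<mu>) \<partial>\<mu>)"
    by (rule Fubini_integral)
  moreover have "kern k i (kern l j f) x = (\<integral>s. (\<integral>t. F s t \<partial>\<mu>) \<partial>\<mu>)"
    unfolding kern_def y_def[symmetric]
    by (intro Bochner_Integration.integral_cong refl)
      (use ij y in \<open>simp add: upd_space F_def\<close>)
  moreover have "kern l j (kern k i f) x = (\<integral>t. (\<integral>s. F s t \<partial>\<mu>) \<partial>\<mu>)"
    unfolding kern_def y_def[symmetric]
  proof (intro Bochner_Integration.integral_cong refl)
    fix t assume "t \<in> space \<mu>"
    then show "l (y j) t * (\<integral>s. k (collapse (y(j := t)) i) s * f ((collapse (y(j := t)))(i := s)) \<partial>\<mu>) = (\<integral>s. F s t \<partial>\<mu>)"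
      using ij y by (simp add: upd_space F_def fun_upd_twist[OF ij(3)] mult.left_commute[of "k _ _"])
  qed
  ultimately show "kern k i (kern l j f) x = kern l j (kern k i f) x" by simp
qed

definition E :: "'i \<Rightarrow> (('i \<Rightarrow> 'a) \<Rightarrow> real) \<Rightarrow> ('i \<Rightarrow> 'a) \<Rightarrow> real" where
  "E = kern (\<lambda>_ _. 1)"

definition cell_kernel :: "'a \<Rightarrow> 'a \<Rightarrow> real" where
  "cell_kernel s t = (if cell s = cell t then real m else 0)"

definition G :: "'i \<Rightarrow> (('i \<Rightarrow> 'a) \<Rightarrow> real) \<Rightarrow> ('i \<Rightarrow> 'a) \<Rightarrow> real" where
  "G = kern cell_kernel"

lemma kernel_one: "kernel (\<lambda>_ _. 1)"
  by (auto simp: kernel_def prob_space)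

lemma kernel_cell: "kernel cell_kernel"
  unfolding kernel_def
proof (intro conjI ballI allI exI)
  show "case_prod cell_kernel \<in> borel_measurable (\<mu> \<Otimes>\<^sub>M \<mu>)"
  proof -
    have c: "(\<lambda>p. cell (fst p)) \<in> measurable (\<mu> \<Otimes>\<^sub>M \<mu>) (count_space UNIV)"
      "(\<lambda>p. cell (snd p)) \<in> measurable (\<mu> \<Otimes>\<^sub>M \<mu>) (count_space UNIV)"
      by (auto intro: measurable_compose[OF _ cell_measurable])
    have "(\<lambda>p. (\<lambda>i p. if i = cell (snd p) then real m else 0) (cell (fst p)) p)
        \<in> borel_measurable (\<mu> \<Otimes>\<^sub>M \<mu>)"
    proof (rule measurable_compose_countable[OF _ c(1)])
      show "(\<lambda>p. if i = cell (snd p) then real m else 0) \<in> borel_measurable (\<mu> \<Otimes>\<^sub>M \<mu>)" for i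
        by (rule measurable_compose[OF c(2), of "\<lambda>j. if i = j then real m else 0"]) simp
    qed
    then show ?thesis by (simp add: cell_kernel_def case_prod_beta')
  qed
  fix s t
  show "0 \<le> cell_kernel s t" "cell_kernel s t \<le> m" "cell_kernel s t = cell_kernel t s"
    by (auto simp: cell_kernel_def)
  assume s: "s \<in> space \<mu>"
  have "(\<integral>t. cell_kernel s t \<partial>\<mu>) = (\<integral>t. real m * indicator {t \<in> space \<mu>. cell t = cell s} t \<partial>\<mu>)"
    by (intro Bochner_Integration.integral_cong) (auto simp: cell_kernel_def)
  also have "\<dots> = real m * measure \<mu> {t \<in> space \<mu>. cell t = cell s}"
    by simp
  finally show "(\<integral>t. cell_kernel s t \<partial>\<mu>) = 1"
    using measure_cell[OF s] m_pos by simp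
qed

lemma E_eq: "x \<in> space P \<Longrightarrow> E n f x = (\<integral>t. f (x(n := t)) \<partial>\<mu>)"
  by (simp add: E_def kern_def)

lemma G_eq: "x \<in> space P \<Longrightarrow> G n f x = (\<integral>t. cell_kernel (x n) t * f (x(n := t)) \<partial>\<mu>)"
  by (simp add: G_def kern_def)

lemma slice_integrable:
  assumes "f \<in> B" "n \<in> set J" "x \<in> space P"
  shows "integrable \<mu> (\<lambda>t. f (x(n := t)))" "integrable \<mu> (\<lambda>t. cell_kernel (x n) t * f (x(n := t)))"
  using kern_integrable[OF kernel_one assms(1,2), of x] kern_integrable[OF kernel_cell assms(1,2), of x]
    assms(3) by simp_all

lemma eq_on_spaceI: "f \<in> B \<Longrightarrow> g \<in> B \<Longrightarrow> (\<And>x. x \<in> space P \<Longrightarrow> f x = g x) \<Longrightarrow> f = g"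
  by (metis B_collapse collapse_space ext)

lemma E_upd: "x \<in> space P \<Longrightarrow> n \<in> set J \<Longrightarrow> t \<in> space \<mu> \<Longrightarrow> E n f (x(n := t)) = E n f x"
  by (simp add: E_eq upd_space)

lemma G_upd:
  "x \<in> space P \<Longrightarrow> n \<in> set J \<Longrightarrow> t \<in> space \<mu> \<Longrightarrow> cell t = cell (x n) \<Longrightarrow> G n f (x(n := t)) = G n f x"
  by (simp add: G_eq upd_space cell_kernel_def)

lemma E_cond_exp_op: assumes n: "n \<in> set J" shows "cond_exp_op (E n)"
  unfolding cond_exp_op_def
proof (intro conjI ballI)
  show M: "markov (E n)" unfolding E_def by (rule kern_markov[OF kernel_one n])
  fix f g assume [simp]: "f \<in> B" "g \<in> B"
  show "E n (\<lambda>x. E n f x * g x) = (\<lambda>x. E n f x * E n g x)"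
  proof (rule eq_on_spaceI)
    fix x assume x: "x \<in> space P"
    have "E n (\<lambda>x. E n f x * g x) x = (\<integral>t. E n f x * g (x(n := t)) \<partial>\<mu>)"
      unfolding E_eq[OF x, where f = "\<lambda>x. E n f x * g x"]
      by (intro Bochner_Integration.integral_cong) (simp_all add: E_upd n x)
    also have "\<dots> = E n f x * E n g x" by (simp add: E_eq[OF x, of n g])
    finally show "E n (\<lambda>x. E n f x * g x) x = E n f x * E n g x" .
  qed (auto intro!: mem markov_mem[OF M])
qed

lemma G_cond_exp_op: assumes n: "n \<in> set J" shows "cond_exp_op (G n)"
  unfolding cond_exp_op_def
proof (intro conjI ballI)
  show M: "markov (G n)" unfolding G_def by (rule kern_markov[OF kernel_cell n])
  fix f g assume [simp]: "f \<in> B" "g \<in> B"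
  show "G n (\<lambda>x. G n f x * g x) = (\<lambda>x. G n f x * G n g x)"
  proof (rule eq_on_spaceI)
    fix x assume x: "x \<in> space P"
    have "G n (\<lambda>x. G n f x * g x) x = (\<integral>t. G n f x * (cell_kernel (x n) t * g (x(n := t))) \<partial>\<mu>)"
      unfolding G_eq[OF x, where f = "\<lambda>x. G n f x * g x"]
    proof (intro Bochner_Integration.integral_cong refl)
      fix t assume "t \<in> space \<mu>"
      then show "cell_kernel (x n) t * (G n f (x(n := t)) * g (x(n := t))) =
          G n f x * (cell_kernel (x n) t * g (x(n := t)))"
        by (cases "cell t = cell (x n)") (auto simp: G_upd n x cell_kernel_def)
    qed
    also have "\<dots> = G n f x * G n g x" by (simp add: G_eq[OF x, of n g])
    finally show "G n (\<lambda>x. G n f x * g x) x = G n f x * G n g x" .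
  qed (auto intro!: mem markov_mem[OF M])
qed

lemma E_markov': "n \<in> set J \<Longrightarrow> markov (E n)" and G_markov': "n \<in> set J \<Longrightarrow> markov (G n)"
  using E_cond_exp_op G_cond_exp_op by (auto intro: cond_exp_op_markov)

text \<open>A function that does not vary with the n-th coordinate is its own cell average. In the
  other order Fubini integrates the kernel over its first argument, and by symmetry the result is
  1.\<close>

lemma E_G_absorb:
  assumes n: "n \<in> set J" and f: "f \<in> B"
  shows "E n (G n f) = E n f" "G n (E n f) = E n f"
proof -
  note B = markov_mem[OF E_markov'[OF n]] markov_mem[OF G_markov'[OF n]] f
  interpret pair_prob_space \<mu> \<mu> ..
  show "G n (E n f) = E n f"
  proof (rule eq_on_spaceI)
    fix x assume x: "x \<in> space P"
    have "G n (E n f) x = (\<integral>t. cell_kernel (x n) t * E n f x \<partial>\<mu>)"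
      unfolding G_eq[OF x] by (intro Bochner_Integration.integral_cong) (simp_all add: E_upd n x)
    also have "\<dots> = E n f x"
      using kernel_integral[OF kernel_cell coord_space[OF x n]] by simp
    finally show "G n (E n f) x = E n f x" .
  qed (simp_all add: B)
  show "E n (G n f) = E n f"
  proof (rule eq_on_spaceI)
    fix x assume x: "x \<in> space P"
    obtain b where b: "\<And>s t x. \<bar>cell_kernel s t * f x\<bar> \<le> b"
      using kern_integrand_bounded[OF kernel_cell f] by blast
    define F where "F s t = cell_kernel s t * f (x(n := t))" for s t
    note [measurable] = B_measurable[OF f] kernel_measurable[OF kernel_cell] upd_measurable'[OF n x]
    have "(\<lambda>p. case_prod cell_kernel p * f (x(n := snd p))) \<in> borel_measurable (\<mu> \<Otimes>\<^sub>M \<mu>)"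
      by measurable
    then have Fm: "case_prod F \<in> borel_measurable (\<mu> \<Otimes>\<^sub>M \<mu>)"
      by (simp add: F_def case_prod_beta')
    have "integrable (\<mu> \<Otimes>\<^sub>M \<mu>) (case_prod F)"
      by (intro P.integrable_bounded[OF Fm, of b]) (auto simp: F_def b)
    then have "(\<integral>t. (\<integral>s. F s t \<partial>\<mu>) \<partial>\<mu>) = (\<integral>s. (\<integral>t. F s t \<partial>\<mu>) \<partial>\<mu>)"
      by (rule Fubini_integral)
    moreover have "E n (G n f) x = (\<integral>s. (\<integral>t. F s t \<partial>\<mu>) \<partial>\<mu>)"
      unfolding E_eq[OF x] F_def
      by (intro Bochner_Integration.integral_cong refl) (simp add: G_eq upd_space x n)
    moreover have "(\<integral>t. (\<integral>s. F s t \<partial>\<mu>) \<partial>\<mu>) = E n f x"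
      unfolding E_eq[OF x] F_def
      using kernel_integral[OF kernel_cell]
      by (intro Bochner_Integration.integral_cong refl) (simp add: kernel_sym[OF kernel_cell, where t = "_ :: 'a"])
    ultimately show "E n (G n f) x = E n f x" by simp
  qed (simp_all add: B)
qed

text \<open>Jensen, and then the cell kernel is at most m. Hypercontractivity sees the number of
  cells only through this bound.\<close>

lemma G_square_le:
  assumes n: "n \<in> set J" and f: "f \<in> B"
  shows "(G n f x)\<^sup>2 \<le> m * E n (\<lambda>x. (f x)\<^sup>2) x"
proof -
  define y where "y = collapse x"
  have y: "y \<in> space P" by (simp add: y_def)
  have f2: "(\<lambda>x. (f x)\<^sup>2) \<in> B" using f by (rule power_mem)
  have "(G n f y)\<^sup>2 \<le> G n (\<lambda>x. (f x)\<^sup>2) y"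
    by (rule markov_Jensen_square[OF G_markov'[OF n] f])
  also have "\<dots> \<le> (\<integral>t. m * (f (y(n := t)))\<^sup>2 \<partial>\<mu>)"
    unfolding G_eq[OF y] using slice_integrable[OF f2 n y]
    by (intro integral_mono) (auto simp: cell_kernel_def)
  also have "\<dots> = m * E n (\<lambda>x. (f x)\<^sup>2) y" by (simp add: E_eq[OF y])
  finally show ?thesis
    using B_collapse[OF markov_mem[OF G_markov'[OF n] f]] B_collapse[OF markov_mem[OF E_markov'[OF n] f2]]
    by (simp add: y_def)
qed

text \<open>Links the operator calculus to the integral in \<open>expect_onto\<close>. The induction
  is over all f, because commutation is used to let \<open>E n\<close> act before the averages over
  the remaining list.\<close>

lemma foldr_E_eq:
  assumes "set L \<subseteq> set J" "distinct L" "f \<in> B" "x \<in> space P"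
  shows "foldr E L f x = (\<integral>y. f (\<lambda>i. if i \<in> set L then y i else x i) \<partial>Pi\<^sub>M (set L) (\<lambda>_. \<mu>))"
  using assms
proof (induction L arbitrary: f)
  case Nil
  interpret product_prob_space "\<lambda>_ :: 'i. \<mu>" "{} :: 'i set" ..
  show ?case by (simp add: P.prob_space)
next
  case (Cons n L)
  have n: "n \<in> set J" "n \<notin> set L" and L: "set L \<subseteq> set J" "distinct L" using Cons.prems by auto
  have P': "prob_space (Pi\<^sub>M (set (n # L)) (\<lambda>_. \<mu>))" by (rule prob_space_PiM) (rule prob_space_axioms)
  interpret product_sigma_finite "\<lambda>_ :: 'i. \<mu>" ..
  define w where "w L y i = (if i \<in> set L then y i else x i)" for L :: "'i list" and y i
  have w_space: "w L y \<in> space P" if "y \<in> space (Pi\<^sub>M (set L) (\<lambda>_. \<mu>))" "set L \<subseteq> set J" for L y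
    using that Cons.prems by (fastforce simp: w_def space_PiM PiE_def Pi_def extensional_def)
  have "w (n # L) \<in> measurable (Pi\<^sub>M (set (n # L)) (\<lambda>_. \<mu>)) P"
  proof (rule measurable_PiM_single')
    fix i assume "i \<in> set J"
    then show "(\<lambda>y. w (n # L) y i) \<in> measurable (Pi\<^sub>M (set (n # L)) (\<lambda>_. \<mu>)) \<mu>"
      using Cons.prems unfolding w_def
      by (cases "i \<in> set (n # L)") (auto intro!: measurable_const coord_space)
  next
    show "w (n # L) \<in> space (Pi\<^sub>M (set (n # L)) (\<lambda>_. \<mu>)) \<rightarrow> (\<Pi>\<^sub>E i\<in>set J. space \<mu>)"
      using w_space[of _ "n # L"] Cons.prems by (auto simp: space_PiM)
  qed
  then have gm: "(\<lambda>y. f (w (n # L) y)) \<in> borel_measurable (Pi\<^sub>M (set (n # L)) (\<lambda>_. \<mu>))"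
    using B_measurable[OF Cons.prems(3)] by (rule measurable_compose)
  obtain b where "\<And>x. \<bar>f x\<bar> \<le> b" using B_bounded[OF Cons.prems(3)] by blast
  then have "integrable (Pi\<^sub>M (set (n # L)) (\<lambda>_. \<mu>)) (\<lambda>y. f (w (n # L) y))"
    using prob_space.integrable_bounded[OF P' gm, of b] by simp
  then have "(\<integral>y. f (w (n # L) y) \<partial>Pi\<^sub>M (set (n # L)) (\<lambda>_. \<mu>)) =
      (\<integral>y. (\<integral>t. f (w (n # L) (y(n := t))) \<partial>\<mu>) \<partial>Pi\<^sub>M (set L) (\<lambda>_. \<mu>))"
    using product_integral_insert[of "set L" n "\<lambda>y. f (w (n # L) y)"] n by simp
  also have "\<dots> = (\<integral>y. E n f (w L y) \<partial>Pi\<^sub>M (set L) (\<lambda>_. \<mu>))"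
  proof (intro Bochner_Integration.integral_cong refl)
    fix y assume "y \<in> space (Pi\<^sub>M (set L) (\<lambda>_. \<mu>))"
    moreover have "w (n # L) (y(n := t)) = (w L y)(n := t)" for t
      using n by (auto simp: w_def)
    ultimately show "(\<integral>t. f (w (n # L) (y(n := t))) \<partial>\<mu>) = E n f (w L y)"
      using w_space[OF _ L(1)] by (simp add: E_eq)
  qed
  also have "\<dots> = foldr E L (E n f) x"
    using Cons.IH[OF L markov_mem[OF E_markov'[OF n(1)] Cons.prems(3)] Cons.prems(4)]
    by (simp add: w_def[abs_def])
  also have "\<dots> = foldr E (n # L) f x"
  proof -
    have "commuting (E n) (foldr E L)"
      using n L by (intro commuting_foldr E_markov')
        (auto simp: E_def intro!: kern_commuting kernel_one)
    then show ?thesis using Cons.prems(3) by (simp add: commutingD)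
  qed
  finally show ?case by (simp add: w_def[abs_def])
qed

lemma foldr_E_all:
  assumes f: "f \<in> B"
  shows "foldr E J f x = (\<integral>y. f y \<partial>P)"
proof -
  have M: "markov (foldr E J)" by (intro markov_foldr E_markov') auto
  have "foldr E J f x = foldr E J f (collapse x)"
    using B_collapse[OF markov_mem[OF M f]] by simp
  also have "\<dots> = (\<integral>y. f (\<lambda>i. if i \<in> set J then y i else collapse x i) \<partial>P)"
    by (rule foldr_E_eq[OF subset_refl distinct_J f collapse_space])
  also have "\<dots> = (\<integral>y. f y \<partial>P)"
  proof (intro Bochner_Integration.integral_cong refl)
    fix y assume "y \<in> space P"
    then have "(\<lambda>i. if i \<in> set J then y i else collapse x i) = y"
      using collapse_space[of x] by (auto simp: space_PiM PiE_def extensional_def fun_eq_iff)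
    then show "f (\<lambda>i. if i \<in> set J then y i else collapse x i) = f y" by simp
  qed
  finally show ?thesis .
qed

sublocale coordinate_operators B J E G "real m"
proof
  show "commuting (E i) (E j)" "commuting (G i) (G j)" "commuting (E i) (G j)"
    if "i \<in> set J" "j \<in> set J" "i \<noteq> j" for i j
    unfolding E_def G_def using that by (auto intro: kern_commuting kernel_one kernel_cell)
qed (auto simp: distinct_J E_cond_exp_op G_cond_exp_op E_G_absorb G_square_le)

lemma ev_integral: "f \<in> B \<Longrightarrow> ev f = (\<integral>x. f x \<partial>P)"
  by (simp add: ev_def foldr_E_all)

end

section \<open>Choice of the parameters\<close>

lemma junta_parameters:
  fixes \<epsilon> :: real
  assumes "0 < \<epsilon>"
  obtains m k :: nat and \<kappa> \<delta> :: real where "2 \<le> m" "0 < \<kappa>" "0 < \<delta>"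
    "((1 - 1 / m) ^ (2 ^ k))\<^sup>2 * m \<le> 1 / 4"
    "8 * (1 / m) + sqrt (2 * \<kappa> * (1 / (1 - (1 - 1 / m)\<^sup>2)) + (1 / \<kappa> ^ (2 ^ k - 1))\<^sup>2 * \<delta> / (4 * \<kappa>)) < \<epsilon>"
proof -
  \<comment> \<open>More than 16 / \<epsilon> cells bring 8 / m below \<epsilon> / 2, and the
    summand 2 guarantees m \<ge> 2.\<close>
  define m where "m = nat \<lceil>16 / \<epsilon>\<rceil> + 2"
  have m: "2 \<le> m" "16 / \<epsilon> < m" by (auto simp: m_def) linarith
  define r where "r = 1 - 1 / real m"
  have r: "0 \<le> r" "r < 1" using m by (auto simp: r_def)
  have r2: "0 < 1 - r\<^sup>2" using power_strict_mono[OF r(2) r(1), of 2] by simp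
  define C where "C = 1 / (1 - r\<^sup>2)"
  have C: "0 < C" using r2 by (simp add: C_def)
  have "(\<lambda>j. r ^ j) \<longlonglongrightarrow> 0" using r by (intro LIMSEQ_realpow_zero)
  then have "(\<lambda>j. (r ^ j)\<^sup>2 * m) \<longlonglongrightarrow> (0 :: real)\<^sup>2 * real m"
    by (rule tendsto_mult[OF tendsto_power tendsto_const])
  then have "eventually (\<lambda>j. (r ^ j)\<^sup>2 * m < 1 / 4) sequentially"
    by (rule order_tendstoD) simp
  then obtain k where k: "\<And>j. k \<le> j \<Longrightarrow> (r ^ j)\<^sup>2 * m < 1 / 4"
    unfolding eventually_sequentially by blast
  \<comment> \<open>Every sufficiently large exponent works, and 2 ^ k exceeds k.\<close>
  have k': "(r ^ (2 ^ k))\<^sup>2 * m \<le> 1 / 4"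
    using k[of "2 ^ k"] less_exp[of k] by (simp add: less_imp_le)
  \<comment> \<open>\<kappa> and \<delta> make both summands under the root \<epsilon>^2 / 32, so
    the root is \<epsilon> / 4. The choices are made in order: C depends on m, \<kappa> on C, K on
    \<kappa> and k, and \<delta> on \<kappa> and K.\<close>
  define \<kappa> where "\<kappa> = \<epsilon>\<^sup>2 / (64 * C)"
  have \<kappa>: "0 < \<kappa>" using C assms by (simp add: \<kappa>_def)
  define K where "K = 1 / \<kappa> ^ (2 ^ k - 1)"
  have K: "0 < K" using \<kappa> by (simp add: K_def)
  define \<delta> where "\<delta> = \<epsilon>\<^sup>2 * \<kappa> / (8 * K\<^sup>2)"
  have \<delta>: "0 < \<delta>" using K \<kappa> assms by (simp add: \<delta>_def)
  have "2 * \<kappa> * C + K\<^sup>2 * \<delta> / (4 * \<kappa>) = \<epsilon>\<^sup>2 / 32 + \<epsilon>\<^sup>2 / 32"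
    using C K \<kappa> by (simp add: \<delta>_def) (simp add: \<kappa>_def)
  also have "\<dots> = (\<epsilon> / 4)\<^sup>2" by (simp add: power_divide)
  finally have "sqrt (2 * \<kappa> * C + K\<^sup>2 * \<delta> / (4 * \<kappa>)) = \<epsilon> / 4"
    using assms by simp
  moreover have "8 * (1 / real m) < \<epsilon> / 2" using m assms by (simp add: field_simps)
  ultimately have "8 * (1 / real m) + sqrt (2 * \<kappa> * C + K\<^sup>2 * \<delta> / (4 * \<kappa>)) < \<epsilon>"
    using assms by linarith
  then show thesis
    using that[of m \<kappa> \<delta> k] m \<kappa> \<delta> k' unfolding C_def K_def r_def by blast
qed

section \<open>From bounds on oscillations to approximation on product spaces\<close>

context cell_product
begin

lemma prob_space_P: "prob_space P"
  by (rule prob_space_PiM) (rule prob_space_axioms)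

text \<open>\<open>d n\<close> plays the role of the size of the n-th derivative, which enters
  through two oscillation bounds: along the whole line, to compare F with \<open>E n\<close>, and
  within a cell, to compare it with \<open>G n\<close>.\<close>

lemma real_junta_approximation:
  fixes F :: "('i \<Rightarrow> 'a) \<Rightarrow> real" and d :: "'i \<Rightarrow> ('i \<Rightarrow> 'a) \<Rightarrow> real"
  assumes F: "F \<in> borel_measurable P" "\<And>x. x \<in> space P \<Longrightarrow> \<bar>F x\<bar> \<le> b"
    and d: "\<And>n. n \<in> set J \<Longrightarrow> d n \<in> borel_measurable P"
      "\<And>n x. n \<in> set J \<Longrightarrow> x \<in> space P \<Longrightarrow> \<bar>d n x\<bar> \<le> b' n"
    and osc: "\<And>n x s t. n \<in> set J \<Longrightarrow> x \<in> space P \<Longrightarrow> s \<in> space \<mu> \<Longrightarrow> t \<in> space \<mu> \<Longrightarrow>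
      \<bar>F (x(n := s)) - F (x(n := t))\<bar> \<le> (\<integral>u. d n (x(n := u)) \<partial>\<mu>)"
    and osc_cell: "\<And>n x s t. n \<in> set J \<Longrightarrow> x \<in> space P \<Longrightarrow> s \<in> space \<mu> \<Longrightarrow> t \<in> space \<mu> \<Longrightarrow>
      cell s = cell t \<Longrightarrow>
      \<bar>F (x(n := s)) - F (x(n := t))\<bar> \<le> (\<integral>u. of_bool (cell s = cell u) * d n (x(n := u)) \<partial>\<mu>)"
    and total: "(\<Sum>n\<in>set J. \<integral>x. d n x \<partial>P) \<le> 1"
    and var: "(\<integral>x. (F x - (\<integral>y. F y \<partial>P))\<^sup>2 \<partial>P) \<le> 1"
    and R: "R \<subseteq> set J" and small: "\<And>n. n \<in> R \<Longrightarrow> (\<integral>x. d n x \<partial>P) \<le> \<delta>"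
    and par: "2 \<le> m" "0 < \<kappa>" "0 \<le> \<delta>" "((1 - 1 / m) ^ (2 ^ k))\<^sup>2 * m \<le> 1 / 4"
  shows "(\<integral>x. \<bar>F x - (\<integral>y. F (\<lambda>i. if i \<in> R then y i else x i) \<partial>Pi\<^sub>M R (\<lambda>_. \<mu>))\<bar> \<partial>P)
    \<le> 8 * (1 / m) + sqrt (2 * \<kappa> * (1 / (1 - (1 - 1 / m)\<^sup>2)) + (1 / \<kappa> ^ (2 ^ k - 1))\<^sup>2 * \<delta> / (4 * \<kappa>))"
proof -
  define f where "f = (\<lambda>x. F (collapse x))"
  define D where "D n = (\<lambda>x. d n (collapse x))" for n
  have f: "f \<in> B" unfolding f_def by (rule BI[OF F])
  have D: "D n \<in> B" if "n \<in> set J" for n unfolding D_def by (rule BI[OF d[OF that]])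
  have fF: "f x = F x" if "x \<in> space P" for x using that by (simp add: f_def)
  have Dd: "D n x = d n x" if "x \<in> space P" for n x using that by (simp add: D_def)
  have evD: "ev (D n) = (\<integral>x. d n x \<partial>P)" if "n \<in> set J" for n
    unfolding ev_integral[OF D[OF that]] by (intro Bochner_Integration.integral_cong) (simp_all add: Dd)
  have evf: "ev f = (\<integral>x. F x \<partial>P)"
    unfolding ev_integral[OF f] by (intro Bochner_Integration.integral_cong) (simp_all add: fF)
  \<comment> \<open>The difference is the kernel average of f x - f (x(n := t)), so a bound on the
    increments that the kernel sees is enough.\<close>
  have ptw: "\<bar>f x - kern k n f x\<bar> \<le> c"
    if k: "kernel k" and n: "n \<in> set J" and x: "x \<in> space P"
      and bd: "\<And>t. t \<in> space \<mu> \<Longrightarrow> k (x n) t * \<bar>f x - f (x(n := t))\<bar> \<le> k (x n) t * c"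
    for k n x c
  proof -
    have xn: "x n \<in> space \<mu>" using x n by (rule coord_space)
    note int = kern_integrable[OF k f n, of x] kern_integrable[OF k const_mem n, of x, simplified]
    have intd: "integrable \<mu> (\<lambda>t. k (x n) t * (f x - f (x(n := t))))"
      using int x kern_integrable[OF k const_mem[of "f x"] n, of x] by (simp add: right_diff_distrib)
    have "f x - kern k n f x = (\<integral>t. k (x n) t * (f x - f (x(n := t))) \<partial>\<mu>)"
      using int(1) kern_integrable[OF k const_mem[of "f x"] n, of x] x kernel_integral[OF k xn]
      by (simp add: kern_def right_diff_distrib)
    also have "\<bar>\<dots>\<bar> \<le> (\<integral>t. \<bar>k (x n) t * (f x - f (x(n := t)))\<bar> \<partial>\<mu>)" by (rule integral_abs_bound)
    also have "\<dots> \<le> (\<integral>t. k (x n) t * c \<partial>\<mu>)"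
    proof (rule integral_mono)
      show "integrable \<mu> (\<lambda>t. \<bar>k (x n) t * (f x - f (x(n := t)))\<bar>)" using intd by (rule integrable_abs)
      show "integrable \<mu> (\<lambda>t. k (x n) t * c)"
        using kern_integrable[OF k const_mem[of c] n, of x] x by simp
    qed (use bd kernel_nonneg[OF k] in \<open>simp add: abs_mult\<close>)
    also have "\<dots> = c" using kernel_integral[OF k xn] by simp
    finally show ?thesis .
  qed
  have lap_le: "\<bar>lap n f x\<bar> \<le> E n (D n) x" if n: "n \<in> set J" and x: "x \<in> space P" for n x
    unfolding lap_def unfolding E_def
  proof (rule ptw[OF kernel_one n x])
    fix t assume t: "t \<in> space \<mu>"
    have "(\<integral>u. d n (x(n := u)) \<partial>\<mu>) = E n (D n) x"
      unfolding E_eq[OF x] by (intro Bochner_Integration.integral_cong) (simp_all add: Dd upd_space x n)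
    then show "1 * \<bar>f x - f (x(n := t))\<bar> \<le> 1 * kern (\<lambda>_ _. 1) n (D n) x"
      using osc[OF n x coord_space[OF x n] t] by (simp add: fF x upd_space n t E_def)
  qed
  \<comment> \<open>The integral over one cell is 1 / m times the cell average, and this is the
    source of \<eta> = 1 / m.\<close>
  have G_le: "\<bar>f x - G n f x\<bar> \<le> 1 / m * G n (D n) x" if n: "n \<in> set J" and x: "x \<in> space P" for n x
    unfolding G_def
  proof (rule ptw[OF kernel_cell n x])
    fix t assume t: "t \<in> space \<mu>"
    have "(\<integral>u. of_bool (cell (x n) = cell u) * d n (x(n := u)) \<partial>\<mu>) =
        (\<integral>u. 1 / m * (cell_kernel (x n) u * D n (x(n := u))) \<partial>\<mu>)"
      using m_pos
      by (intro Bochner_Integration.integral_cong) (simp_all add: Dd upd_space x n cell_kernel_def)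
    also have "\<dots> = 1 / m * G n (D n) x"
      unfolding G_eq[OF x] by simp
    finally have eq: "(\<integral>u. of_bool (cell (x n) = cell u) * d n (x(n := u)) \<partial>\<mu>) = 1 / m * G n (D n) x" .
    show "cell_kernel (x n) t * \<bar>f x - f (x(n := t))\<bar>
        \<le> cell_kernel (x n) t * (1 / m * kern cell_kernel n (D n) x)"
    proof (cases "cell (x n) = cell t")
      case True
      then have "\<bar>f x - f (x(n := t))\<bar> \<le> 1 / m * G n (D n) x"
        using osc_cell[OF n x coord_space[OF x n] t] eq by (simp add: fF x upd_space n t)
      then show ?thesis
        unfolding G_def using kernel_nonneg[OF kernel_cell] by (rule mult_left_mono)
    qed (simp add: cell_kernel_def)
  qed
  have ev_le: "ev g \<le> ev h" if "g \<in> B" "h \<in> B" "\<And>x. x \<in> space P \<Longrightarrow> g x \<le> h x" for g h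
  proof (rule ev_mono[OF that(1,2)])
    show "g x \<le> h x" for x
      using that(3)[OF collapse_space[of x]] unfolding B_collapse[OF that(1)] B_collapse[OF that(2)] .
  qed
  obtain L where L: "set L = R" "distinct L"
    using finite_distinct_list[OF finite_subset[OF R]] by auto
  have LJ: "set L \<subseteq> set J" using L R by simp
  have m1: "0 < 1 / real m" "1 / real m < 1" using par(1) by auto
  have main: "norm1 (\<lambda>x. f x - foldr E L f x) \<le>
      8 * (1 / m) + sqrt (2 * \<kappa> * (1 / (1 - (1 - 1 / m)\<^sup>2)) + (1 / \<kappa> ^ (2 ^ k - 1))\<^sup>2 * \<delta> / (4 * \<kappa>))"
  proof (rule junta_approximation[where f = f and \<eta> = "1 / m" and \<kappa> = \<kappa> and k = k and R = L and \<delta> = \<delta>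
        and a = "\<lambda>n. \<integral>x. d n x \<partial>P"])
    fix n assume n: "n \<in> set J"
    have "norm1 (lap n f) \<le> ev (E n (D n))"
      unfolding norm1_def using n f D
      by (intro ev_le lap_le) (auto intro!: mem lap_mem markov_mem[OF E_markov])
    then show "norm1 (lap n f) \<le> (\<integral>x. d n x \<partial>P)" using n D by (simp add: ev_E evD)
    have "norm1 (\<lambda>x. f x - G n f x) \<le> ev (\<lambda>x. 1 / m * G n (D n) x)"
      unfolding norm1_def using n f D
      by (intro ev_le G_le) (auto intro!: mem markov_mem[OF G_markov])
    then show "norm1 (\<lambda>x. f x - G n f x) \<le> 1 / m * (\<integral>x. d n x \<partial>P)"
      using n D by (simp only: ev_cmult markov_mem[OF G_markov] ev_G evD)
  next
    have "sqnorm2 (\<lambda>x. f x - ev f) = (\<integral>x. (f x - ev f)\<^sup>2 \<partial>P)"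
      unfolding sqnorm2_def using f by (intro ev_integral mem)
    also have "\<dots> = (\<integral>x. (F x - (\<integral>y. F y \<partial>P))\<^sup>2 \<partial>P)"
      by (intro Bochner_Integration.integral_cong) (simp_all add: fF evf)
    finally show "sqnorm2 (\<lambda>x. f x - ev f) \<le> 1" using var by simp
  next
    fix n assume "n \<in> set L"
    then show "(\<integral>x. d n x \<partial>P) \<le> \<delta>" using small L(1) by simp
  qed (fact f m1 par total LJ L)+
  have "(\<integral>x. \<bar>F x - (\<integral>y. F (\<lambda>i. if i \<in> R then y i else x i) \<partial>Pi\<^sub>M R (\<lambda>_. \<mu>))\<bar> \<partial>P)
      = (\<integral>x. \<bar>f x - foldr E L f x\<bar> \<partial>P)"
  proof (intro Bochner_Integration.integral_cong refl)
    fix x assume x: "x \<in> space P"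
    have "foldr E L f x = (\<integral>y. f (\<lambda>i. if i \<in> R then y i else x i) \<partial>Pi\<^sub>M R (\<lambda>_. \<mu>))"
      using foldr_E_eq[OF LJ L(2) f x] by (simp add: L)
    also have "\<dots> = (\<integral>y. F (\<lambda>i. if i \<in> R then y i else x i) \<partial>Pi\<^sub>M R (\<lambda>_. \<mu>))"
    proof (intro Bochner_Integration.integral_cong refl fF)
      fix y assume "y \<in> space (Pi\<^sub>M R (\<lambda>_. \<mu>))"
      then show "(\<lambda>i. if i \<in> R then y i else x i) \<in> space P"
        using x R by (fastforce simp: space_PiM PiE_def Pi_def extensional_def)
    qed
    finally show "\<bar>F x - (\<integral>y. F (\<lambda>i. if i \<in> R then y i else x i) \<partial>Pi\<^sub>M R (\<lambda>_. \<mu>))\<bar> = \<bar>f x - foldr E L f x\<bar>"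
      using x by (simp add: fF)
  qed
  also have "\<dots> = norm1 (\<lambda>x. f x - foldr E L f x)"
    unfolding norm1_def using f LJ by (intro ev_integral[symmetric] mem markov_mem[OF markov_foldr_E])
  finally show ?thesis using main by simp
qed

text \<open>The set is chosen from the \<open>d n\<close> alone, so one set serves all real
  components of \<open>F\<close>. Summing over the components costs the factor DIM('k).\<close>

theorem vector_junta_approximation:
  fixes F :: "('i \<Rightarrow> 'a) \<Rightarrow> 'k :: euclidean_space" and d :: "'i \<Rightarrow> ('i \<Rightarrow> 'a) \<Rightarrow> real"
    and \<epsilon> :: real
  assumes F: "F \<in> borel_measurable P" "\<And>x. x \<in> space P \<Longrightarrow> norm (F x) \<le> b"
    and d: "\<And>n. n \<in> set J \<Longrightarrow> d n \<in> borel_measurable P"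
      "\<And>n x. n \<in> set J \<Longrightarrow> x \<in> space P \<Longrightarrow> \<bar>d n x\<bar> \<le> b' n"
    and osc: "\<And>n x s t. n \<in> set J \<Longrightarrow> x \<in> space P \<Longrightarrow> s \<in> space \<mu> \<Longrightarrow> t \<in> space \<mu> \<Longrightarrow>
      norm (F (x(n := s)) - F (x(n := t))) \<le> (\<integral>u. d n (x(n := u)) \<partial>\<mu>)"
    and osc_cell: "\<And>n x s t. n \<in> set J \<Longrightarrow> x \<in> space P \<Longrightarrow> s \<in> space \<mu> \<Longrightarrow> t \<in> space \<mu> \<Longrightarrow>
      cell s = cell t \<Longrightarrow>
      norm (F (x(n := s)) - F (x(n := t))) \<le> (\<integral>u. of_bool (cell s = cell u) * d n (x(n := u)) \<partial>\<mu>)"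
    and total: "(\<Sum>n\<in>set J. \<integral>x. d n x \<partial>P) \<le> 1"
    and var: "(\<integral>x. (norm (F x - (\<integral>y. F y \<partial>P)))\<^sup>2 \<partial>P) \<le> 1"
    and par: "2 \<le> m" "0 < \<kappa>" "0 < \<delta>" "((1 - 1 / m) ^ (2 ^ k))\<^sup>2 * m \<le> 1 / 4"
      "8 * (1 / m) + sqrt (2 * \<kappa> * (1 / (1 - (1 - 1 / m)\<^sup>2)) + (1 / \<kappa> ^ (2 ^ k - 1))\<^sup>2 * \<delta> / (4 * \<kappa>)) < \<epsilon>"
  shows "\<exists>S\<subseteq>set J. card S \<le> nat \<lceil>1 / \<delta>\<rceil> \<and>
    (\<integral>x. norm (F x - (\<integral>y. F (merge S (set J - S) (x, y)) \<partial>Pi\<^sub>M (set J - S) (\<lambda>_. \<mu>))) \<partial>P) < DIM('k) * \<epsilon>"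
proof -
  interpret PP: prob_space P by (rule prob_space_P)
  \<comment> \<open>The oscillation bound with s = t makes the integral of \<open>d n\<close> along
    each line nonnegative, although \<open>d n\<close> itself may change sign; averaging over the
    lines gives the claim.\<close>
  have d_nonneg: "0 \<le> (\<integral>x. d n x \<partial>P)" if n: "n \<in> set J" for n
  proof -
    have Bd: "(\<lambda>x. d n (collapse x)) \<in> B" by (rule BI[OF d[OF n]])
    have "0 \<le> (\<integral>u. d n (x(n := u)) \<partial>\<mu>)" if "x \<in> space P" for x
      using osc[OF n that coord_space[OF that n] coord_space[OF that n]] by simp
    then have "0 \<le> (\<integral>x. E n (\<lambda>x. d n (collapse x)) x \<partial>P)"
      using n by (intro integral_nonneg_AE) (auto simp: E_eq upd_space cong: Bochner_Integration.integral_cong)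
    also have "\<dots> = ev (E n (\<lambda>x. d n (collapse x)))"
      using Bd n by (intro ev_integral[symmetric] markov_mem[OF E_markov])
    also have "\<dots> = ev (\<lambda>x. d n (collapse x))" using Bd n by (intro ev_E)
    also have "\<dots> = (\<integral>x. d n x \<partial>P)"
      unfolding ev_integral[OF Bd] by (intro Bochner_Integration.integral_cong) simp_all
    finally show ?thesis .
  qed
  define S where "S = {n \<in> set J. \<delta> < (\<integral>x. d n x \<partial>P)}"
  define R where "R = set J - S"
  have S: "S \<subseteq> set J" "finite S" by (auto simp: S_def)
  \<comment> \<open>Markov's inequality for the counting measure: each member of \<open>S\<close>
    takes more than \<delta> from a total of at most 1.\<close>
  have "\<delta> * card S = (\<Sum>n\<in>S. \<delta>)" by simp
  also have "\<dots> \<le> (\<Sum>n\<in>S. \<integral>x. d n x \<partial>P)" by (intro sum_mono) (auto simp: S_def)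
  also have "\<dots> \<le> (\<Sum>n\<in>set J. \<integral>x. d n x \<partial>P)" using d_nonneg S by (intro sum_mono2) auto
  finally have "real (card S) \<le> 1 / \<delta>" using total par(3) by (simp add: field_simps)
  then have card: "card S \<le> nat \<lceil>1 / \<delta>\<rceil>" by linarith
  define w where "w x y i = (if i \<in> R then y i else x i)" for x y :: "'i \<Rightarrow> 'a" and i
  have merge: "merge S (set J - S) (x, y) = w x y" if "x \<in> space P" for x y
    using that S by (auto simp: merge_def w_def R_def space_PiM PiE_def extensional_def fun_eq_iff)
  have F_int: "integrable P F" using F by (intro PP.integrable_const_bound[of _ b]) auto
  have w_space: "w x y \<in> space P" if "x \<in> space P" "y \<in> space (Pi\<^sub>M R (\<lambda>_. \<mu>))" for x y
    using that by (fastforce simp: w_def R_def space_PiM PiE_def Pi_def extensional_def)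
  have w_meas: "(\<lambda>(x, y). w x y) \<in> measurable (P \<Otimes>\<^sub>M Pi\<^sub>M R (\<lambda>_. \<mu>)) P"
  proof (rule measurable_PiM_single')
    fix i assume i: "i \<in> set J"
    show "(\<lambda>p. (case p of (x, y) \<Rightarrow> w x y) i) \<in> measurable (P \<Otimes>\<^sub>M Pi\<^sub>M R (\<lambda>_. \<mu>)) \<mu>"
      using i by (cases "i \<in> R") (auto simp: w_def case_prod_beta')
  next
    show "(\<lambda>(x, y). w x y) \<in> space (P \<Otimes>\<^sub>M Pi\<^sub>M R (\<lambda>_. \<mu>)) \<rightarrow> (\<Pi>\<^sub>E i\<in>set J. space \<mu>)"
      using w_space by (auto simp: space_pair_measure space_PiM)
  qed
  interpret PR: prob_space "Pi\<^sub>M R (\<lambda>_. \<mu>)" by (rule prob_space_PiM) (rule prob_space_axioms)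
  have Fw_meas: "(\<lambda>(x, y). F (w x y)) \<in> borel_measurable (P \<Otimes>\<^sub>M Pi\<^sub>M R (\<lambda>_. \<mu>))"
    using measurable_compose[OF w_meas F(1)] by (simp add: case_prod_beta')
  have Fw_int: "integrable (Pi\<^sub>M R (\<lambda>_. \<mu>)) (\<lambda>y. F (w x y))" if x: "x \<in> space P" for x
    using measurable_compose[OF measurable_Pair1'[OF x] Fw_meas] w_space[OF x] F(2)
    by (intro PR.integrable_const_bound[of _ b]) auto
  define A where "A x = (\<integral>y. F (w x y) \<partial>Pi\<^sub>M R (\<lambda>_. \<mu>))" for x
  have A_meas: "A \<in> borel_measurable P"
    unfolding A_def by (rule PR.borel_measurable_lebesgue_integral[OF Fw_meas])
  have A_bd: "norm (A x) \<le> b" if x: "x \<in> space P" for x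
  proof -
    have "norm (A x) \<le> (\<integral>y. norm (F (w x y)) \<partial>Pi\<^sub>M R (\<lambda>_. \<mu>))"
      unfolding A_def by (rule integral_norm_bound)
    also have "\<dots> \<le> (\<integral>y. b \<partial>Pi\<^sub>M R (\<lambda>_. \<mu>))"
      using Fw_int[OF x] w_space[OF x] F(2) by (intro integral_mono) auto
    finally show ?thesis by (simp add: PR.prob_space)
  qed
  have A_int: "integrable P A" using A_meas A_bd by (intro PP.integrable_const_bound[of _ b]) auto
  have comp: "(\<integral>x. \<bar>(F x - A x) \<bullet> e\<bar> \<partial>P) < \<epsilon>" if e: "e \<in> Basis" for e
  proof -
    have le: "\<bar>v \<bullet> e\<bar> \<le> norm v" for v :: 'k using Basis_le_norm[OF e] .
    have "(\<integral>x. \<bar>F x \<bullet> e - (\<integral>y. F (\<lambda>i. if i \<in> R then y i else x i) \<bullet> e \<partial>Pi\<^sub>M R (\<lambda>_. \<mu>))\<bar> \<partial>P)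
      \<le> 8 * (1 / m) + sqrt (2 * \<kappa> * (1 / (1 - (1 - 1 / m)\<^sup>2)) + (1 / \<kappa> ^ (2 ^ k - 1))\<^sup>2 * \<delta> / (4 * \<kappa>))"
    proof (rule real_junta_approximation[where d = d and b' = b' and b = b])
      show "(\<lambda>x. F x \<bullet> e) \<in> borel_measurable P" using F(1) by measurable
      show "\<bar>F x \<bullet> e\<bar> \<le> b" if "x \<in> space P" for x using le[of "F x"] F(2)[OF that] by linarith
      show "\<bar>F (x(n := s)) \<bullet> e - F (x(n := t)) \<bullet> e\<bar> \<le> (\<integral>u. d n (x(n := u)) \<partial>\<mu>)"
        if "n \<in> set J" "x \<in> space P" "s \<in> space \<mu>" "t \<in> space \<mu>" for n x s t
        using osc[OF that] le[of "F (x(n := s)) - F (x(n := t))"] by (simp add: inner_diff_left)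
      show "\<bar>F (x(n := s)) \<bullet> e - F (x(n := t)) \<bullet> e\<bar> \<le> (\<integral>u. of_bool (cell s = cell u) * d n (x(n := u)) \<partial>\<mu>)"
        if "n \<in> set J" "x \<in> space P" "s \<in> space \<mu>" "t \<in> space \<mu>" "cell s = cell t" for n x s t
        using osc_cell[OF that] le[of "F (x(n := s)) - F (x(n := t))"] by (simp add: inner_diff_left)
      have "norm (\<integral>y. F y \<partial>P) \<le> b"
      proof -
        have "norm (\<integral>y. F y \<partial>P) \<le> (\<integral>y. norm (F y) \<partial>P)" by (rule integral_norm_bound)
        also have "\<dots> \<le> (\<integral>y. b \<partial>P)" using F_int F(2) by (intro integral_mono) auto
        finally show ?thesis by (simp add: PP.prob_space)
      qed
      then have nb: "norm (F x - (\<integral>y. F y \<partial>P)) \<le> 2 * b" if "x \<in> space P" for x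
        using F(2)[OF that] norm_triangle_ineq4[of "F x" "\<integral>y. F y \<partial>P"] by linarith
      have "(\<integral>x. (F x \<bullet> e - (\<integral>y. F y \<bullet> e \<partial>P))\<^sup>2 \<partial>P) = (\<integral>x. ((F x - (\<integral>y. F y \<partial>P)) \<bullet> e)\<^sup>2 \<partial>P)"
        using F_int by (simp add: inner_diff_left)
      also have "\<dots> \<le> (\<integral>x. (norm (F x - (\<integral>y. F y \<partial>P)))\<^sup>2 \<partial>P)"
      proof (rule integral_mono)
        have sq: "((F x - (\<integral>y. F y \<partial>P)) \<bullet> e)\<^sup>2 \<le> (norm (F x - (\<integral>y. F y \<partial>P)))\<^sup>2" for x
          using le by (intro abs_le_square_iff[THEN iffD1]) simp
        then show "((F x - (\<integral>y. F y \<partial>P)) \<bullet> e)\<^sup>2 \<le> (norm (F x - (\<integral>y. F y \<partial>P)))\<^sup>2" for x .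
        have nb2: "(norm (F x - (\<integral>y. F y \<partial>P)))\<^sup>2 \<le> (2 * b)\<^sup>2" if "x \<in> space P" for x
          using nb[OF that] by (intro power_mono) auto
        show "integrable P (\<lambda>x. (norm (F x - (\<integral>y. F y \<partial>P)))\<^sup>2)"
          using nb2 F(1) by (intro PP.integrable_bounded[of _ "(2 * b)\<^sup>2"]) auto
        show "integrable P (\<lambda>x. ((F x - (\<integral>y. F y \<partial>P)) \<bullet> e)\<^sup>2)"
          using order_trans[OF sq nb2] F(1) by (intro PP.integrable_bounded[of _ "(2 * b)\<^sup>2"]) auto
      qed
      finally show "(\<integral>x. (F x \<bullet> e - (\<integral>y. F y \<bullet> e \<partial>P))\<^sup>2 \<partial>P) \<le> 1" using var by simp
    qed (use d total par R_def S_def in auto)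
    moreover have "(\<integral>x. \<bar>F x \<bullet> e - (\<integral>y. F (\<lambda>i. if i \<in> R then y i else x i) \<bullet> e \<partial>Pi\<^sub>M R (\<lambda>_. \<mu>))\<bar> \<partial>P)
        = (\<integral>x. \<bar>(F x - A x) \<bullet> e\<bar> \<partial>P)"
      by (intro Bochner_Integration.integral_cong refl)
        (simp add: A_def inner_diff_left Fw_int[unfolded w_def[abs_def]] w_def[abs_def])
    ultimately show ?thesis using par(5) by simp
  qed
  have int: "integrable P (\<lambda>x. F x - A x)" using F_int A_int by simp
  have "(\<integral>x. norm (F x - (\<integral>y. F (merge S (set J - S) (x, y)) \<partial>Pi\<^sub>M (set J - S) (\<lambda>_. \<mu>))) \<partial>P) = (\<integral>x. norm (F x - A x) \<partial>P)"
    by (intro Bochner_Integration.integral_cong refl) (simp add: A_def merge R_def)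
  also have "\<dots> \<le> (\<integral>x. (\<Sum>e\<in>Basis. \<bar>(F x - A x) \<bullet> e\<bar>) \<partial>P)"
    using int by (intro integral_mono norm_le_l1) auto
  also have "\<dots> = (\<Sum>e\<in>Basis. \<integral>x. \<bar>(F x - A x) \<bullet> e\<bar> \<partial>P)"
    using int by (intro Bochner_Integration.integral_sum) auto
  also have "\<dots> < (\<Sum>e\<in>(Basis :: 'k set). \<epsilon>)"
    using comp by (intro sum_strict_mono) auto
  also have "\<dots> = DIM('k) * \<epsilon>" by simp
  finally show ?thesis using S card by (intro exI[of _ S]) auto
qed

end

section \<open>Functions on the cube\<close>

text \<open>The fundamental theorem of calculus on [s, t]. Passing to a larger set A, later the
  whole parameter range or one cell, frees the bound from the end points.\<close>

lemma norm_diff_le_integral: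
  fixes u u' :: "real \<Rightarrow> 'k :: euclidean_space"
  assumes der: "\<And>r. r \<in> {0..1} \<Longrightarrow> (u has_vector_derivative u' r) (at r within {0..1})"
    and cont: "continuous_on {0..1} u'"
    and A: "A \<in> sets borel" "A \<subseteq> {0..1}" "{s..t} \<subseteq> A" and st: "s \<le> t"
  shows "norm (u t - u s) \<le> (\<integral>r. indicator A r * norm (u' r) \<partial>lborel)"
proof -
  have sub: "{s..t} \<subseteq> {0..1}" using A(3,2) by (rule order_trans)
  have int: "integrable lborel (\<lambda>r. indicator {0..1} r *\<^sub>R u' r)"
    by (intro borel_integrable_compact cont) simp
  have int': "integrable lborel (\<lambda>r. indicator C r * norm (u' r))" if "C \<in> sets borel" "C \<subseteq> {0..1}" for C
  proof -
    have "integrable lborel (\<lambda>r. indicator C r *\<^sub>R norm (indicator {0..1} r *\<^sub>R u' r))"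
      using that(1) by (intro integrable_mult_indicator integrable_norm int) simp
    moreover have "(\<lambda>r. indicator C r *\<^sub>R norm (indicator {0..1} r *\<^sub>R u' r)) = (\<lambda>r. indicator C r * norm (u' r))"
      using that(2) by (auto simp: fun_eq_iff indicator_def)
    ultimately show ?thesis by simp
  qed
  have "u t - u s = (\<integral>r. indicator {s..t} r *\<^sub>R u' r \<partial>lborel)"
  proof (rule integral_FTC_Icc[symmetric, OF st])
    show "(u has_vector_derivative u' r) (at r within {s..t})" if "s \<le> r" "r \<le> t" for r
      using that sub by (intro has_vector_derivative_within_subset[OF der sub]) auto
  qed (rule continuous_on_subset[OF cont sub])
  also have "norm \<dots> \<le> (\<integral>r. norm (indicator {s..t} r *\<^sub>R u' r) \<partial>lborel)"
    by (rule integral_norm_bound)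
  also have "\<dots> = (\<integral>r. indicator {s..t} r * norm (u' r) \<partial>lborel)" by simp
  also have "\<dots> \<le> (\<integral>r. indicator A r * norm (u' r) \<partial>lborel)"
    using A sub by (intro integral_mono int') (auto simp: indicator_def)
  finally show ?thesis .
qed

lemma norm_diff_le_integral_unordered:
  fixes u u' :: "real \<Rightarrow> 'k :: euclidean_space"
  assumes "\<And>r. r \<in> {0..1} \<Longrightarrow> (u has_vector_derivative u' r) (at r within {0..1})"
    and "continuous_on {0..1} u'"
    and "A \<in> sets borel" "A \<subseteq> {0..1}" "s \<in> A" "t \<in> A" and A: "\<And>s t. s \<in> A \<Longrightarrow> t \<in> A \<Longrightarrow> {s..t} \<subseteq> A"
  shows "norm (u s - u t) \<le> (\<integral>r. indicator A r * norm (u' r) \<partial>lborel)"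
proof (cases "s \<le> t")
  case True
  then show ?thesis
    using norm_diff_le_integral[OF assms(1-4) A, of s t] assms(5,6) by (simp add: norm_minus_commute)
next
  case False
  then show ?thesis using norm_diff_le_integral[OF assms(1-4) A, of t s] assms(5,6) by simp
qed

text \<open>Continuity refers to the topology on all functions, measurability to the product
  sigma-algebra over \<open>I\<close>. With a countable index type and second countable factors it
  suffices to check coordinates, and those outside \<open>I\<close> are constantly
  \<open>undefined\<close>.\<close>

lemma space_measurable_borel:
  fixes \<mu> :: "'b :: second_countable_topology measure" and I :: "'i :: countable set"
  assumes "(\<lambda>t. t) \<in> borel_measurable \<mu>"
  shows "(\<lambda>x. x) \<in> borel_measurable (Pi\<^sub>M I (\<lambda>_. \<mu>))"
proof (rule measurable_coordinatewise_then_product)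
  fix i
  show "(\<lambda>x. x i) \<in> borel_measurable (Pi\<^sub>M I (\<lambda>_. \<mu>))"
  proof (cases "i \<in> I")
    case True
    then show ?thesis using measurable_compose[OF measurable_component_singleton[OF True, where M = "\<lambda>_. \<mu>"] assms] by simp
  next
    case False
    then have "(\<lambda>x. x i) \<in> borel_measurable (Pi\<^sub>M I (\<lambda>_. \<mu>)) \<longleftrightarrow>
        (\<lambda>x. undefined :: 'b) \<in> borel_measurable (Pi\<^sub>M I (\<lambda>_. \<mu>))"
      by (intro measurable_cong) (auto simp: space_PiM PiE_def extensional_def)
    then show ?thesis by simp
  qed
qed

lemma continuous_on_measurable_PiM:
  fixes \<mu> :: "'b :: second_countable_topology measure" and I :: "'i :: countable set"
    and f :: "('i \<Rightarrow> 'b) \<Rightarrow> 'c :: topological_space"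
  assumes "(\<lambda>t. t) \<in> borel_measurable \<mu>" "continuous_on (PiE I (\<lambda>_. space \<mu>)) f"
  shows "f \<in> borel_measurable (Pi\<^sub>M I (\<lambda>_. \<mu>))"
proof -
  have "(\<lambda>x. x) \<in> measurable (Pi\<^sub>M I (\<lambda>_. \<mu>)) (restrict_space borel (PiE I (\<lambda>_. space \<mu>)))"
    by (intro measurable_restrict_space2 space_measurable_borel assms) (simp add: space_PiM)
  then show ?thesis
    by (rule measurable_compose[OF _ borel_measurable_continuous_on_restrict[OF assms(2)]])
qed

text \<open>Tychonoff over the whole index type, with the one-point factor
  \<open>{undefined}\<close> outside \<open>I\<close>.\<close>

lemma compact_PiE:
  fixes A :: "'b :: topological_space set"
  assumes "compact A"
  shows "compact (PiE I (\<lambda>_. A))"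
proof -
  have "PiE I (\<lambda>_. A) = PiE UNIV (\<lambda>i. if i \<in> I then A else {undefined})"
    by (force simp: PiE_def extensional_def Pi_def)
  moreover have "compactin (product_topology (\<lambda>_. euclidean) UNIV) (PiE UNIV (\<lambda>i. if i \<in> I then A else {undefined}))"
    unfolding compactin_PiE using assms by auto
  ultimately show ?thesis by (simp add: euclidean_product_topology)
qed

lemma continuous_on_PiE_bounded:
  fixes f :: "('i \<Rightarrow> 'b :: topological_space) \<Rightarrow> 'c :: real_normed_vector"
  assumes "compact A" "continuous_on (PiE I (\<lambda>_. A)) f"
  obtains b where "\<And>x. x \<in> PiE I (\<lambda>_. A) \<Longrightarrow> norm (f x) \<le> b"
proof -
  have "bounded (f ` PiE I (\<lambda>_. A))"
    by (intro compact_imp_bounded compact_continuous_image compact_PiE assms)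
  then show thesis using that by (auto simp: bounded_iff)
qed

lemma continuous_on_fun_upd:
  fixes c :: "'a :: topological_space \<Rightarrow> 'b :: topological_space"
  assumes "continuous_on S c"
  shows "continuous_on S (\<lambda>t. x(n := c t))"
proof (rule continuous_on_coordinatewise_then_product)
  show "continuous_on S (\<lambda>t. (x(n := c t)) i)" for i
    using assms by (cases "i = n") auto
qed

text \<open>The last cell of the unit interval also contains the right endpoint.\<close>

definition interval_cell :: "nat \<Rightarrow> real \<Rightarrow> nat" where
  "interval_cell m t = min (m - 1) (nat \<lfloor>real m * t\<rfloor>)"

lemma interval_cell_measurable [measurable]: "interval_cell m \<in> measurable borel (count_space UNIV)"
  unfolding interval_cell_def[abs_def] by measurable

lemma interval_cell_mono: "s \<le> t \<Longrightarrow> interval_cell m s \<le> interval_cell m t"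
  unfolding interval_cell_def
  by (intro min.mono nat_mono floor_mono mult_left_mono) auto

text \<open>Level sets of a monotone function are convex, so a path between two points of a cell
  stays in the cell.\<close>

lemma interval_cell_convex:
  assumes "interval_cell m s = j" "interval_cell m t = j"
  shows "{s..t} \<subseteq> {r. interval_cell m r = j}"
  using assms interval_cell_mono[of s _ m] interval_cell_mono[of _ t m] by (auto intro: antisym)

text \<open>For t < 1 the floor of m t is at most m - 1, so the minimum has no effect and the cells
  have equal length.\<close>

lemma interval_cell_halfopen:
  assumes m: "0 < m" and j: "j < m"
  shows "{t \<in> {0..<1}. interval_cell m t = j} = {real j / real m..<(real j + 1) / real m}"
proof (intro set_eqI)
  fix t :: real
  show "t \<in> {t \<in> {0..<1}. interval_cell m t = j} \<longleftrightarrow> t \<in> {real j / real m..<(real j + 1) / real m}"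
  proof (cases "0 \<le> t \<and> t < 1")
    case True
    then have fl: "0 \<le> \<lfloor>m * t\<rfloor>" "\<lfloor>m * t\<rfloor> < m" using m by (auto simp: floor_less_iff)
    then have "nat \<lfloor>m * t\<rfloor> \<le> m - 1" by linarith
    then have "interval_cell m t = j \<longleftrightarrow> \<lfloor>m * t\<rfloor> = int j"
      using fl unfolding interval_cell_def by (auto simp: min_def)
    also have "\<dots> \<longleftrightarrow> real j / real m \<le> t \<and> t < (real j + 1) / real m"
      using m by (simp add: floor_eq_iff field_simps)
    finally show ?thesis using True by simp
  next
    case False
    have "0 \<le> real j / m" "(real j + 1) / m \<le> 1" using m j by auto
    then show ?thesis
      using False unfolding mem_Collect_eq atLeastLessThan_iff by linarith
  qed
qed

lemma emeasure_interval_cell: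
  assumes m: "0 < m" and j: "j < m"
  shows "emeasure lborel {t \<in> {0..<1}. interval_cell m t = j} = ennreal (1 / m)"
proof -
  have "(real j + 1) / real m = real j / real m + 1 / real m" by (rule add_divide_distrib)
  then show ?thesis unfolding interval_cell_halfopen[OF assms] by simp
qed

lemma interval_cell_less: "0 < m \<Longrightarrow> interval_cell m t < m"
  by (simp add: interval_cell_def min_def) linarith

lemma prob_space_unit_interval: "prob_space unit_interval"
  by (rule prob_spaceI) (simp add: emeasure_restrict_space space_restrict_space)

lemma set_upt_Icc: "set [1..<Suc N] = {1..N}"
  by auto

lemma cube_cell_product:
  assumes "0 < m"
  shows "cell_product unit_interval (interval_cell m) m (J :: nat list) \<longleftrightarrow> distinct J"
proof -
  have "measure unit_interval {t \<in> space unit_interval. interval_cell m t = interval_cell m s} = 1 / m"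
    for s
  proof -
    let ?j = "interval_cell m s"
    have "emeasure unit_interval {t \<in> space unit_interval. interval_cell m t = ?j}
        = emeasure lborel {t \<in> {0..1}. interval_cell m t = ?j}"
      by (subst emeasure_restrict_space) (auto simp: space_restrict_space)
    \<comment> \<open>The right end point is a null set, so the last cell also has mass 1 /
      m.\<close>
    also have "\<dots> = emeasure lborel {t \<in> {0..<1}. interval_cell m t = ?j}"
    proof (rule emeasure_eq_AE)
      show "AE t in lborel. (t \<in> {t \<in> {0..1}. interval_cell m t = ?j}) =
          (t \<in> {t \<in> {0..<1}. interval_cell m t = ?j})"
        using AE_lborel_singleton[of 1] by eventually_elim auto
    qed auto
    also have "\<dots> = ennreal (1 / m)"
      using emeasure_interval_cell[OF assms interval_cell_less[OF assms]] .
    finally show ?thesis by (simp add: measure_def)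
  qed
  then show ?thesis
    unfolding cell_product_def cell_product_axioms_def
    using assms prob_space_unit_interval by (auto intro!: measurable_restrict_space1)
qed

theorem cube_junta:
  fixes \<epsilon> :: real
  assumes "0 < \<epsilon>"
  shows "\<exists>q::nat. q \<ge> 1 \<and> (\<forall>N::nat. N \<ge> 1 \<longrightarrow> (\<forall>f :: (nat \<Rightarrow> real) \<Rightarrow> 'k :: euclidean_space.
    C1_cube N f \<and> cube_gradient_norm N f \<le> 1 \<and>
    L2_norm (cube_lebesgue N) (\<lambda>x. f x - (\<integral>y. f y \<partial>cube_lebesgue N)) \<le> 1 \<longrightarrow>
    (\<exists>S \<subseteq> {1..N}. card S \<le> q \<and>
      L1_norm (cube_lebesgue N) (\<lambda>x. f x - expect_onto unit_interval N S f x) < \<epsilon>)))"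
proof -
  have "0 < \<epsilon> / DIM('k)" using assms by simp
  then obtain m k :: nat and \<kappa> \<delta> :: real where par: "2 \<le> m" "0 < \<kappa>" "0 < \<delta>"
    "((1 - 1 / m) ^ (2 ^ k))\<^sup>2 * m \<le> 1 / 4"
    "8 * (1 / m) + sqrt (2 * \<kappa> * (1 / (1 - (1 - 1 / m)\<^sup>2)) + (1 / \<kappa> ^ (2 ^ k - 1))\<^sup>2 * \<delta> / (4 * \<kappa>)) < \<epsilon> / DIM('k)"
    by (rule junta_parameters)
  have m: "0 < m" using par(1) by simp
  show ?thesis
  proof (intro exI[of _ "max 1 (nat \<lceil>1 / \<delta>\<rceil>)"] conjI allI impI)
    fix N :: nat and f :: "(nat \<Rightarrow> real) \<Rightarrow> 'k"
    assume "C1_cube N f \<and> cube_gradient_norm N f \<le> 1 \<and>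
      L2_norm (cube_lebesgue N) (\<lambda>x. f x - (\<integral>y. f y \<partial>cube_lebesgue N)) \<le> 1"
    then have f: "continuous_on (cube N) f"
        "\<And>n x. n \<in> {1..N} \<Longrightarrow> x \<in> cube N \<Longrightarrow> cube_line n f x differentiable (at (x n) within {0..1})"
        "\<And>n. n \<in> {1..N} \<Longrightarrow> continuous_on (cube N) (cube_partial n f)"
      and grad: "cube_gradient_norm N f \<le> 1"
      and var: "L2_norm (cube_lebesgue N) (\<lambda>x. f x - (\<integral>y. f y \<partial>cube_lebesgue N)) \<le> 1"
      by (auto simp: C1_cube_def)
    let ?J = "[1..<Suc N]"
    interpret cell_product unit_interval "interval_cell m" m ?J
      by (subst cube_cell_product[OF m]) simp
    have id: "(\<lambda>t. t) \<in> borel_measurable unit_interval"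
      by (intro measurable_restrict_space1) simp
    have PiE: "cube N = PiE {1..N} (\<lambda>_. space unit_interval)"
      by (simp add: cube_def space_restrict_space)
    have P_space: "space (Pi\<^sub>M {1..N} (\<lambda>_. unit_interval)) = cube N"
      by (simp add: PiE space_PiM)
    have P_eq: "Pi\<^sub>M {1..N} (\<lambda>_. unit_interval) = cube_lebesgue N" by (simp only: prod_measure_def)
    define d where "d n x = norm (cube_partial n f x)" for n x
    have d_cont: "continuous_on (cube N) (d n)" if "n \<in> {1..N}" for n
      unfolding d_def by (intro continuous_on_norm f that)
    have "\<exists>b. \<forall>x\<in>cube N. \<bar>d n x\<bar> \<le> b" if "n \<in> {1..N}" for n
      using continuous_on_PiE_bounded[OF compact_Icc d_cont[OF that, unfolded cube_def]]
      unfolding cube_def real_norm_def by metis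
    then obtain b' where b': "\<And>n x. n \<in> {1..N} \<Longrightarrow> x \<in> cube N \<Longrightarrow> \<bar>d n x\<bar> \<le> b' n" by metis
    obtain b where b: "\<And>x. x \<in> cube N \<Longrightarrow> norm (f x) \<le> b"
      using continuous_on_PiE_bounded[OF compact_Icc f(1)[unfolded cube_def]] unfolding cube_def by metis
    \<comment> \<open>Serves both oscillation bounds: A is \<open>UNIV\<close> or the cell of s, and
      its convexity keeps the segment between s and t inside.\<close>
    have osc: "norm (f (x(n := s)) - f (x(n := t))) \<le> (\<integral>u. indicator A u * d n (x(n := u)) \<partial>unit_interval)"
      if n: "n \<in> {1..N}" and x: "x \<in> cube N"
        and A: "A \<in> sets borel" "s \<in> A \<inter> {0..1}" "t \<in> A \<inter> {0..1}"
          "\<And>s t. s \<in> A \<Longrightarrow> t \<in> A \<Longrightarrow> {s..t} \<subseteq> A" for n x s t A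
    proof -
      have upd: "x(n := r) \<in> cube N" if "r \<in> {0..1}" for r
        using x n that by (auto simp: cube_def PiE_def Pi_def extensional_def)
      have "norm (f (x(n := s)) - f (x(n := t))) \<le>
          (\<integral>r. indicator (A \<inter> {0..1}) r * norm (cube_partial n f (x(n := r))) \<partial>lborel)"
      proof (rule norm_diff_le_integral_unordered[where u = "\<lambda>r. f (x(n := r))" and u' = "\<lambda>r. cube_partial n f (x(n := r))"])
        fix r :: real assume r: "r \<in> {0..1}"
        \<comment> \<open>The line in direction n is the same from each of its points, so a single
          function of r carries all the derivatives.\<close>
        have "cube_line n f (x(n := r)) = (\<lambda>r. f (x(n := r)))"
          by (auto simp: cube_line_def)
        then show "((\<lambda>r. f (x(n := r))) has_vector_derivative cube_partial n f (x(n := r))) (at r within {0..1})"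
          using f(2)[OF n upd[OF r]] by (simp add: cube_partial_def vector_derivative_works)
      next
        show "continuous_on {0..1} (\<lambda>r. cube_partial n f (x(n := r)))"
          by (rule continuous_on_compose2[OF f(3)[OF n] continuous_on_fun_upd[OF continuous_on_id]])
            (use upd in auto)
      qed (use A in auto)
      also have "\<dots> = (\<integral>u. indicator A u * d n (x(n := u)) \<partial>unit_interval)"
        by (subst integral_restrict_space) (auto simp: d_def indicator_inter_arith mult_ac)
      finally show ?thesis .
    qed
    have total: "(\<Sum>n\<in>{1..N}. \<integral>x. d n x \<partial>cube_lebesgue N) \<le> 1"
      using grad by (simp add: cube_gradient_norm_def L1_norm_def d_def)
    have var': "(\<integral>x. (norm (f x - (\<integral>y. f y \<partial>cube_lebesgue N)))\<^sup>2 \<partial>cube_lebesgue N) \<le> 1"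
      using var by (simp add: L2_norm_def)
    have "\<exists>S\<subseteq>set ?J. card S \<le> nat \<lceil>1 / \<delta>\<rceil> \<and>
      (\<integral>x. norm (f x - (\<integral>y. f (merge S (set ?J - S) (x, y)) \<partial>Pi\<^sub>M (set ?J - S) (\<lambda>_. unit_interval))) \<partial>P)
        < DIM('k) * (\<epsilon> / DIM('k))"
    proof (rule vector_junta_approximation[where d = d and b = b and b' = b', OF _ _ _ _ _ _ _ _ par])
      show "f \<in> borel_measurable P"
        unfolding set_upt_Icc by (intro continuous_on_measurable_PiM id f(1)[unfolded PiE])
      show "norm (f x) \<le> b" if "x \<in> space P" for x using b that by (simp only: set_upt_Icc P_space)
      show "d n \<in> borel_measurable P" if "n \<in> set ?J" for n
        using that unfolding set_upt_Icc by (intro continuous_on_measurable_PiM id d_cont[unfolded PiE])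
      show "\<bar>d n x\<bar> \<le> b' n" if "n \<in> set ?J" "x \<in> space P" for n x
        using b' that by (simp only: P_space set_upt_Icc)
      show "norm (f (x(n := s)) - f (x(n := t))) \<le> (\<integral>u. d n (x(n := u)) \<partial>unit_interval)"
        if "n \<in> set ?J" "x \<in> space P" "s \<in> space unit_interval" "t \<in> space unit_interval" for n x s t
        using osc[of n x UNIV s t] that unfolding P_space set_upt_Icc by (simp add: space_restrict_space)
      show "norm (f (x(n := s)) - f (x(n := t))) \<le>
          (\<integral>u. of_bool (interval_cell m s = interval_cell m u) * d n (x(n := u)) \<partial>unit_interval)"
        if "n \<in> set ?J" "x \<in> space P" "s \<in> space unit_interval" "t \<in> space unit_interval"
          "interval_cell m s = interval_cell m t" for n x s t
      proof -
        define A where "A = {r. interval_cell m r = interval_cell m s}"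
        have "A \<in> sets borel"
          using measurable_sets[OF interval_cell_measurable[of m], of "{interval_cell m s}"]
          by (simp add: A_def vimage_def)
        then have "norm (f (x(n := s)) - f (x(n := t))) \<le> (\<integral>u. indicator A u * d n (x(n := u)) \<partial>unit_interval)"
          using that interval_cell_convex[of m _ "interval_cell m s"] unfolding P_space set_upt_Icc
          by (intro osc) (auto simp: A_def space_restrict_space)
        then show ?thesis by (simp add: A_def indicator_def eq_commute)
      qed
      show "(\<Sum>n\<in>set ?J. \<integral>x. d n x \<partial>P) \<le> 1" using total unfolding set_upt_Icc P_eq .
      show "(\<integral>x. (norm (f x - (\<integral>y. f y \<partial>P)))\<^sup>2 \<partial>P) \<le> 1" using var' unfolding set_upt_Icc P_eq .
    qed
    then show "\<exists>S \<subseteq> {1..N}. card S \<le> max 1 (nat \<lceil>1 / \<delta>\<rceil>) \<and>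
      L1_norm (cube_lebesgue N) (\<lambda>x. f x - expect_onto unit_interval N S f x) < \<epsilon>"
      unfolding set_upt_Icc P_eq L1_norm_def expect_onto_def by (auto simp: le_max_iff_disj)
  qed simp
qed

section \<open>Functions on the torus\<close>

lemma continuous_on_to_circle: "continuous_on A to_circle"
proof (rule continuous_on_subset)
  show "continuous_on UNIV to_circle"
    unfolding continuous_on_open_vimage[OF open_UNIV] by (simp add: open_circle_def)
qed simp

text \<open>The preimage of the image is the union of the integer translates of U. Openness of the
  quotient map transports a countable basis from the line.\<close>

lemma open_to_circle_image:
  assumes "open U" shows "open (to_circle ` U)"
proof -
  have "to_circle -` (to_circle ` U) = (\<Union>k\<in>\<int>. (+) k ` U)"
  proof (intro set_eqI iffI)
    fix x assume "x \<in> to_circle -` (to_circle ` U)"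
    then obtain y where "y \<in> U" "x - y \<in> \<int>" by (auto simp: to_circle_eq_iff)
    then show "x \<in> (\<Union>k\<in>\<int>. (+) k ` U)"
      by (intro UN_I[of "x - y"] image_eqI[of _ _ y]) auto
  next
    fix x assume "x \<in> (\<Union>k\<in>\<int>. (+) k ` U)"
    then obtain k y where "k \<in> \<int>" "y \<in> U" "x = k + y" by auto
    then have "to_circle x = to_circle y" by (simp add: to_circle_eq_iff)
    then show "x \<in> to_circle -` (to_circle ` U)" using \<open>y \<in> U\<close> by auto
  qed
  moreover have "open (\<Union>k\<in>\<int>. (+) k ` U)"
    by (intro open_UN ballI open_translation assms)
  ultimately show ?thesis by (simp add: open_circle_def)
qed

lemma to_circle_rep: "to_circle (rep_circle z) = z"
  by (rule Quotient3_abs_rep[OF Quotient3_circle])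

text \<open>Required to derive measurability for the product measure from continuity on the
  torus.\<close>

instance circle :: second_countable_topology
proof
  obtain C :: "real set set" where C: "countable C" "topological_basis C"
    using ex_countable_basis by blast
  have "topological_basis ((`) to_circle ` C)"
  proof (rule topological_basisI)
    show "open U" if "U \<in> (`) to_circle ` C" for U
      using that topological_basis_open[OF C(2)] by (auto intro: open_to_circle_image)
  next
    fix U and z :: circle assume U: "open U" "z \<in> U"
    have "open (to_circle -` U)" "rep_circle z \<in> to_circle -` U"
      using U by (auto simp: open_circle_def to_circle_rep)
    then obtain V where V: "V \<in> C" "rep_circle z \<in> V" "V \<subseteq> to_circle -` U"
      by (rule topological_basisE[OF C(2)])
    show "\<exists>W\<in>(`) to_circle ` C. z \<in> W \<and> W \<subseteq> U"
    proof (intro bexI conjI)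
      show "z \<in> to_circle ` V" using V(2) to_circle_rep[of z] by force
    qed (use V in auto)
  qed
  then have "open = generate_topology ((`) to_circle ` C)"
    by (rule topological_basis_imp_subbasis)
  then show "\<exists>C :: circle set set. countable C \<and> open = generate_topology C"
    using C(1) by (intro exI[of _ "(`) to_circle ` C"]) simp
qed

text \<open>The section of the quotient map with values in [0, 1). It cuts the circle at 0, where it
  is discontinuous.\<close>

definition angle :: "circle \<Rightarrow> real" where
  "angle z = frac (rep_circle z)"

lemma angle_bounds: "0 \<le> angle z" "angle z < 1"
  by (simp_all add: angle_def frac_lt_1)

lemma to_circle_angle: "to_circle (angle z) = z"
proof -
  have "to_circle (angle z) = to_circle (rep_circle z)"
    by (simp add: to_circle_eq_iff angle_def frac_def)
  then show ?thesis by (simp add: to_circle_rep)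
qed

lemma angle_to_circle:
  assumes "0 \<le> t" "t < 1" shows "angle (to_circle t) = t"
proof -
  have "to_circle (angle (to_circle t)) = to_circle t" by (rule to_circle_angle)
  then have "angle (to_circle t) - t \<in> \<int>" by (simp add: to_circle_eq_iff)
  then obtain k where "angle (to_circle t) - t = of_int k" by (auto elim: Ints_cases)
  moreover have "\<bar>angle (to_circle t) - t\<bar> < 1"
    using angle_bounds[of "to_circle t"] assms by linarith
  ultimately have "k = 0" by linarith
  then show ?thesis using \<open>angle (to_circle t) - t = of_int k\<close> by simp
qed

lemma angle_vimage: "{z. angle z \<in> A} = to_circle ` (A \<inter> {0..<1})"
proof (intro set_eqI iffI)
  fix z assume "z \<in> {z. angle z \<in> A}"
  then show "z \<in> to_circle ` (A \<inter> {0..<1})"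
    using to_circle_angle[of z] angle_bounds[of z] by (intro image_eqI[of _ _ "angle z"]) auto
qed (auto simp: angle_to_circle)

text \<open>Apart from the cut, a sublevel set is an open arc. The cut itself is Borel as the
  complement of an open arc.\<close>

lemma angle_measurable [measurable]: "angle \<in> borel_measurable borel"
proof (rule borel_measurableI_less)
  fix c :: real
  have zero: "{to_circle 0} = - to_circle ` {0<..<1}"
  proof -
    have "to_circle ` {0<..<1} = {z. angle z \<in> {0<..}}"
      unfolding angle_vimage by (rule arg_cong[where f = "(`) to_circle"]) auto
    moreover have "{to_circle 0} = {z. angle z \<in> {0}}"
      unfolding angle_vimage by auto
    ultimately show ?thesis using angle_bounds(1) by (auto simp: less_le)
  qed
  have "{z. angle z < c} = {z. angle z \<in> {0} \<inter> {..<c}} \<union> {z. angle z \<in> {0<..<min c 1}}"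
    using angle_bounds by (auto simp: less_le)
  also have "{z. angle z \<in> {0} \<inter> {..<c}} = (if 0 < c then {to_circle 0} else {})"
    unfolding angle_vimage by auto
  also have "{z. angle z \<in> {0<..<min c 1}} = to_circle ` {0<..<min c 1}"
    unfolding angle_vimage by (rule arg_cong[where f = "(`) to_circle"]) auto
  finally show "{z \<in> space borel. angle z < c} \<in> sets borel"
    by (simp add: zero open_to_circle_image borel_comp)
qed

lemma compact_circle: "compact (UNIV :: circle set)"
proof -
  have "(UNIV :: circle set) = to_circle ` {0..1}"
    using angle_vimage[of UNIV] by fastforce
  then show ?thesis
    using compact_continuous_image[OF continuous_on_to_circle compact_Icc[of 0 1]] by simp
qed

lemma space_circle_haar [simp]: "space circle_haar = UNIV"
  and sets_circle_haar [simp, measurable_cong]: "sets circle_haar = sets borel"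
  by (simp_all add: circle_haar_def)

lemma integral_circle_haar:
  fixes g :: "circle \<Rightarrow> real"
  assumes [measurable]: "g \<in> borel_measurable borel"
  shows "(\<integral>z. g z \<partial>circle_haar) = (\<integral>r. indicator {0..<1} r * g (to_circle r) \<partial>lborel)"
proof -
  have "(\<integral>z. g z \<partial>circle_haar) = (\<integral>r. g (to_circle r) \<partial>restrict_space lborel {0..<1})"
    unfolding circle_haar_def by (intro integral_distr measurable_restrict_space1) simp_all
  also have "\<dots> = (\<integral>r. indicator {0..<1} r *\<^sub>R g (to_circle r) \<partial>lborel)"
    by (rule integral_restrict_space) simp
  finally show ?thesis by simp
qed

lemma torus_cell_product:
  assumes "0 < m"
  shows "cell_product circle_haar (\<lambda>z. interval_cell m (angle z)) m (J :: nat list) \<longleftrightarrow> distinct J"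
proof -
  have meas [measurable]: "(\<lambda>z. interval_cell m (angle z)) \<in> measurable borel (count_space UNIV)"
    by (rule measurable_compose[OF angle_measurable interval_cell_measurable])
  have "measure circle_haar {z. interval_cell m (angle z) = interval_cell m (angle s)} = 1 / m" for s
  proof -
    let ?j = "interval_cell m (angle s)"
    have "{z. interval_cell m (angle z) = ?j} \<in> sets borel"
      using measurable_sets[OF meas, of "{?j}"] by (simp add: vimage_def)
    then have "emeasure circle_haar {z. interval_cell m (angle z) = ?j}
        = emeasure lborel (to_circle -` {z. interval_cell m (angle z) = ?j} \<inter> {0..<1})"
      by (rule emeasure_circle_haar)
    also have "to_circle -` {z. interval_cell m (angle z) = ?j} \<inter> {0..<1} =
        {t \<in> {0..<1}. interval_cell m t = ?j}"
      by (auto simp: angle_to_circle)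
    also have "emeasure lborel \<dots> = ennreal (1 / m)"
      using emeasure_interval_cell[OF assms interval_cell_less[OF assms]] .
    finally show ?thesis by (simp add: measure_def)
  qed
  then show ?thesis
    unfolding cell_product_def cell_product_axioms_def
    using assms prob_space_circle_haar by auto
qed

text \<open>\<open>torus_partial\<close> differentiates at 0 along the line translated to each
  point. A shift by r turns this into a derivative at r of one periodic function on the real
  line.\<close>

lemma torus_line_has_vector_derivative:
  assumes "torus_line n f (x(n := to_circle r)) differentiable (at 0)"
  shows "((\<lambda>r. f (x(n := to_circle r))) has_vector_derivative torus_partial n f (x(n := to_circle r))) (at r)"
proof -
  \<comment> \<open>The base point 0 is written as r - r, the value at r of the inner function in
    the chain rule.\<close>
  have "(torus_line n f (x(n := to_circle r)) has_vector_derivative torus_partial n f (x(n := to_circle r)))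
      (at (r - r))"
    using assms by (simp add: torus_partial_def vector_derivative_works)
  then have "((torus_line n f (x(n := to_circle r)) \<circ> (\<lambda>y. y - r)) has_vector_derivative
      1 *\<^sub>R torus_partial n f (x(n := to_circle r))) (at r)"
    by (intro vector_diff_chain_at) (auto intro!: derivative_eq_intros)
  moreover have "torus_line n f (x(n := to_circle r)) \<circ> (\<lambda>y. y - r) = (\<lambda>r. f (x(n := to_circle r)))"
    by (auto simp: torus_line_def to_circle_add[symmetric] fun_eq_iff)
  ultimately show ?thesis by simp
qed

theorem torus_junta:
  fixes \<epsilon> :: real
  assumes "0 < \<epsilon>"
  shows "\<exists>q::nat. q \<ge> 1 \<and> (\<forall>N::nat. N \<ge> 1 \<longrightarrow> (\<forall>f :: (nat \<Rightarrow> circle) \<Rightarrow> 'k :: euclidean_space.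
    C1_torus N f \<and> torus_gradient_norm N f \<le> 1 \<and>
    L2_norm (torus_haar N) (\<lambda>x. f x - (\<integral>y. f y \<partial>torus_haar N)) \<le> 1 \<longrightarrow>
    (\<exists>S \<subseteq> {1..N}. card S \<le> q \<and>
      L1_norm (torus_haar N) (\<lambda>x. f x - expect_onto circle_haar N S f x) < \<epsilon>)))"
proof -
  have "0 < \<epsilon> / DIM('k)" using assms by simp
  then obtain m k :: nat and \<kappa> \<delta> :: real where par: "2 \<le> m" "0 < \<kappa>" "0 < \<delta>"
    "((1 - 1 / m) ^ (2 ^ k))\<^sup>2 * m \<le> 1 / 4"
    "8 * (1 / m) + sqrt (2 * \<kappa> * (1 / (1 - (1 - 1 / m)\<^sup>2)) + (1 / \<kappa> ^ (2 ^ k - 1))\<^sup>2 * \<delta> / (4 * \<kappa>)) < \<epsilon> / DIM('k)"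
    by (rule junta_parameters)
  have m: "0 < m" using par(1) by simp
  let ?cell = "\<lambda>z. interval_cell m (angle z)"
  show ?thesis
  proof (intro exI[of _ "max 1 (nat \<lceil>1 / \<delta>\<rceil>)"] conjI allI impI)
    fix N :: nat and f :: "(nat \<Rightarrow> circle) \<Rightarrow> 'k"
    assume "C1_torus N f \<and> torus_gradient_norm N f \<le> 1 \<and>
      L2_norm (torus_haar N) (\<lambda>x. f x - (\<integral>y. f y \<partial>torus_haar N)) \<le> 1"
    then have f: "continuous_on (torus N) f"
        "\<And>n x. n \<in> {1..N} \<Longrightarrow> x \<in> torus N \<Longrightarrow> torus_line n f x differentiable (at 0)"
        "\<And>n. n \<in> {1..N} \<Longrightarrow> continuous_on (torus N) (torus_partial n f)"
      and grad: "torus_gradient_norm N f \<le> 1"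
      and var: "L2_norm (torus_haar N) (\<lambda>x. f x - (\<integral>y. f y \<partial>torus_haar N)) \<le> 1"
      by (auto simp: C1_torus_def)
    let ?J = "[1..<Suc N]"
    interpret cell_product circle_haar ?cell m ?J
      by (subst torus_cell_product[OF m]) simp
    have id: "(\<lambda>t. t) \<in> borel_measurable circle_haar" by simp
    have PiE: "torus N = PiE {1..N} (\<lambda>_. space circle_haar)"
      by (simp add: torus_def)
    have P_space: "space (Pi\<^sub>M {1..N} (\<lambda>_. circle_haar)) = torus N"
      by (simp add: PiE space_PiM)
    have P_eq: "Pi\<^sub>M {1..N} (\<lambda>_. circle_haar) = torus_haar N" by (simp only: prod_measure_def)
    define d where "d n x = norm (torus_partial n f x)" for n x
    have d_cont: "continuous_on (torus N) (d n)" if "n \<in> {1..N}" for n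
      unfolding d_def by (intro continuous_on_norm f that)
    have "\<exists>b. \<forall>x\<in>torus N. \<bar>d n x\<bar> \<le> b" if n: "n \<in> {1..N}" for n
    proof -
      obtain b where "\<And>x. x \<in> torus N \<Longrightarrow> norm (d n x) \<le> b"
        using continuous_on_PiE_bounded[OF compact_circle d_cont[OF n, unfolded torus_def]]
        unfolding torus_def by blast
      then show ?thesis by auto
    qed
    then obtain b' where b': "\<And>n x. n \<in> {1..N} \<Longrightarrow> x \<in> torus N \<Longrightarrow> \<bar>d n x\<bar> \<le> b' n" by metis
    obtain b where b: "\<And>x. x \<in> torus N \<Longrightarrow> norm (f x) \<le> b"
      using continuous_on_PiE_bounded[OF compact_circle f(1)[unfolded torus_def]] unfolding torus_def by blast
    \<comment> \<open>The path runs between the representatives in [0, 1) and does not cross the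
      cut, so cells of the circle can be treated as intervals.\<close>
    have osc: "norm (f (x(n := s)) - f (x(n := t))) \<le> (\<integral>u. indicator A (angle u) * d n (x(n := u)) \<partial>circle_haar)"
      if n: "n \<in> {1..N}" and x: "x \<in> torus N"
        and A [measurable]: "A \<in> sets borel" and st: "angle s \<in> A" "angle t \<in> A"
        and conv: "\<And>s t. s \<in> A \<Longrightarrow> t \<in> A \<Longrightarrow> {s..t} \<subseteq> A" for n x s t A
    proof -
      have upd: "x(n := z) \<in> torus N" for z
        using x n by (auto simp: torus_def PiE_def Pi_def extensional_def)
      have "norm (f (x(n := to_circle (angle s))) - f (x(n := to_circle (angle t)))) \<le>
          (\<integral>r. indicator (A \<inter> {0..<1}) r * norm (torus_partial n f (x(n := to_circle r))) \<partial>lborel)"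
      proof (rule norm_diff_le_integral_unordered[where u = "\<lambda>r. f (x(n := to_circle r))"
            and u' = "\<lambda>r. torus_partial n f (x(n := to_circle r))"])
        show "((\<lambda>r. f (x(n := to_circle r))) has_vector_derivative torus_partial n f (x(n := to_circle r)))
            (at r within {0..1})" for r
          by (rule has_vector_derivative_at_within[OF torus_line_has_vector_derivative[OF f(2)[OF n upd]]])
        show "continuous_on {0..1} (\<lambda>r. torus_partial n f (x(n := to_circle r)))"
          by (rule continuous_on_compose2[OF f(3)[OF n] continuous_on_fun_upd[OF continuous_on_to_circle]])
            (use upd in auto)
        show "{s..t} \<subseteq> A \<inter> {0..<1}" if "s \<in> A \<inter> {0..<1}" "t \<in> A \<inter> {0..<1}" for s t
          using that conv[of s t] by auto
      qed (use st angle_bounds in auto)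
      also have "\<dots> = (\<integral>r. indicator {0..<1} r * (indicator A (angle (to_circle r)) * d n (x(n := to_circle r))) \<partial>lborel)"
        by (intro Bochner_Integration.integral_cong refl)
          (auto simp: d_def indicator_def angle_to_circle)
      also have "\<dots> = (\<integral>u. indicator A (angle u) * d n (x(n := u)) \<partial>circle_haar)"
      proof (rule integral_circle_haar[symmetric])
        have "continuous_on UNIV (\<lambda>u. d n (x(n := u)))"
          by (rule continuous_on_compose2[OF d_cont[OF n] continuous_on_fun_upd[OF continuous_on_id]])
            (use upd in auto)
        then have [measurable]: "(\<lambda>u. d n (x(n := u))) \<in> borel_measurable borel"
          by (rule borel_measurable_continuous_onI)
        show "(\<lambda>u. indicator A (angle u) * d n (x(n := u))) \<in> borel_measurable borel"
          by measurable
      qed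
      finally show ?thesis by (simp add: to_circle_angle)
    qed
    have total: "(\<Sum>n\<in>{1..N}. \<integral>x. d n x \<partial>torus_haar N) \<le> 1"
      using grad by (simp add: torus_gradient_norm_def L1_norm_def d_def)
    have var': "(\<integral>x. (norm (f x - (\<integral>y. f y \<partial>torus_haar N)))\<^sup>2 \<partial>torus_haar N) \<le> 1"
      using var by (simp add: L2_norm_def)
    have "\<exists>S\<subseteq>set ?J. card S \<le> nat \<lceil>1 / \<delta>\<rceil> \<and>
      (\<integral>x. norm (f x - (\<integral>y. f (merge S (set ?J - S) (x, y)) \<partial>Pi\<^sub>M (set ?J - S) (\<lambda>_. circle_haar))) \<partial>P)
        < DIM('k) * (\<epsilon> / DIM('k))"
    proof (rule vector_junta_approximation[where d = d and b = b and b' = b', OF _ _ _ _ _ _ _ _ par])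
      show "f \<in> borel_measurable P"
        unfolding set_upt_Icc by (intro continuous_on_measurable_PiM id f(1)[unfolded PiE])
      show "norm (f x) \<le> b" if "x \<in> space P" for x using b that by (simp only: set_upt_Icc P_space)
      show "d n \<in> borel_measurable P" if "n \<in> set ?J" for n
        using that unfolding set_upt_Icc by (intro continuous_on_measurable_PiM id d_cont[unfolded PiE])
      show "\<bar>d n x\<bar> \<le> b' n" if "n \<in> set ?J" "x \<in> space P" for n x
        using b' that by (simp only: P_space set_upt_Icc)
      show "norm (f (x(n := s)) - f (x(n := t))) \<le> (\<integral>u. d n (x(n := u)) \<partial>circle_haar)"
        if "n \<in> set ?J" "x \<in> space P" for n x s t
        using osc[of n x UNIV s t] that unfolding P_space set_upt_Icc by simp
      show "norm (f (x(n := s)) - f (x(n := t))) \<le>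
          (\<integral>u. of_bool (?cell s = ?cell u) * d n (x(n := u)) \<partial>circle_haar)"
        if "n \<in> set ?J" "x \<in> space P" "?cell s = ?cell t" for n x s t
      proof -
        define A where "A = {r. interval_cell m r = ?cell s}"
        have "A \<in> sets borel"
          using measurable_sets[OF interval_cell_measurable[of m], of "{?cell s}"]
          by (simp add: A_def vimage_def)
        then have "norm (f (x(n := s)) - f (x(n := t))) \<le> (\<integral>u. indicator A (angle u) * d n (x(n := u)) \<partial>circle_haar)"
          using that interval_cell_convex[of m _ "?cell s"] unfolding P_space set_upt_Icc
          by (intro osc) (auto simp: A_def)
        then show ?thesis by (simp add: A_def indicator_def eq_commute)
      qed
      show "(\<Sum>n\<in>set ?J. \<integral>x. d n x \<partial>P) \<le> 1" using total unfolding set_upt_Icc P_eq .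
      show "(\<integral>x. (norm (f x - (\<integral>y. f y \<partial>P)))\<^sup>2 \<partial>P) \<le> 1" using var' unfolding set_upt_Icc P_eq .
    qed
    then show "\<exists>S \<subseteq> {1..N}. card S \<le> max 1 (nat \<lceil>1 / \<delta>\<rceil>) \<and>
      L1_norm (torus_haar N) (\<lambda>x. f x - expect_onto circle_haar N S f x) < \<epsilon>"
      unfolding set_upt_Icc P_eq L1_norm_def expect_onto_def by (auto simp: le_max_iff_disj)
  qed simp
qed

theorem theorem2p1:
  shows "(\<forall>\<epsilon>::real. \<epsilon> > 0 \<longrightarrow> (\<exists>q::nat. q \<ge> 1 \<and>
           (\<forall>N::nat. N \<ge> 1 \<longrightarrow>
             (\<forall>f :: (nat \<Rightarrow> circle) \<Rightarrow> 'k :: {real_normed_field, euclidean_space}.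
               C1_torus N f \<and> torus_gradient_norm N f \<le> 1 \<and>
               L2_norm (torus_haar N) (\<lambda>x. f x - (\<integral>y. f y \<partial>torus_haar N)) \<le> 1 \<longrightarrow>
               (\<exists>S \<subseteq> {1..N}. card S \<le> q \<and>
                 L1_norm (torus_haar N) (\<lambda>x. f x - expect_onto circle_haar N S f x) < \<epsilon>)))))
       \<and> (\<forall>\<epsilon>::real. \<epsilon> > 0 \<longrightarrow> (\<exists>q'::nat. q' \<ge> 1 \<and>
           (\<forall>N::nat. N \<ge> 1 \<longrightarrow>
             (\<forall>f :: (nat \<Rightarrow> real) \<Rightarrow> 'k.
               C1_cube N f \<and> cube_gradient_norm N f \<le> 1 \<and>
               L2_norm (cube_lebesgue N) (\<lambda>x. f x - (\<integral>y. f y \<partial>cube_lebesgue N)) \<le> 1 \<longrightarrow>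
               (\<exists>S \<subseteq> {1..N}. card S \<le> q' \<and>
                 L1_norm (cube_lebesgue N) (\<lambda>x. f x - expect_onto unit_interval N S f x) < \<epsilon>)))))"
  by (intro conjI allI impI; (rule torus_junta | rule cube_junta))

end
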